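(* Let $\mathbf u$ be a velocity field on $\mathbb R^3$ with correlation function $\Gamma$, second order structure function $S_2$ and energy spectrum $E$ as defined in the context, with $\Gamma$ satisfying the decay assumption stated there. Let $0<\alpha<2$. (i) Suppose there are $c>0$ and $\ell_0>0$ such that $S_2(\ell)=c\,\ell^\alpha$ for all $\ell<\ell_0$. Then $$E(\kappa)=\frac{c(\kappa)}{\kappa^{1+\alpha}},\quad\text{where } c(\kappa)\to c_0 \text{ as }\kappa\to\infty\text{ for some constant } c_0>0.$$ (ii) Conversely, suppose there are $c>0$ and $\kappa_0>0$ such that $E(\kappa)=c\,\kappa^{-1-\alpha}$ for all $\kappa\ge\kappa_0$. Then $$S_2(\ell)=c(\ell)\,\ell^{\alpha},\quad\text{where } c(\ell)\to c_0\text{ as }\ell\to0\text{ for some constant } c_0>0.$$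
   Context: $\mathbf u\in L^2(\mathbb R^3;\mathbb R^3)$, $\langle g\rangle=\int_{\mathbb R^3}g\,dx$, $O(3)$ is the orthogonal group of $\mathbb R^3$ with normalized Haar measure $\nu$. The correlation function is $$\Gamma(\mathbf y)=\tfrac12\int_{O(3)}\langle\mathbf u(\cdot+A\mathbf y)\cdot\mathbf u(\cdot)\rangle\,d\nu(A),\quad \mathbf y\in\mathbb R^3,$$ a radial function. The second order structure function is $$S_2(\ell)=\tfrac14\int_{O(3)}\langle|\mathbf u(\cdot+A\mathbf y)-\mathbf u(\cdot)|^2\rangle\,d\nu(A),\quad \ell=|\mathbf y|,$$ so $\Gamma(\mathbf y)=\Gamma(0)-S_2(|\mathbf y|)$. The energy spectrum is $E(\kappa)=4\pi\kappa^2E_{3D}(\boldsymbol\kappa)$, $\kappa=|\boldsymbol\kappa|>0$, where $E_{3D}(\boldsymbol\kappa)=\int_{\mathbb R^3}e^{-i\boldsymbol\kappa\cdot\mathbf y}\,\Gamma(\mathbf y)\,d\mathbf y$ is the Fourier transform of $\Gamma$ (in the sense of tempered distributions; up to normalization it is the spherical average of $|\hat{\mathbf u}|^2$, a radial $L^1$ function, and identities for $E(\kappa)$ are understood for a.e. $\kappa$, or for the continuous representative where there is one). Decay assumption: $\Gamma$ is $C^5$ on $\mathbb R^3\setminus\{0\}$ and for every $r>0$ there is a constant $C_r$ with $|\nabla^k\Gamma(\mathbf y)|\le \dfrac{C_r}{1+|\mathbf y|^{k-1}}$ for all $|\mathbf y|\ge r$ and $0\le k\le5$. *)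

theory Defs
  imports "HOL-Probability.Probability_Measure"
begin

section \<open>Normalized Haar measure on the orthogonal group\<close>

abbreviation O3 :: "(real^3^3) set"
  where "O3 \<equiv> {A. orthogonal_matrix A}"

text \<open>The library has no Haar measures. On the compact group \<open>O3\<close> the normalized Haar measure is the
  unique left-invariant Borel probability measure.\<close>

definition normalized_haar_O3 :: "(real^3^3) measure \<Rightarrow> bool"
  where "normalized_haar_O3 \<nu> \<longleftrightarrow>
    prob_space \<nu> \<and> sets \<nu> = sets (restrict_space borel O3) \<and>
    (\<forall>B\<in>O3. distr \<nu> \<nu> (\<lambda>A. B ** A) = \<nu>)"


section \<open>Correlation function and structure function\<close>

definition square_integrable :: "(real^3 \<Rightarrow> real^3) \<Rightarrow> bool"
  where "square_integrable u \<longleftrightarrow>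
    u \<in> borel_measurable lebesgue \<and> integrable lebesgue (\<lambda>x. (norm (u x))\<^sup>2)"

definition correlation :: "(real^3^3) measure \<Rightarrow> (real^3 \<Rightarrow> real^3) \<Rightarrow> real^3 \<Rightarrow> real"
  where "correlation \<nu> u y =
    1/2 * (\<integral>A. (\<integral>x. u (x + A *v y) \<bullet> u x \<partial>lebesgue) \<partial>\<nu>)"

definition structure2_vec :: "(real^3^3) measure \<Rightarrow> (real^3 \<Rightarrow> real^3) \<Rightarrow> real^3 \<Rightarrow> real"
  where "structure2_vec \<nu> u y =
    1/4 * (\<integral>A. (\<integral>x. (norm (u (x + A *v y) - u x))\<^sup>2 \<partial>lebesgue) \<partial>\<nu>)"

text \<open>For \<open>l \<ge> 0\<close> any vector of length \<open>l\<close> may be used in place of \<open>l *\<^sub>R axis 1 1\<close>; see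
  \<open>structure2_norm\<close> below.\<close>

definition structure2 :: "(real^3^3) measure \<Rightarrow> (real^3 \<Rightarrow> real^3) \<Rightarrow> real \<Rightarrow> real"
  where "structure2 \<nu> u l = structure2_vec \<nu> u (l *\<^sub>R axis 1 1)"


section \<open>Iterated partial derivatives and the decay assumption\<close>

definition partial :: "'n \<Rightarrow> (real^'n \<Rightarrow> 'a::real_normed_vector) \<Rightarrow> real^'n \<Rightarrow> 'a"
  where "partial i f x = frechet_derivative f (at x) (axis i 1)"

primrec iter_partial :: "'n list \<Rightarrow> (real^'n \<Rightarrow> 'a::real_normed_vector) \<Rightarrow> real^'n \<Rightarrow> 'a"
  where
    "iter_partial [] f = f"
  | "iter_partial (i # is) f = partial i (iter_partial is f)"

text \<open>Intended for open \<open>S\<close>.\<close>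

definition C_on :: "nat \<Rightarrow> (real^'n) set \<Rightarrow> (real^'n \<Rightarrow> 'a::real_normed_vector) \<Rightarrow> bool"
  where "C_on n S f \<longleftrightarrow>
    (\<forall>is. length is < n \<longrightarrow> (\<forall>x\<in>S. iter_partial is f differentiable (at x))) \<and>
    (\<forall>is. length is \<le> n \<longrightarrow> continuous_on S (iter_partial is f))"

text \<open>The Euclidean norm of the tensor of all partial derivatives of order \<open>k\<close>.\<close>

definition grad_norm :: "nat \<Rightarrow> (real^'n \<Rightarrow> real) \<Rightarrow> real^'n \<Rightarrow> real"
  where "grad_norm k f y = sqrt (\<Sum>is | length is = k. (iter_partial is f y)\<^sup>2)"

text \<open>The exponent \<open>k - 1\<close> is an integer: it is \<open>-1\<close> for \<open>k = 0\<close>.\<close>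

definition decay_assumption :: "(real^3 \<Rightarrow> real) \<Rightarrow> bool"
  where "decay_assumption G \<longleftrightarrow>
    C_on 5 (- {0}) G \<and>
    (\<forall>r>0. \<exists>C. \<forall>y. r \<le> norm y \<longrightarrow>
       (\<forall>k\<le>5. grad_norm k G y \<le> C / (1 + norm y powi (int k - 1))))"


section \<open>Fourier transform of tempered distributions and the energy spectrum\<close>

definition schwartz :: "(real^'n \<Rightarrow> complex) \<Rightarrow> bool"
  where "schwartz \<phi> \<longleftrightarrow>
    (\<forall>n. C_on n UNIV \<phi>) \<and>
    (\<forall>m is. \<exists>C. \<forall>x. norm x ^ m * norm (iter_partial is \<phi> x) \<le> C)"

definition fourier :: "(real^'n \<Rightarrow> complex) \<Rightarrow> real^'n \<Rightarrow> complex"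
  where "fourier \<phi> y = (\<integral>k. exp (- \<i> * complex_of_real (k \<bullet> y)) * \<phi> k \<partial>lebesgue)"

text \<open>Functions that define a tempered distribution \<open>\<phi> \<mapsto> \<integral>f \<phi>\<close>.\<close>

definition tempered_function :: "(real^'n \<Rightarrow> complex) \<Rightarrow> bool"
  where "tempered_function f \<longleftrightarrow>
    (\<forall>\<phi>. schwartz \<phi> \<longrightarrow> integrable lebesgue (\<lambda>x. f x * \<phi> x))"

text \<open>The Fourier transform of the tempered distribution given by \<open>f\<close> is the one given by \<open>g\<close>.
  This determines \<open>g\<close> only up to a null set.\<close>

definition has_tempered_fourier :: "(real^'n \<Rightarrow> complex) \<Rightarrow> (real^'n \<Rightarrow> complex) \<Rightarrow> bool"
  where "has_tempered_fourier f g \<longleftrightarrow>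
    tempered_function f \<and> tempered_function g \<and>
    (\<forall>\<phi>. schwartz \<phi> \<longrightarrow>
       (\<integral>k. g k * \<phi> k \<partial>lebesgue) = (\<integral>y. f y * fourier \<phi> y \<partial>lebesgue))"

text \<open>\<open>E\<close> is a representative of the energy spectrum. The spectrum is determined by \<open>u\<close> almost
  everywhere on \<open>(0, \<infinity>)\<close>; values of \<open>E\<close> on \<open>(-\<infinity>, 0]\<close> play no role.\<close>

definition energy_spectrum ::
  "(real^3^3) measure \<Rightarrow> (real^3 \<Rightarrow> real^3) \<Rightarrow> (real \<Rightarrow> real) \<Rightarrow> bool"
  where "energy_spectrum \<nu> u E \<longleftrightarrow>
    (\<exists>E3D. has_tempered_fourier (\<lambda>y. complex_of_real (correlation \<nu> u y))
                                (\<lambda>k. complex_of_real (E3D k)) \<and>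
       (AE k in lebesgue. E (norm k) = 4 * pi * (norm k)\<^sup>2 * E3D k))"


section \<open>The structure function depends on the length only\<close>

lemma space_haar_O3: "normalized_haar_O3 \<nu> \<Longrightarrow> space \<nu> = O3"
  unfolding normalized_haar_O3_def
  by (metis sets_eq_imp_space_eq space_borel space_restrict_space inf_top_right)

lemma continuous_on_transpose: "continuous_on S (transpose :: real^3^3 \<Rightarrow> real^3^3)"
  unfolding transpose_def by (intro continuous_intros)

lemma continuous_on_matrix_mul:
  assumes "continuous_on S f" "continuous_on S g"
  shows "continuous_on S (\<lambda>x. (f x :: real^3^3) ** (g x :: real^3^3))"
  unfolding matrix_matrix_mult_def by (intro continuous_intros assms)

lemma normalized_haar_O3_right_invariant:
  assumes h: "normalized_haar_O3 \<nu>" and B: "B \<in> O3"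
  shows "distr \<nu> \<nu> (\<lambda>A. A ** B) = \<nu>"
proof -
  interpret prob_space \<nu> using h by (simp add: normalized_haar_O3_def)
  have sp: "space \<nu> = O3" by (rule space_haar_O3[OF h])
  have st: "sets \<nu> = sets (restrict_space borel O3)"
    and linv: "\<And>B. B \<in> O3 \<Longrightarrow> distr \<nu> \<nu> (\<lambda>A. B ** A) = \<nu>"
    using h by (auto simp: normalized_haar_O3_def)
  have idm: "(\<lambda>A. A) \<in> measurable \<nu> borel"
    by (subst measurable_cong_sets[OF st refl]) (rule measurable_restrict_space1, simp)
  have intoN: "f \<in> measurable M \<nu>"
    if "f \<in> measurable M borel" "\<And>x. x \<in> space M \<Longrightarrow> f x \<in> O3" for f and M :: "'z measure"
    by (subst measurable_cong_sets[OF refl st]) (auto intro!: measurable_restrict_space2 that)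
  have mul_b: "(\<lambda>p. fst p ** snd p) \<in> measurable (\<nu> \<Otimes>\<^sub>M \<nu>) borel"
  proof -
    have "(\<lambda>p. fst p ** (snd p :: real^3^3) :: real^3^3) \<in> borel_measurable (borel \<Otimes>\<^sub>M borel)"
      unfolding borel_prod
      by (intro borel_measurable_continuous_onI continuous_on_matrix_mul continuous_intros)
    moreover have "(\<lambda>p. (fst p, snd p)) \<in> measurable (\<nu> \<Otimes>\<^sub>M \<nu>) (borel \<Otimes>\<^sub>M borel)"
      by (intro measurable_Pair measurable_compose[OF measurable_fst idm]
          measurable_compose[OF measurable_snd idm])
    ultimately show ?thesis
      by (auto dest: measurable_compose)
  qed
  have mul: "(\<lambda>p. fst p ** snd p) \<in> measurable (\<nu> \<Otimes>\<^sub>M \<nu>) \<nu>"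
    by (rule intoN[OF mul_b]) (auto simp: space_pair_measure sp intro: orthogonal_matrix_mul)
  have tr: "transpose \<in> measurable \<nu> \<nu>"
    by (rule intoN) (auto simp: sp intro!: measurable_compose[OF idm]
        borel_measurable_continuous_onI continuous_on_transpose)
  have R: "(\<lambda>A. A ** C) \<in> measurable \<nu> \<nu>" if "C \<in> O3" for C
    using measurable_compose[OF measurable_Pair[OF measurable_ident measurable_const[of C \<nu> \<nu>]] mul] that
    by (simp add: sp)
  have L: "(\<lambda>A. C ** A) \<in> measurable \<nu> \<nu>" if "C \<in> O3" for C
    using measurable_compose[OF measurable_Pair[OF measurable_const[of C \<nu> \<nu>] measurable_ident] mul] that
    by (simp add: sp)
  let ?i = "\<lambda>S. \<integral>\<^sup>+ A. indicator S (transpose A) \<partial>\<nu>"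
  have key: "emeasure \<nu> S = ?i S" if S: "S \<in> sets \<nu>" for S
  proof -
    interpret P: pair_sigma_finite \<nu> \<nu> by standard
    have m2: "(\<lambda>p. transpose (fst p) ** snd p) \<in> measurable (\<nu> \<Otimes>\<^sub>M \<nu>) \<nu>"
      using measurable_compose[OF measurable_Pair[OF measurable_compose[OF measurable_fst tr] measurable_snd] mul]
      by simp
    have m3: "(\<lambda>p. indicator S (transpose (fst p) ** snd p) :: ennreal) \<in> borel_measurable (\<nu> \<Otimes>\<^sub>M \<nu>)"
      using measurable_compose[OF m2 borel_measurable_indicator[OF S]] .
    have a: "(\<integral>\<^sup>+ A. indicator S (transpose D ** A) \<partial>\<nu>) = emeasure \<nu> S" if "D \<in> space \<nu>" for D
    proof -
      have D: "transpose D \<in> O3" using that by (simp add: sp)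
      have "emeasure \<nu> S = (\<integral>\<^sup>+ A. indicator S A \<partial>distr \<nu> \<nu> (\<lambda>A. transpose D ** A))"
        using S linv[OF D] by simp
      also have "\<dots> = (\<integral>\<^sup>+ A. indicator S (transpose D ** A) \<partial>\<nu>)"
        by (rule nn_integral_distr[OF L[OF D]]) (use S in simp)
      finally show ?thesis by simp
    qed
    have b: "(\<integral>\<^sup>+ D. indicator S (transpose D ** A) \<partial>\<nu>) = ?i S" if "A \<in> space \<nu>" for A
    proof -
      have A: "transpose A \<in> O3" using that by (simp add: sp)
      have "?i S = (\<integral>\<^sup>+ D. indicator S (transpose D) \<partial>distr \<nu> \<nu> (\<lambda>D. transpose A ** D))"
        using linv[OF A] by simp
      also have "\<dots> = (\<integral>\<^sup>+ D. indicator S (transpose (transpose A ** D)) \<partial>\<nu>)"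
        by (rule nn_integral_distr[OF L[OF A]])
          (use measurable_compose[OF tr borel_measurable_indicator[OF S]] in simp)
      finally show ?thesis by (simp add: matrix_transpose_mul)
    qed
    have "emeasure \<nu> S = (\<integral>\<^sup>+ D. (\<integral>\<^sup>+ A. indicator S (transpose D ** A) \<partial>\<nu>) \<partial>\<nu>)"
      by (simp add: a emeasure_space_1 cong: nn_integral_cong)
    also have "\<dots> = (\<integral>\<^sup>+ A. (\<integral>\<^sup>+ D. indicator S (transpose D ** A) \<partial>\<nu>) \<partial>\<nu>)"
      using P.Fubini[OF m3] by simp
    also have "\<dots> = ?i S"
      by (simp add: b emeasure_space_1 cong: nn_integral_cong)
    finally show ?thesis .
  qed
  show ?thesis
  proof (rule measure_eqI)
    fix S assume "S \<in> sets (distr \<nu> \<nu> (\<lambda>A. A ** B))"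
    then have S: "S \<in> sets \<nu>" by simp
    let ?T = "(\<lambda>A. A ** B) -` S \<inter> space \<nu>"
    have T: "?T \<in> sets \<nu>" by (rule measurable_sets[OF R[OF B] S])
    have Bt: "transpose B \<in> O3" using B by simp
    have "emeasure (distr \<nu> \<nu> (\<lambda>A. A ** B)) S = ?i ?T"
      using emeasure_distr[OF R[OF B] S] key[OF T] by simp
    also have "\<dots> = (\<integral>\<^sup>+ A. indicator S (transpose (transpose B ** A)) \<partial>\<nu>)"
      by (rule nn_integral_cong) (auto simp: sp indicator_def matrix_transpose_mul)
    also have "\<dots> = (\<integral>\<^sup>+ A. indicator S (transpose A) \<partial>distr \<nu> \<nu> (\<lambda>A. transpose B ** A))"
      by (rule nn_integral_distr[OF L[OF Bt], symmetric])
        (use measurable_compose[OF tr borel_measurable_indicator[OF S]] in simp)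
    also have "\<dots> = emeasure \<nu> S"
      using linv[OF Bt] key[OF S] by simp
    finally show "emeasure (distr \<nu> \<nu> (\<lambda>A. A ** B)) S = emeasure \<nu> S" .
  qed simp
qed

lemma haar_average_radial:
  fixes F :: "real^3 \<Rightarrow> real"
  assumes h: "normalized_haar_O3 \<nu>" and "norm y = norm z"
  shows "(\<integral>A. F (A *v y) \<partial>\<nu>) = (\<integral>A. F (A *v z) \<partial>\<nu>)"
proof -
  obtain T where T: "orthogonal_transformation T" "T y = z"
    using orthogonal_transformation_exists[OF \<open>norm y = norm z\<close>] by blast
  define B where "B = matrix T"
  have B: "B \<in> O3" and Bz: "B *v y = z"
    using T by (auto simp: B_def orthogonal_transformation_matrix matrix_works)
  have sp: "space \<nu> = O3" by (rule space_haar_O3[OF h])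
  have R: "(\<lambda>A. A ** C) \<in> measurable \<nu> \<nu>" if "C \<in> O3" for C
  proof -
    have st: "sets \<nu> = sets (restrict_space borel O3)"
      using h by (simp add: normalized_haar_O3_def)
    have "(\<lambda>A. A ** C) \<in> measurable (restrict_space borel O3) (restrict_space borel O3)"
      using that
      by (intro measurable_restrict_space3 borel_measurable_continuous_onI
          continuous_on_matrix_mul continuous_intros) (auto intro: orthogonal_matrix_mul)
    then show ?thesis by (simp cong: measurable_cong_sets add: st)
  qed
  let ?g = "\<lambda>A. F (A *v y)"
  have eq: "?g (A ** B) = F (A *v z)" for A :: "real^3^3"
    by (simp add: Bz flip: matrix_vector_mul_assoc)
  show ?thesis
  proof (cases "?g \<in> borel_measurable \<nu>")
    case True
    have "(\<integral>A. ?g A \<partial>\<nu>) = (\<integral>A. ?g A \<partial>distr \<nu> \<nu> (\<lambda>A. A ** B))"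
      using normalized_haar_O3_right_invariant[OF h B] by simp
    also have "\<dots> = (\<integral>A. ?g (A ** B) \<partial>\<nu>)"
      by (rule integral_distr[OF R[OF B] True])
    finally show ?thesis by (simp only: eq)
  next
    case False
    have "(\<lambda>A. F (A *v z)) \<notin> borel_measurable \<nu>"
    proof
      assume "(\<lambda>A. F (A *v z)) \<in> borel_measurable \<nu>"
      from measurable_compose[OF R this] B
      have "(\<lambda>A. F ((A ** transpose B) *v z)) \<in> borel_measurable \<nu>" by simp
      moreover have "(A ** transpose B) *v z = A *v y" for A :: "real^3^3"
        using B by (simp add: Bz[symmetric] matrix_vector_mul_assoc orthogonal_matrix_def
            flip: matrix_mul_assoc)
      ultimately show False using False by simp
    qed
    with False show ?thesis
      by (metis (no_types, lifting) borel_measurable_integrable not_integrable_integral_eq)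
  qed
qed

lemma structure2_norm:
  assumes "normalized_haar_O3 \<nu>"
  shows "structure2 \<nu> u (norm y) = structure2_vec \<nu> u y"
  unfolding structure2_def structure2_vec_def
  using haar_average_radial[OF assms, of "norm y *\<^sub>R axis 1 1" y
      "\<lambda>z. \<integral>x. (norm (u (x + z) - u x))\<^sup>2 \<partial>lebesgue"]
  by simp

end

theory Submission
  imports Defs "HOL-Probability.Probability" "HOL-Real_Asymp.Real_Asymp"
begin

text \<open>
The correlation is radial, \<open>\<Gamma>(y) = \<gamma>(|y|)\<close>, and the relation \<open>E(|k|) = 4\<pi>|k|\<^sup>2 E3D(k)\<close> makes the
spectrum radial as well. Radial functions are determined by their integrals against Gaussians, so it
suffices to test the Fourier relation between \<open>\<Gamma>\<close> and \<open>E3D\<close> with \<open>exp(-t|k|\<^sup>2)\<close>, \<open>t > 0\<close>. The Fourier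
transform of a Gaussian is a Gaussian, and integration over spheres leaves
  \<open>\<integral> E(k) exp(-tk\<^sup>2) dk = 4\<pi> (\<pi>/t)^(3/2) \<integral> r\<^sup>2 \<gamma>(r) exp(-r\<^sup>2/(4t)) dr\<close>
with both integrals over \<open>(0, \<infinity>)\<close>; this is the locale \<open>spectral_pair\<close>, and
\<open>energy_spectrum_gauss_moments\<close> establishes it. Each side is a Laplace transform in the squared variable
and therefore injective, by the Weierstrass theorem (\<open>gauss_laplace_unique\<close>). So \<open>E\<close> or \<open>\<gamma>\<close> is
identified by exhibiting a candidate with the right Gaussian moments.

The two power laws are linked by the scaling identity
  \<open>A r^\<alpha> = \<integral> (1 - sin(kr)/(kr)) k^(-1-\<alpha>) dk\<close>,
where \<open>A\<close> is finite and positive because \<open>0 < \<alpha> < 2\<close> (\<open>sinc_moment_scaling\<close>, \<open>sinc_moment_pos\<close>).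

From spectrum to structure function: \<open>E\<close> is integrable, and
\<open>\<gamma>(r) = (8\<pi>\<^sup>3)^(-1) \<integral> E(k) sin(kr)/(kr) dk\<close>, because both sides are continuous and have the same Gaussian
moments (\<open>correlation_of_spectrum\<close>); continuity of \<open>\<Gamma>\<close> at the origin is the continuity of translations
in \<open>L\<^sup>2\<close>. Hence \<open>S2(l) = \<gamma>(0) - \<gamma>(l) = (8\<pi>\<^sup>3)^(-1) \<integral> E(k) (1 - sin(kl)/(kl)) dk\<close>. If \<open>E\<close> were
\<open>c k^(-1-\<alpha>)\<close> on all of \<open>(0, \<infinity>)\<close> this would be \<open>cA l^\<alpha> / (8\<pi>\<^sup>3)\<close>; the discrepancy at bounded \<open>k\<close>
contributes \<open>O(l\<^sup>2) = o(l^\<alpha>)\<close> (\<open>increment_of_power_spectrum\<close>).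

From structure function to spectrum: now \<open>\<gamma>(r) = \<gamma>(0) - c r^\<alpha>\<close> near the origin, so the remainder
\<open>r (\<gamma>(r) - \<gamma>(0) + c r^\<alpha>)\<close> vanishes there, and by the decay of \<open>\<gamma>\<close> its fourth derivative \<open>p\<close> is
integrable. Formally \<open>E(k)\<close> is \<open>16\<pi>\<^sup>2 k\<close> times the sine transform of \<open>r \<gamma>(r)\<close>, and four derivatives of
\<open>r \<gamma>(r)\<close> amount to the factor \<open>k\<^sup>4\<close>; they remove the linear part of \<open>r \<gamma>(r)\<close>, its power contributes
a power of \<open>k\<close>, and
  \<open>k\<^sup>4 E(k) = 8\<pi>\<^sup>3 c/A k^(3-\<alpha>) + 16\<pi>\<^sup>2 k \<integral> sin(kr) p(r) dr\<close>
(\<open>spectrum_of_power_law\<close>). This is proved on Gaussian moments: two derivatives in \<open>t\<close> of the moment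
identity produce the factor \<open>k\<^sup>4\<close> on one side and four derivatives in \<open>r\<close> of \<open>r exp(-r\<^sup>2/(4t))\<close> on the
other, which integration by parts moves to \<open>r \<gamma>(r)\<close>. The last integral is bounded, so
\<open>E(k) = k^(-1-\<alpha>) (8\<pi>\<^sup>3 c/A + O(k^(\<alpha>-2)))\<close>.
\<close>

section \<open>Lebesgue measure on the positive half-line\<close>

abbreviation gexp :: "real \<Rightarrow> real \<Rightarrow> real"
  where "gexp s x \<equiv> exp (- s * x\<^sup>2)"

text \<open>Short for half-line. Restricting the measure, rather than multiplying integrands by an indicator,
  makes positivity of the variable available from membership in the space.\<close>

abbreviation hl :: "real measure"
  where "hl \<equiv> restrict_space lborel {0<..}"

lemma measurable_hl: "f \<in> borel_measurable borel \<Longrightarrow> f \<in> borel_measurable hl"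
  by (intro measurable_restrict_space1) simp

lemma measurable_hl_continuous:
  fixes f :: "real \<Rightarrow> 'a::topological_space"
  assumes "continuous_on {0<..} f" shows "f \<in> borel_measurable hl"
  using borel_measurable_continuous_on_restrict[OF assms]
  by (simp add: measurable_cong_sets[OF sets_restrict_space_cong[OF sets_lborel] refl])

lemma sigma_finite_hl: "sigma_finite_measure hl"
  by (intro sigma_finite_measure_restrict_space sigma_finite_lborel) simp

lemma integral_hl: "(\<integral>x. f x \<partial>hl) = (\<integral>x. indicator {0<..} x *\<^sub>R f x \<partial>lborel)"
  for f :: "real \<Rightarrow> 'b::{banach,second_countable_topology}"
  by (simp add: integral_restrict_space)

lemma integrable_hl: "integrable hl f \<longleftrightarrow> integrable lborel (\<lambda>x. indicator {0<..} x *\<^sub>R f x)"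
  for f :: "real \<Rightarrow> 'b::{banach,second_countable_topology}"
  by (simp add: integrable_restrict_space)

lemma integrable_hl_lborel: "integrable lborel f \<Longrightarrow> integrable hl f"
  for f :: "real \<Rightarrow> 'b::{banach,second_countable_topology}"
  unfolding integrable_hl by (intro integrable_mult_indicator) auto

lemma ident_hl: "(\<lambda>x. x) \<in> measurable hl borel"
  by (rule measurable_hl) simp

lemma measurable_hl_pair:
  assumes "(\<lambda>(x::real, y::real). f x y) \<in> borel_measurable borel"
  shows "(\<lambda>(x, y). f x y) \<in> borel_measurable (hl \<Otimes>\<^sub>M hl)"
proof -
  have "(\<lambda>p. (fst p, snd p)) \<in> measurable (hl \<Otimes>\<^sub>M hl) (borel \<Otimes>\<^sub>M borel)"
    by (intro measurable_Pair measurable_compose[OF measurable_fst ident_hl]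
        measurable_compose[OF measurable_snd ident_hl])
  from measurable_compose[OF this] show ?thesis
    using assms by (simp add: borel_prod)
qed

lemma FTC_hl:
  fixes f F :: "real \<Rightarrow> real"
  assumes "\<And>r. 0 < r \<Longrightarrow> (F has_real_derivative f r) (at r)"
    and "continuous_on {0<..} f" "integrable hl f"
    and A: "(F \<longlongrightarrow> A) (at_right 0)" and B: "(F \<longlongrightarrow> B) at_top"
  shows "(\<integral>r. f r \<partial>hl) = B - A"
proof -
  have e: "einterval 0 \<infinity> = {0<..}" by (auto simp: einterval_def)
  have "(LBINT x=0..\<infinity>. f x) = B - A"
  proof (rule interval_integral_FTC_integrable)
    show "(F has_vector_derivative f x) (at x)" if "0 < ereal x" for x
      using assms(1)[of x] that by (simp add: has_real_derivative_iff_has_vector_derivative)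
    show "isCont f x" if "0 < ereal x" for x
      using assms(2) that by (simp add: continuous_on_eq_continuous_at)
    show "set_integrable lborel (einterval 0 \<infinity>) f"
      using assms(3) by (simp add: e set_integrable_def integrable_hl)
    show "((F \<circ> real_of_ereal) \<longlongrightarrow> A) (at_right 0)"
      using A by (simp add: zero_ereal_def ereal_tendsto_simps)
    show "((F \<circ> real_of_ereal) \<longlongrightarrow> B) (at_left \<infinity>)"
      using B by (simp add: ereal_tendsto_simps)
  qed simp
  then show ?thesis
    by (simp add: interval_lebesgue_integral_def e set_lebesgue_integral_def integral_hl)
qed


text \<open>A product majorant is the form in which absolute integrability is available whenever the order
  of integration is exchanged below.\<close>

lemma Fubini_hl_dominated:
  fixes f :: "real \<Rightarrow> real \<Rightarrow> real"
  assumes m: "(\<lambda>(x, y). f x y) \<in> borel_measurable (hl \<Otimes>\<^sub>M hl)"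
    and a: "integrable hl a" and b: "integrable hl b"
    and bound: "\<And>x y. 0 < x \<Longrightarrow> 0 < y \<Longrightarrow> \<bar>f x y\<bar> \<le> a x * b y"
  shows "(\<integral>x. (\<integral>y. f x y \<partial>hl) \<partial>hl) = (\<integral>y. (\<integral>x. f x y \<partial>hl) \<partial>hl)"
    and "integrable hl (\<lambda>x. \<integral>y. f x y \<partial>hl)" and "integrable hl (\<lambda>y. \<integral>x. f x y \<partial>hl)"
proof -
  interpret S: sigma_finite_measure hl by (rule sigma_finite_hl)
  interpret P: pair_sigma_finite hl hl ..
  have [measurable]: "a \<in> borel_measurable hl" "b \<in> borel_measurable hl"
    using a b by (simp_all add: borel_measurable_integrable)
  have ab: "integrable (hl \<Otimes>\<^sub>M hl) (\<lambda>p. a (fst p) * b (snd p))"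
  proof (rule P.Fubini_integrable)
    have "(\<lambda>x. \<integral>y. norm (a (fst (x, y)) * b (snd (x, y))) \<partial>hl) = (\<lambda>x. norm (a x) * (\<integral>y. norm (b y) \<partial>hl))"
      by (simp add: abs_mult)
    then show "integrable hl (\<lambda>x. \<integral>y. norm (a (fst (x, y)) * b (snd (x, y))) \<partial>hl)"
      using a by simp
    show "AE x in hl. integrable hl (\<lambda>y. a (fst (x, y)) * b (snd (x, y)))"
      using b by simp
  qed measurable
  have i: "integrable (hl \<Otimes>\<^sub>M hl) (\<lambda>(x, y). f x y)"
  proof (rule Bochner_Integration.integrable_bound[OF ab m], rule AE_I2)
    fix p assume "p \<in> space (hl \<Otimes>\<^sub>M hl)"
    then have "0 < fst p" "0 < snd p" by (auto simp: space_pair_measure space_restrict_space)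
    from bound[OF this] show "norm (case p of (x, y) \<Rightarrow> f x y) \<le> norm (a (fst p) * b (snd p))"
      by (auto simp: case_prod_beta)
  qed
  show "(\<integral>x. (\<integral>y. f x y \<partial>hl) \<partial>hl) = (\<integral>y. (\<integral>x. f x y \<partial>hl) \<partial>hl)"
    using P.Fubini_integral[OF i] by simp
  show "integrable hl (\<lambda>x. \<integral>y. f x y \<partial>hl)" using P.integrable_fst[OF i] by simp
  show "integrable hl (\<lambda>y. \<integral>x. f x y \<partial>hl)" using P.integrable_snd[OF i] by simp
qed

text \<open>The set where \<open>f\<close> does not vanish is open, and a nonempty open set is not a null set.\<close>

lemma continuous_AE_eq_0_hl:
  fixes f :: "real \<Rightarrow> real"
  assumes c: "continuous_on {0<..} f" and ae: "AE r in hl. f r = 0" and "0 < r"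
  shows "f r = 0"
proof (rule ccontr)
  assume "f r \<noteq> 0"
  let ?S = "{0<..} \<inter> f -` (- {0})"
  have o: "open ?S" by (rule continuous_open_preimage[OF c]) auto
  have "AE x in lborel. x \<in> {0<..} \<longrightarrow> f x = 0"
    using ae by (subst (asm) AE_restrict_space_iff) auto
  then have "AE x in lebesgue. x \<notin> ?S"
    by (intro AE_completion) (auto elim!: eventually_mono)
  then obtain N where N: "negligible N" "{x. \<not> x \<notin> ?S} \<subseteq> N"
    unfolding eventually_ae_filter_negligible by blast
  have "?S \<subseteq> N" using N(2) by blast
  with N(1) have "negligible ?S" by (rule negligible_subset)
  with o have "?S = {}" using open_not_negligible by blast
  with \<open>f r \<noteq> 0\<close> \<open>0 < r\<close> show False by auto
qed


section \<open>Differentiation under Laplace-type integrals\<close>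

lemma abs_exp_minus_one_le: "\<bar>exp z - 1\<bar> \<le> \<bar>z\<bar> * exp \<bar>z\<bar>" for z :: real
proof (cases "0 \<le> z")
  case True
  have "1 - z \<le> exp (- z)" using exp_ge_add_one_self[of "- z"] by simp
  then have "(1 - z) * exp z \<le> exp (- z) * exp z" by (intro mult_right_mono) auto
  then have "exp z - 1 \<le> z * exp z" by (simp add: exp_minus algebra_simps)
  with True show ?thesis by simp
next
  case False
  have "1 - exp z \<le> - z" using exp_ge_add_one_self[of z] by linarith
  also have "\<dots> \<le> - z * exp (- z)"
    using False by (simp add: mult_le_cancel_left1)
  finally show ?thesis using False by simp
qed

text \<open>Since \<open>x \<le> exp x\<close>, a factor \<open>v\<close> is absorbed by half of the exponent.\<close>

lemma laplace_integrable_times: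
  fixes h v :: "'a \<Rightarrow> real"
  assumes [measurable]: "h \<in> borel_measurable M" "v \<in> borel_measurable M"
    and v: "\<And>x. x \<in> space M \<Longrightarrow> 0 \<le> v x"
    and int: "\<And>s. 0 < s \<Longrightarrow> integrable M (\<lambda>x. h x * exp (- s * v x))" and "0 < s"
  shows "integrable M (\<lambda>x. h x * v x * exp (- s * v x))"
proof (rule Bochner_Integration.integrable_bound)
  show "integrable M (\<lambda>x. 2 / s * (h x * exp (- (s/2) * v x)))"
    using int[of "s/2"] \<open>0 < s\<close> by simp
  show "AE x in M. norm (h x * v x * exp (- s * v x)) \<le> norm (2 / s * (h x * exp (- (s/2) * v x)))"
  proof (intro AE_I2)
    fix x assume x: "x \<in> space M"
    have "s/2 * v x \<le> exp (s/2 * v x)" using exp_ge_add_one_self[of "s/2 * v x"] by linarith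
    then have "v x \<le> 2 / s * exp (s/2 * v x)" using \<open>0 < s\<close> by (simp add: field_simps)
    then have "v x * exp (- s * v x) \<le> 2 / s * exp (s/2 * v x) * exp (- s * v x)"
      by (intro mult_right_mono) auto
    also have "\<dots> = 2 / s * exp (- (s/2) * v x)"
      by (simp add: mult_exp_exp algebra_simps)
    finally have "\<bar>h x\<bar> * (v x * exp (- s * v x)) \<le> \<bar>h x\<bar> * (2 / s * exp (- (s/2) * v x))"
      by (intro mult_left_mono) auto
    then show "norm (h x * v x * exp (- s * v x)) \<le> norm (2 / s * (h x * exp (- (s/2) * v x)))"
      using v[OF x] \<open>0 < s\<close> by (simp add: abs_mult ac_simps)
  qed
qed measurable

text \<open>By \<open>abs_exp_minus_one_le\<close>, the difference quotients with increment below \<open>s/2\<close> are dominated by the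
  function that \<open>laplace_integrable_times\<close> shows to be integrable at \<open>s/2\<close>.\<close>

lemma laplace_has_derivative:
  fixes h v :: "'a \<Rightarrow> real"
  assumes [measurable]: "h \<in> borel_measurable M" "v \<in> borel_measurable M"
    and v: "\<And>x. x \<in> space M \<Longrightarrow> 0 \<le> v x"
    and int: "\<And>s. 0 < s \<Longrightarrow> integrable M (\<lambda>x. h x * exp (- s * v x))" and s: "0 < s"
  shows "((\<lambda>s. \<integral>x. h x * exp (- s * v x) \<partial>M) has_real_derivative
           - (\<integral>x. h x * v x * exp (- s * v x) \<partial>M)) (at s)"
  unfolding DERIV_def tendsto_at_iff_sequentially comp_def
proof (intro allI impI)
  fix X :: "nat \<Rightarrow> real" assume X0: "\<forall>i. X i \<in> UNIV - {0}" and X: "X \<longlonglongrightarrow> 0"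
  have "\<exists>N. \<forall>n\<ge>N. \<bar>X n\<bar> < s/2" using LIMSEQ_D[OF X, of "s/2"] s by auto
  then obtain N where N: "\<And>n. N \<le> n \<Longrightarrow> \<bar>X n\<bar> < s/2" by blast
  let ?Q = "\<lambda>n x. (h x * exp (- (s + X n) * v x) - h x * exp (- s * v x)) / X n"
  have "(\<lambda>n. \<integral>x. ?Q (n + N) x \<partial>M) \<longlonglongrightarrow> (\<integral>x. - (h x * v x * exp (- s * v x)) \<partial>M)"
  proof (rule integral_dominated_convergence[where w="\<lambda>x. \<bar>h x * v x * exp (- (s/2) * v x)\<bar>"])
    show "integrable M (\<lambda>x. \<bar>h x * v x * exp (- (s/2) * v x)\<bar>)"
      by (intro integrable_abs laplace_integrable_times v int) (use s in auto)
    show "AE x in M. (\<lambda>n. ?Q (n + N) x) \<longlonglongrightarrow> - (h x * v x * exp (- s * v x))"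
    proof (intro AE_I2)
      fix x
      have "((\<lambda>s. h x * exp (- s * v x)) has_real_derivative - (h x * v x * exp (- s * v x))) (at s)"
        by (auto intro!: derivative_eq_intros)
      then have "(\<lambda>n. ?Q n x) \<longlonglongrightarrow> - (h x * v x * exp (- s * v x))"
        unfolding DERIV_def tendsto_at_iff_sequentially comp_def using X0 X by blast
      then show "(\<lambda>n. ?Q (n + N) x) \<longlonglongrightarrow> - (h x * v x * exp (- s * v x))"
        by (rule LIMSEQ_ignore_initial_segment)
    qed
    show "AE x in M. norm (?Q (n + N) x) \<le> \<bar>h x * v x * exp (- (s/2) * v x)\<bar>" for n
    proof (intro AE_I2)
      fix x assume x: "x \<in> space M"
      define d where "d = X (n + N)"
      have d: "d \<noteq> 0" "\<bar>d\<bar> < s/2" using X0 N[of "n + N"] by (auto simp: d_def)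
      have "\<bar>exp (- d * v x) - 1\<bar> \<le> \<bar>- d * v x\<bar> * exp \<bar>- d * v x\<bar>" by (rule abs_exp_minus_one_le)
      also have "\<dots> \<le> (\<bar>d\<bar> * v x) * exp (s/2 * v x)"
      proof -
        have "\<bar>- d * v x\<bar> = \<bar>d\<bar> * v x" using v[OF x] by (simp add: abs_mult)
        moreover have "\<bar>d\<bar> * v x \<le> s/2 * v x" using d v[OF x] by (intro mult_right_mono) auto
        ultimately show ?thesis using v[OF x] by (simp add: mult_left_mono)
      qed
      finally have e: "\<bar>exp (- d * v x) - 1\<bar> \<le> (\<bar>d\<bar> * v x) * exp (s/2 * v x)" .
      have "h x * exp (- (s + d) * v x) - h x * exp (- s * v x) = h x * exp (- s * v x) * (exp (- d * v x) - 1)"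
        by (simp add: algebra_simps mult_exp_exp)
      then have "norm (?Q (n + N) x) = \<bar>h x\<bar> * exp (- s * v x) * \<bar>exp (- d * v x) - 1\<bar> / \<bar>d\<bar>"
        by (simp add: d_def abs_mult)
      also have "\<dots> \<le> \<bar>h x\<bar> * exp (- s * v x) * ((\<bar>d\<bar> * v x) * exp (s/2 * v x)) / \<bar>d\<bar>"
        by (intro divide_right_mono mult_left_mono e) auto
      also have "\<dots> = \<bar>h x\<bar> * v x * (exp (- s * v x) * exp (s/2 * v x))" using d by simp
      also have "exp (- s * v x) * exp (s/2 * v x) = exp (- (s/2) * v x)" by (simp add: mult_exp_exp algebra_simps)
      also have "\<bar>h x\<bar> * v x * exp (- (s/2) * v x) = \<bar>h x * v x * exp (- (s/2) * v x)\<bar>"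
        using v[OF x] by (simp add: abs_mult)
      finally show "norm (?Q (n + N) x) \<le> \<bar>h x * v x * exp (- (s/2) * v x)\<bar>" .
    qed
  qed auto
  then have "(\<lambda>n. \<integral>x. ?Q n x \<partial>M) \<longlonglongrightarrow> - (\<integral>x. h x * v x * exp (- s * v x) \<partial>M)"
    unfolding Bochner_Integration.integral_minus by (rule LIMSEQ_offset)
  moreover have "eventually (\<lambda>n. (\<integral>x. ?Q n x \<partial>M) =
      ((\<integral>x. h x * exp (- (s + X n) * v x) \<partial>M) - (\<integral>x. h x * exp (- s * v x) \<partial>M)) / X n) sequentially"
    using eventually_ge_at_top[of N]
  proof eventually_elim
    case (elim n)
    have "0 < s + X n" using N[OF elim] s by linarith
    then show ?case using int[of s] int[of "s + X n"] s by (simp del: minus_add_distrib)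
  qed
  ultimately show "(\<lambda>n. ((\<integral>x. h x * exp (- (s + X n) * v x) \<partial>M) - (\<integral>x. h x * exp (- s * v x) \<partial>M)) / X n)
      \<longlonglongrightarrow> - (\<integral>x. h x * v x * exp (- s * v x) \<partial>M)"
    by (rule Lim_transform_eventually)
qed



section \<open>Gaussian integrals on the half-line\<close>

lemma integrable_power_gauss:
  assumes "0 < s"
  shows "integrable lborel (\<lambda>x::real. x ^ k * gexp s x)"
proof -
  have "integrable lborel (\<lambda>x. sqrt (pi / s) * (normal_density 0 (1 / sqrt (2 * s)) x * (x - 0) ^ k))"
    by (intro integrable_mult_right integrable_normal_moment) (use assms in simp)
  moreover have "sqrt (pi / s) * (normal_density 0 (1 / sqrt (2 * s)) x * (x - 0) ^ k) = x ^ k * gexp s x" for x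
    using assms by (simp add: normal_density_def power_divide field_simps)
  ultimately show ?thesis by (simp only:)
qed

text \<open>The characteristic function of the standard normal distribution, rescaled.\<close>

lemma gauss_fourier_1d:
  assumes s: "0 < s"
  shows "(\<integral>x. exp (- \<i> * complex_of_real (x * y)) * complex_of_real (gexp s x) \<partial>lborel)
    = complex_of_real (sqrt (pi / s) * exp (- (y\<^sup>2 / (4 * s))))"
proof -
  define t where "t = - y / sqrt (2 * s)"
  have "complex_of_real (exp (- (t\<^sup>2) / 2)) = char std_normal_distribution t"
    by (simp add: char_std_normal_distribution)
  also have "\<dots> = (\<integral>x. std_normal_density x *\<^sub>R iexp (t * x) \<partial>lborel)"
    unfolding char_def by (subst integral_density) auto
  also have "\<dots> = \<bar>sqrt (2 * s)\<bar> *\<^sub>R (\<integral>x. std_normal_density (0 + sqrt (2 * s) * x) *\<^sub>R iexp (t * (0 + sqrt (2 * s) * x)) \<partial>lborel)"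
    using s by (intro lborel_integral_real_affine) simp
  also have "\<dots> = \<bar>sqrt (2 * s)\<bar> *\<^sub>R (\<integral>x. complex_of_real (1 / sqrt (2 * pi)) * (exp (- \<i> * complex_of_real (x * y)) * complex_of_real (gexp s x)) \<partial>lborel)"
    using s by (intro arg_cong2[where f=scaleR] refl Bochner_Integration.integral_cong)
      (simp_all add: t_def std_normal_density_def power_mult_distrib scaleR_conv_of_real ac_simps)
  also have "\<dots> = complex_of_real (sqrt (2 * s) / sqrt (2 * pi)) * (\<integral>x. exp (- \<i> * complex_of_real (x * y)) * complex_of_real (gexp s x) \<partial>lborel)"
    using s by (subst integral_mult_right_zero) (simp add: scaleR_conv_of_real)
  finally have "complex_of_real (exp (- (t\<^sup>2) / 2)) = complex_of_real (sqrt (2 * s) / sqrt (2 * pi)) * (\<integral>x. exp (- \<i> * complex_of_real (x * y)) * complex_of_real (gexp s x) \<partial>lborel)" .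
  moreover have "sqrt (2 * s) / sqrt (2 * pi) = 1 / sqrt (pi / s)"
    using s by (simp add: real_sqrt_mult real_sqrt_divide)
  moreover have "t\<^sup>2 / 2 = y\<^sup>2 / (4 * s)" using s by (simp add: t_def power_divide)
  ultimately show ?thesis using s by (simp add: field_simps)
qed

text \<open>The real part of the preceding integral, halved because the integrand is even.\<close>

lemma integral_cos_gauss_hl:
  assumes s: "0 < s"
  shows "(\<integral>x. cos (k * x) * gexp s x \<partial>hl) = sqrt (pi / s) / 2 * exp (- (k\<^sup>2 / (4 * s)))"
    and "integrable hl (\<lambda>x. cos (k * x) * gexp s x)"
proof -
  let ?f = "\<lambda>x. cos (k * x) * gexp s x"
  have i: "integrable lborel (\<lambda>x. gexp s x)" using integrable_power_gauss[OF s, of 0] by simp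
  have ic: "integrable lborel (\<lambda>x. exp (- \<i> * complex_of_real (x * k)) * complex_of_real (gexp s x))"
    by (rule Bochner_Integration.integrable_bound[OF i]) (auto simp: norm_mult)
  have iF: "integrable lborel ?f"
    by (rule Bochner_Integration.integrable_bound[OF i])
       (auto simp: abs_mult intro!: mult_left_le_one_le)
  then show ihl: "integrable hl ?f" by (rule integrable_hl_lborel)
  have "(\<integral>x. ?f x \<partial>lborel) = (\<integral>x. Re (exp (- \<i> * complex_of_real (x * k)) * complex_of_real (gexp s x)) \<partial>lborel)"
    by (intro Bochner_Integration.integral_cong) (auto simp: Re_exp mult.commute)
  also have "\<dots> = sqrt (pi / s) * exp (- (k\<^sup>2 / (4 * s)))"
    using integral_Re[OF ic] gauss_fourier_1d[OF s, of k] by simp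
  finally have full: "(\<integral>x. ?f x \<partial>lborel) = sqrt (pi / s) * exp (- (k\<^sup>2 / (4 * s)))" .
  have i0: "integrable lborel (\<lambda>x. indicator {0..} x *\<^sub>R ?f x)"
    by (intro integrable_mult_indicator iF) auto
  have "(\<integral>x. ?f x \<partial>lborel) = 2 *\<^sub>R (\<integral>x. indicator {0..} x *\<^sub>R ?f x \<partial>lborel)"
    using has_bochner_integral_even_function[of ?f, OF has_bochner_integral_integrable[OF i0]]
    by (simp add: has_bochner_integral_integral_eq)
  also have "(\<integral>x. indicator {0..} x *\<^sub>R ?f x \<partial>lborel) = (\<integral>x. ?f x \<partial>hl)"
    unfolding integral_hl
    by (rule integral_cong_AE) (use AE_lborel_singleton[of 0] in \<open>auto simp: indicator_def elim!: eventually_mono\<close>)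
  finally show "(\<integral>x. ?f x \<partial>hl) = sqrt (pi / s) / 2 * exp (- (k\<^sup>2 / (4 * s)))" using full by simp
qed

lemma tendsto_poly_gauss:
  assumes "0 < s"
  shows "((\<lambda>x::real. x ^ n * gexp s x) \<longlongrightarrow> 0) at_top"
  using assms by real_asymp

text \<open>The derivative of \<open>sin(kx) exp(-sx\<^sup>2)\<close> integrates to \<open>0\<close>, which reduces the claim to the cosine
  integral. It says that \<open>x exp(-sx\<^sup>2)\<close> is its own sine transform up to scaling; this is what turns
  Gaussian tests of a profile into Gaussian tests of its spectrum and back.\<close>

lemma integral_sin_gauss_hl:
  assumes s: "0 < s"
  shows "(\<integral>x. x * sin (k * x) * gexp s x \<partial>hl) = k / (2 * s) * (sqrt (pi / s) / 2 * exp (- (k\<^sup>2 / (4 * s))))"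
    and "integrable hl (\<lambda>x. x * sin (k * x) * gexp s x)"
proof -
  have i: "integrable hl (\<lambda>x. \<bar>x ^ 1 * gexp s x\<bar>)"
    by (intro integrable_hl_lborel integrable_abs integrable_power_gauss s)
  show iS: "integrable hl (\<lambda>x. x * sin (k * x) * gexp s x)"
    by (rule Bochner_Integration.integrable_bound[OF i])
       (auto intro!: measurable_hl simp: abs_mult mult_le_cancel_right1 mult_left_le)
  have lim: "((\<lambda>x. sin (k * x) * gexp s x) \<longlongrightarrow> 0) at_top"
  proof (rule Lim_null_comparison)
    show "eventually (\<lambda>x. norm (sin (k * x) * gexp s x) \<le> x ^ 0 * gexp s x) at_top"
      by (auto simp: abs_mult intro!: mult_left_le_one_le)
  qed (rule tendsto_poly_gauss[OF s])
  have "(\<integral>x. k * (cos (k * x) * gexp s x) - 2 * s * (x * sin (k * x) * gexp s x) \<partial>hl) = 0 - 0"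
  proof (rule FTC_hl[where F="\<lambda>x. sin (k * x) * gexp s x"])
    show "((\<lambda>x. sin (k * x) * gexp s x) has_real_derivative
      k * (cos (k * x) * gexp s x) - 2 * s * (x * sin (k * x) * gexp s x)) (at x)" for x
      by (auto intro!: derivative_eq_intros simp: algebra_simps)
    have "isCont (\<lambda>x. sin (k * x) * gexp s x) 0" by (intro continuous_intros)
    then show "((\<lambda>x. sin (k * x) * gexp s x) \<longlongrightarrow> 0) (at_right 0)"
      by (auto simp: isCont_def elim: filterlim_mono intro!: at_le)
    show "integrable hl (\<lambda>x. k * (cos (k * x) * gexp s x) - 2 * s * (x * sin (k * x) * gexp s x))"
      using iS integral_cos_gauss_hl(2)[OF s, of k] by simp
  qed (use lim in \<open>auto intro!: continuous_intros\<close>)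
  moreover have "(\<integral>x. k * (cos (k * x) * gexp s x) - 2 * s * (x * sin (k * x) * gexp s x) \<partial>hl)
      = k * (\<integral>x. cos (k * x) * gexp s x \<partial>hl) - 2 * s * (\<integral>x. x * sin (k * x) * gexp s x \<partial>hl)"
    using iS integral_cos_gauss_hl(2)[OF s, of k]
    by (subst Bochner_Integration.integral_diff) auto
  ultimately show "(\<integral>x. x * sin (k * x) * gexp s x \<partial>hl) = k / (2 * s) * (sqrt (pi / s) / 2 * exp (- (k\<^sup>2 / (4 * s))))"
    unfolding integral_cos_gauss_hl(1)[OF s] using s by (simp add: field_simps)
qed

text \<open>The exponent 3 covers every function that is paired with a Gaussian below, the fastest growing
  ones being \<open>r^(1+\<alpha>)\<close> with \<open>\<alpha> < 2\<close> and cubic polynomials.\<close>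

definition cubic_growth :: "real set \<Rightarrow> (real \<Rightarrow> real) \<Rightarrow> bool"
  where "cubic_growth S p \<longleftrightarrow> (\<exists>C. \<forall>r\<in>S. \<bar>p r\<bar> \<le> C * (1 + r ^ 3))"

lemma cubic_growthI: "(\<And>r. r \<in> S \<Longrightarrow> \<bar>p r\<bar> \<le> C * (1 + r ^ 3)) \<Longrightarrow> cubic_growth S p"
  unfolding cubic_growth_def by blast

lemma cubic_growth_add:
  assumes "cubic_growth S p" "cubic_growth S q"
  shows "cubic_growth S (\<lambda>r. p r + q r)"
proof -
  obtain C D where "\<And>r. r \<in> S \<Longrightarrow> \<bar>p r\<bar> \<le> C * (1 + r ^ 3)" "\<And>r. r \<in> S \<Longrightarrow> \<bar>q r\<bar> \<le> D * (1 + r ^ 3)"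
    using assms unfolding cubic_growth_def by blast
  then have "\<bar>p r + q r\<bar> \<le> (C + D) * (1 + r ^ 3)" if "r \<in> S" for r
    using that unfolding distrib_right by (intro order_trans[OF abs_triangle_ineq] add_mono) auto
  then show ?thesis by (rule cubic_growthI)
qed

lemma cubic_growth_cmult: "cubic_growth S p \<Longrightarrow> cubic_growth S (\<lambda>r. c * p r)"
  unfolding cubic_growth_def abs_mult by (metis abs_ge_zero mult.assoc mult_left_mono)

lemma cubic_growth_id_times:
  assumes "\<And>r. r \<in> S \<Longrightarrow> 0 \<le> r \<and> \<bar>p r\<bar> \<le> C"
  shows "cubic_growth S p" "cubic_growth S (\<lambda>r. r * p r)"
proof -
  have r: "1 \<le> 1 + r ^ 3 \<and> r \<le> 1 + r ^ 3" if "0 \<le> r" for r :: real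
    using that power_increasing[of 1 3 r] by (cases "r \<le> 1") (auto intro: add_increasing2)
  show "cubic_growth S p"
  proof (rule cubic_growthI)
    fix r assume "r \<in> S"
    then have "0 \<le> r" "\<bar>p r\<bar> \<le> C" using assms by auto
    then have "\<bar>p r\<bar> * 1 \<le> C * (1 + r ^ 3)" using r by (intro mult_mono) auto
    then show "\<bar>p r\<bar> \<le> C * (1 + r ^ 3)" by simp
  qed
  show "cubic_growth S (\<lambda>r. r * p r)"
  proof (rule cubic_growthI)
    fix r assume "r \<in> S"
    then have "0 \<le> r" "\<bar>p r\<bar> \<le> C" using assms by auto
    then have "\<bar>p r\<bar> * r \<le> C * (1 + r ^ 3)" using r by (intro mult_mono) auto
    then show "\<bar>r * p r\<bar> \<le> C * (1 + r ^ 3)" using \<open>0 \<le> r\<close> by (simp add: abs_mult mult.commute)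
  qed
qed

lemma cubic_growth_bounded: "(\<And>r. \<bar>p r\<bar> \<le> C) \<Longrightarrow> cubic_growth {0<..} p"
  by (rule cubic_growth_id_times(1)) auto

lemma cubic_growth_id: "cubic_growth {0<..} (\<lambda>r. r)"
  using cubic_growth_id_times(2)[of "{0<..}" "\<lambda>_. 1" 1] by simp

lemma cubic_growth_powr:
  assumes "0 < d" "a \<le> 3" shows "cubic_growth {d..} (\<lambda>r. r powr a)"
proof (rule cubic_growthI)
  fix r assume r: "r \<in> {d..}"
  have "\<bar>r powr a\<bar> = r powr (a - 3) * r powr 3" by (simp flip: powr_add)
  also have "\<dots> = r powr (a - 3) * r ^ 3" using assms r by (simp add: powr_numeral)
  also have "\<dots> \<le> d powr (a - 3) * (1 + r ^ 3)" using assms r by (intro mult_mono powr_mono2') auto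
  finally show "\<bar>r powr a\<bar> \<le> d powr (a - 3) * (1 + r ^ 3)" .
qed

lemma cubic_growth_extend:
  assumes "cubic_growth {d..} p" "d < l" and z: "\<And>r. 0 < r \<Longrightarrow> r < l \<Longrightarrow> p r = 0"
  shows "cubic_growth {0<..} p"
proof -
  obtain C where C: "\<And>r. d \<le> r \<Longrightarrow> \<bar>p r\<bar> \<le> C * (1 + r ^ 3)"
    using assms(1) unfolding cubic_growth_def by auto
  show ?thesis
  proof (rule cubic_growthI)
    fix r :: real assume r: "r \<in> {0<..}"
    have "\<bar>p r\<bar> \<le> C * (1 + r ^ 3) \<or> \<bar>p r\<bar> \<le> 0" using C[of r] z[of r] r assms(2) by (cases "r < l") auto
    moreover have "C * (1 + r ^ 3) \<le> \<bar>C\<bar> * (1 + r ^ 3)" "0 \<le> \<bar>C\<bar> * (1 + r ^ 3)"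
      using r by (auto intro!: mult_right_mono mult_nonneg_nonneg add_nonneg_nonneg)
    ultimately show "\<bar>p r\<bar> \<le> \<bar>C\<bar> * (1 + r ^ 3)" by linarith
  qed
qed

lemma cubic_growth_times_gauss:
  assumes f: "cubic_growth {0<..} f"
  obtains C where "\<And>r. 0 < r \<Longrightarrow> norm (f r * (r ^ n * gexp s r))
     \<le> C * (r ^ n * gexp s r) + C * (r ^ (3 + n) * gexp s r)"
proof -
  obtain C where C: "\<And>r. 0 < r \<Longrightarrow> \<bar>f r\<bar> \<le> C * (1 + r ^ 3)"
    using f unfolding cubic_growth_def by auto
  show ?thesis
  proof (rule that)
    fix r :: real assume r: "0 < r"
    have "norm (f r * (r ^ n * gexp s r)) = \<bar>f r\<bar> * (r ^ n * gexp s r)"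
      using r by (simp add: abs_mult)
    also have "\<dots> \<le> C * (1 + r ^ 3) * (r ^ n * gexp s r)"
      using r by (intro mult_right_mono C) auto
    also have "\<dots> = C * (r ^ n * gexp s r) + C * (r ^ (3 + n) * gexp s r)"
      by (simp add: algebra_simps power_add)
    finally show "norm (f r * (r ^ n * gexp s r))
     \<le> C * (r ^ n * gexp s r) + C * (r ^ (3 + n) * gexp s r)" .
  qed
qed

lemma integrable_growth_gauss:
  assumes s: "0 < s" and m: "f \<in> borel_measurable hl" and f: "cubic_growth {0<..} f"
  shows "integrable hl (\<lambda>r. f r * (r ^ n * gexp s r))"
proof -
  obtain C where C: "\<And>r. 0 < r \<Longrightarrow> norm (f r * (r ^ n * gexp s r))
     \<le> C * (r ^ n * gexp s r) + C * (r ^ (3 + n) * gexp s r)"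
    using cubic_growth_times_gauss[OF f, of n s] by blast
  show ?thesis
  proof (rule Bochner_Integration.integrable_bound)
    show "integrable hl (\<lambda>r. C * (r ^ n * gexp s r) + C * (r ^ (3 + n) * gexp s r))"
      by (intro integrable_hl_lborel Bochner_Integration.integrable_add integrable_mult_right integrable_power_gauss s)
    show "(\<lambda>r. f r * (r ^ n * gexp s r)) \<in> borel_measurable hl"
      by (intro borel_measurable_times[OF m] measurable_hl) measurable
  qed (use C in \<open>auto simp: space_restrict_space intro!: AE_I2 order_trans[OF _ abs_ge_self]\<close>)
qed

lemma tendsto_growth_gauss:
  assumes s: "0 < s" and f: "cubic_growth {0<..} f"
  shows "((\<lambda>r. f r * (r ^ n * gexp s r)) \<longlongrightarrow> 0) at_top"
proof -
  obtain C where C: "\<And>r. 0 < r \<Longrightarrow> norm (f r * (r ^ n * gexp s r))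
     \<le> C * (r ^ n * gexp s r) + C * (r ^ (3 + n) * gexp s r)"
    using cubic_growth_times_gauss[OF f, of n s] by blast
  have "((\<lambda>r. C * (r ^ n * gexp s r) + C * (r ^ (3 + n) * gexp s r)) \<longlongrightarrow> C * 0 + C * 0) at_top"
    by (intro tendsto_intros tendsto_poly_gauss s)
  then show ?thesis
    by (intro Lim_null_comparison[OF eventually_mono[OF eventually_gt_at_top[of 0] C]]) simp_all
qed

text \<open>The fourth derivative of \<open>r exp(-sr\<^sup>2)\<close>.\<close>

definition gauss4 :: "real \<Rightarrow> real \<Rightarrow> real"
  where "gauss4 s r = (60 * s\<^sup>2 * r - 80 * s ^ 3 * r ^ 3 + 16 * s ^ 4 * r ^ 5) * gexp s r"

lemma integrable_growth_gauss4:
  assumes "0 < s" "f \<in> borel_measurable hl" "cubic_growth {0<..} f"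
  shows "integrable hl (\<lambda>r. f r * gauss4 s r)"
proof -
  have "integrable hl (\<lambda>r. 60 * s\<^sup>2 * (f r * (r ^ 1 * gexp s r)) - 80 * s ^ 3 * (f r * (r ^ 3 * gexp s r))
      + 16 * s ^ 4 * (f r * (r ^ 5 * gexp s r)))"
    by (intro Bochner_Integration.integrable_add Bochner_Integration.integrable_diff integrable_mult_right
        integrable_growth_gauss[OF assms])
  then show ?thesis by (simp add: gauss4_def algebra_simps)
qed

text \<open>Four integrations by parts at once: \<open>F\<close> in the proof is the alternating sum of the products of
  derivatives. At the origin \<open>p1\<close> and \<open>p3\<close> meet the second and the zeroth derivative of the odd
  function \<open>r exp(-sr\<^sup>2)\<close>, which vanish there, so only \<open>p0\<close> and \<open>p2\<close> have to tend to \<open>0\<close>.\<close>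

lemma integral_by_parts_gauss4:
  fixes p0 p1 p2 p3 p4 :: "real \<Rightarrow> real"
  assumes s: "0 < s"
    and d: "\<And>r. 0 < r \<Longrightarrow> (p0 has_real_derivative p1 r) (at r)" "\<And>r. 0 < r \<Longrightarrow> (p1 has_real_derivative p2 r) (at r)"
      "\<And>r. 0 < r \<Longrightarrow> (p2 has_real_derivative p3 r) (at r)" "\<And>r. 0 < r \<Longrightarrow> (p3 has_real_derivative p4 r) (at r)"
    and c: "continuous_on {0<..} p4"
    and b: "cubic_growth {0<..} p0" "cubic_growth {0<..} p1" "cubic_growth {0<..} p2" "cubic_growth {0<..} p3"
    and l: "(p0 \<longlongrightarrow> 0) (at_right 0)" "(p2 \<longlongrightarrow> 0) (at_right 0)"
    and i: "integrable hl (\<lambda>r. p4 r * (r * gexp s r))"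
  shows "(\<integral>r. p0 r * gauss4 s r \<partial>hl) = (\<integral>r. p4 r * (r * gexp s r) \<partial>hl)"
proof -
  define e where "e r = gexp s r" for r
  have de: "(e has_real_derivative - 2 * s * r * e r) (at r)" for r
    unfolding e_def by (auto intro!: derivative_eq_intros)
  have dp: "continuous_on {0<..} p0"
    using d(1) by (auto intro!: continuous_at_imp_continuous_on dest: DERIV_isCont)
  have i0: "integrable hl (\<lambda>r. p0 r * gauss4 s r)"
    by (rule integrable_growth_gauss4[OF s measurable_hl_continuous[OF dp] b(1)])
  define F where "F r = p0 r * ((- 6 * s + 24 * s\<^sup>2 * r\<^sup>2 - 8 * s ^ 3 * r ^ 4) * e r)
      - p1 r * ((4 * s\<^sup>2 * r ^ 3 - 6 * s * r) * e r)
      + p2 r * ((1 - 2 * s * r\<^sup>2) * e r) - p3 r * (r * e r)" for r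
  have "(\<integral>r. p0 r * gauss4 s r - p4 r * (r * gexp s r) \<partial>hl) = 0 - 0"
  proof (rule FTC_hl[where F=F])
    show "(F has_real_derivative p0 r * gauss4 s r - p4 r * (r * gexp s r)) (at r)" if r: "0 < r" for r
      unfolding F_def gauss4_def e_def[symmetric]
      by (rule derivative_eq_intros d[OF r] de refl)+ (simp add: algebra_simps power2_eq_square power3_eq_cube eval_nat_numeral)
    show "continuous_on {0<..} (\<lambda>r. p0 r * gauss4 s r - p4 r * (r * gexp s r))"
      unfolding gauss4_def by (intro continuous_intros dp c)
    show "integrable hl (\<lambda>r. p0 r * gauss4 s r - p4 r * (r * gexp s r))"
      using i0 i by simp
    have t: "((\<lambda>r. p r * (r ^ n * e r)) \<longlongrightarrow> 0) at_top" if "cubic_growth {0<..} p" for p n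
      unfolding e_def by (rule tendsto_growth_gauss[OF s that])
    have "((\<lambda>r. (- 6 * s * (p0 r * (r ^ 0 * e r)) + 24 * s\<^sup>2 * (p0 r * (r ^ 2 * e r)) - 8 * s ^ 3 * (p0 r * (r ^ 4 * e r)))
      - (4 * s\<^sup>2 * (p1 r * (r ^ 3 * e r)) - 6 * s * (p1 r * (r ^ 1 * e r)))
      + (p2 r * (r ^ 0 * e r) - 2 * s * (p2 r * (r ^ 2 * e r))) - p3 r * (r ^ 1 * e r))
      \<longlongrightarrow> (- 6 * s * 0 + 24 * s\<^sup>2 * 0 - 8 * s ^ 3 * 0) - (4 * s\<^sup>2 * 0 - 6 * s * 0) + (0 - 2 * s * 0) - 0) at_top"
      by (intro tendsto_intros t b)
    moreover have "F = (\<lambda>r. (- 6 * s * (p0 r * (r ^ 0 * e r)) + 24 * s\<^sup>2 * (p0 r * (r ^ 2 * e r)) - 8 * s ^ 3 * (p0 r * (r ^ 4 * e r)))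
      - (4 * s\<^sup>2 * (p1 r * (r ^ 3 * e r)) - 6 * s * (p1 r * (r ^ 1 * e r)))
      + (p2 r * (r ^ 0 * e r) - 2 * s * (p2 r * (r ^ 2 * e r))) - p3 r * (r ^ 1 * e r))"
      by (rule ext) (simp add: F_def algebra_simps)
    ultimately show "(F \<longlongrightarrow> 0) at_top" by simp
    have e0: "(e \<longlongrightarrow> 1) (at_right 0)"
      unfolding e_def by (auto intro!: tendsto_eq_intros)
    have bd: "((\<lambda>r. p r * g r) \<longlongrightarrow> 0) (at_right 0)"
      if pc: "cubic_growth {0<..} p" and g: "(g \<longlongrightarrow> 0) (at_right 0)" for p g :: "real \<Rightarrow> real"
    proof -
      obtain C where p: "\<And>r. 0 < r \<Longrightarrow> \<bar>p r\<bar> \<le> C * (1 + r ^ 3)" using pc unfolding cubic_growth_def by auto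
      have C: "0 \<le> C" using p[of 1] by simp
      show ?thesis
      proof (rule Lim_null_comparison)
        show "eventually (\<lambda>r. norm (p r * g r) \<le> 2 * C * \<bar>g r\<bar>) (at_right 0)"
          using eventually_at_right_real[OF zero_less_one]
        proof eventually_elim
          fix r :: real assume r: "r \<in> {0<..<1}"
          have "\<bar>p r\<bar> \<le> C * (1 + r ^ 3)" by (rule p) (use r in simp)
          also have "\<dots> \<le> C * 2" using r C by (intro mult_left_mono) (auto intro: power_le_one)
          finally show "norm (p r * g r) \<le> 2 * C * \<bar>g r\<bar>" by (auto simp: abs_mult intro: mult_right_mono)
        qed
        show "((\<lambda>r. 2 * C * \<bar>g r\<bar>) \<longlongrightarrow> 0) (at_right 0)" using tendsto_mult[OF tendsto_const tendsto_rabs[OF g], of "2 * C"] by simp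
      qed
    qed
    have t0: "((\<lambda>r. p0 r * ((- 6 * s + 24 * s\<^sup>2 * r\<^sup>2 - 8 * s ^ 3 * r ^ 4) * e r)) \<longlongrightarrow> 0 * ((- 6 * s + 24 * s\<^sup>2 * 0\<^sup>2 - 8 * s ^ 3 * 0 ^ 4) * 1)) (at_right 0)"
      by (intro tendsto_intros l e0)
    have t1: "((\<lambda>r. p1 r * ((4 * s\<^sup>2 * r ^ 3 - 6 * s * r) * e r)) \<longlongrightarrow> 0) (at_right 0)"
      by (rule bd[OF b(2)]) (auto intro!: tendsto_eq_intros e0)
    have t2: "((\<lambda>r. p2 r * ((1 - 2 * s * r\<^sup>2) * e r)) \<longlongrightarrow> 0 * ((1 - 2 * s * 0\<^sup>2) * 1)) (at_right 0)"
      by (intro tendsto_intros l e0)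
    have t3: "((\<lambda>r. p3 r * (r * e r)) \<longlongrightarrow> 0) (at_right 0)"
      by (rule bd[OF b(4)]) (auto intro!: tendsto_eq_intros e0)
    have "(F \<longlongrightarrow> 0 * ((- 6 * s + 24 * s\<^sup>2 * 0\<^sup>2 - 8 * s ^ 3 * 0 ^ 4) * 1) - 0 + 0 * ((1 - 2 * s * 0\<^sup>2) * 1) - 0) (at_right 0)"
      unfolding F_def by (rule tendsto_diff[OF tendsto_add[OF tendsto_diff[OF t0 t1] t2] t3])
    then show "(F \<longlongrightarrow> 0) (at_right 0)" by simp
  qed
  then show ?thesis using i0 i by simp
qed


section \<open>Uniqueness for the Laplace transform in the squared variable\<close>

text \<open>The measures whose densities are the positive and the negative part of \<open>f\<close> agree on all rays
  \<open>(x, \<infinity>)\<close>, hence on all Borel sets.\<close>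

lemma AE_eq_0_if_integral_Ioi_eq_0:
  fixes f :: "real \<Rightarrow> real"
  assumes f: "integrable lborel f" and z: "\<And>x. (\<integral>r. indicator {x<..} r * f r \<partial>lborel) = 0"
  shows "AE r in lborel. f r = 0"
proof -
  have [measurable]: "f \<in> borel_measurable borel" using f by (simp add: borel_measurable_integrable)
  let ?M = "density lborel (\<lambda>r. ennreal (f r))" and ?N = "density lborel (\<lambda>r. ennreal (- f r))"
  have fi: "integrable lborel (\<lambda>r. indicator {x<..} r * f r)" for x
    using integrable_mult_indicator[OF _ f, of "{x<..}"] by simp
  have eq: "emeasure ?M {x<..} = (\<integral>\<^sup>+r. ennreal (indicator {x<..} r * f r) \<partial>lborel)"
    "emeasure ?N {x<..} = (\<integral>\<^sup>+r. ennreal (- (indicator {x<..} r * f r)) \<partial>lborel)" for x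
    by (auto simp: emeasure_density intro!: nn_integral_cong split: split_indicator)
  have fin: "emeasure ?M {x<..} < \<infinity>" "emeasure ?N {x<..} < \<infinity>" for x
    using real_integrable_def[of lborel "\<lambda>r. indicator {x<..} r * f r"] fi[of x] unfolding eq by (auto simp: less_top)
  have "emeasure ?M {x<..} = emeasure ?N {x<..}" for x
  proof -
    have "enn2real (emeasure ?M {x<..}) - enn2real (emeasure ?N {x<..}) = 0"
      unfolding eq using real_lebesgue_integral_def[OF fi[of x]] z[of x] by simp
    then show ?thesis using fin[of x] by (metis eq_iff_diff_eq_0 ennreal_enn2real infinity_ennreal_def)
  qed
  then have "?M = ?N" using fin by (intro measure_eqI_lessThan) auto
  then have "AE r in lborel. ennreal (f r) = ennreal (- f r)"
    by (subst (asm) sigma_finite_measure.density_unique_iff[OF sigma_finite_lborel]) auto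
  then show ?thesis
  proof eventually_elim
    case (elim r)
    show ?case
    proof (cases "0 \<le> f r")
      case True
      then have "ennreal (- f r) = 0" by (simp add: ennreal_neg)
      with elim True show ?thesis by (simp add: ennreal_eq_0_iff)
    next
      case False
      then have "ennreal (f r) = 0" by (simp add: ennreal_neg)
      with elim False show ?thesis by (simp add: ennreal_eq_0_iff flip: ennreal_0)
    qed
  qed
qed

text \<open>In the variable \<open>X = exp(-r\<^sup>2)\<close> the moments at \<open>s = 1 + i\<close> say that the integrable function
  \<open>G(r) = g(r) exp(-r\<^sup>2)\<close> is orthogonal to every monomial \<open>X^i\<close>. By the Weierstrass theorem it is
  orthogonal to every continuous function of \<open>X\<close>, by dominated convergence to the indicators of
  \<open>X < a\<close>, and these are the indicators of the rays in \<open>r\<close>.\<close>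

theorem gauss_laplace_unique:
  fixes g :: "real \<Rightarrow> real"
  assumes int: "\<And>s. 0 < s \<Longrightarrow> integrable hl (\<lambda>r. g r * gexp s r)"
    and zero: "\<And>s. 0 < s \<Longrightarrow> (\<integral>r. g r * gexp s r \<partial>hl) = 0"
  shows "AE r in hl. g r = 0"
proof -
  define G where "G r = g r * gexp 1 r" for r
  have G: "integrable hl G" unfolding G_def[abs_def] by (rule int) simp
  then have [measurable]: "G \<in> borel_measurable hl" by (rule borel_measurable_integrable)
  define X where "X r = exp (- (r\<^sup>2))" for r :: real
  have [measurable]: "X \<in> borel_measurable hl"
    unfolding X_def[abs_def] by (rule measurable_hl) measurable
  have X: "0 < X r" "X r \<le> 1" for r by (auto simp: X_def)
  have mono: "integrable hl (\<lambda>r. G r * X r ^ i)" "(\<integral>r. G r * X r ^ i \<partial>hl) = 0" for i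
  proof -
    have e: "G r * X r ^ i = g r * gexp (1 + real i) r" for r
      by (simp add: G_def X_def mult_exp_exp algebra_simps flip: exp_of_nat_mult)
    show "integrable hl (\<lambda>r. G r * X r ^ i)" unfolding e by (rule int) simp
    show "(\<integral>r. G r * X r ^ i \<partial>hl) = 0" unfolding e by (rule zero) simp
  qed
  have bnd: "integrable hl (\<lambda>r. G r * f (X r))"
    if c: "continuous_on {0..1} f" for f :: "real \<Rightarrow> real"
  proof -
    obtain B where B': "\<forall>y\<in>f ` {0..1}. norm y \<le> B"
      using compact_imp_bounded[OF compact_continuous_image[OF c compact_Icc]] unfolding bounded_iff by blast
    have B: "\<bar>f x\<bar> \<le> B" if "x \<in> {0..1}" for x using B' that by auto
    have m: "(\<lambda>r. f (X r)) \<in> borel_measurable hl"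
    proof (rule measurable_hl)
      have "continuous_on UNIV (\<lambda>r. f (X r))"
      proof (rule continuous_on_compose2[OF c])
        show "continuous_on UNIV X" unfolding X_def[abs_def] by (intro continuous_intros)
        show "X ` UNIV \<subseteq> {0..1}" using less_imp_le[OF X(1)] X(2) by auto
      qed
      then show "(\<lambda>r. f (X r)) \<in> borel_measurable borel" by (rule borel_measurable_continuous_onI)
    qed
    show ?thesis
    proof (rule Bochner_Integration.integrable_bound)
      show "integrable hl (\<lambda>r. B * G r)" using G by simp
      show "AE r in hl. norm (G r * f (X r)) \<le> norm (B * G r)"
      proof (intro AE_I2)
        fix r
        have "\<bar>f (X r)\<bar> \<le> B" using B[of "X r"] X[of r] by simp
        then have "\<bar>f (X r)\<bar> \<le> \<bar>B\<bar>" by simp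
        then show "norm (G r * f (X r)) \<le> norm (B * G r)" 
          using mult_left_mono[of _ _ "\<bar>G r\<bar>"] by (simp add: abs_mult mult.commute[of "\<bar>B\<bar>"])
      qed
    qed (use m in measurable)
  qed
  have cont: "(\<integral>r. G r * f (X r) \<partial>hl) = 0"
    if c: "continuous_on {0..1} f" for f :: "real \<Rightarrow> real"
  proof -
    have "\<bar>\<integral>r. G r * f (X r) \<partial>hl\<bar> \<le> 0 + \<epsilon>" if \<epsilon>: "0 < \<epsilon>" for \<epsilon>
    proof -
      define I where "I = (\<integral>r. \<bar>G r\<bar> \<partial>hl)"
      have I: "0 \<le> I" by (simp add: I_def)
      obtain p where p: "real_polynomial_function p" "\<And>x. x \<in> {0..1} \<Longrightarrow> \<bar>f x - p x\<bar> < \<epsilon> / (I + 1)"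
        using Stone_Weierstrass_real_polynomial_function[OF compact_Icc c, of "\<epsilon> / (I + 1)"] \<epsilon> I by auto
      obtain a n where pa: "p = (\<lambda>x. \<Sum>i\<le>n. a i * x ^ i)"
        using p(1) unfolding real_polynomial_function_iff_sum by blast
      have pc: "continuous_on {0..1} p" unfolding pa by (intro continuous_intros)
      have "(\<integral>r. G r * p (X r) \<partial>hl) = (\<integral>r. (\<Sum>i\<le>n. a i * (G r * X r ^ i)) \<partial>hl)"
        by (simp add: pa sum_distrib_left ac_simps)
      also have "\<dots> = (\<Sum>i\<le>n. a i * (\<integral>r. G r * X r ^ i \<partial>hl))"
        using mono(1) by (subst Bochner_Integration.integral_sum) auto
      also have "\<dots> = 0" by (simp add: mono(2))
      finally have "(\<integral>r. G r * f (X r) \<partial>hl) = (\<integral>r. G r * f (X r) - G r * p (X r) \<partial>hl)"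
        using bnd[OF c] bnd[OF pc] by simp
      also have "\<bar>\<dots>\<bar> \<le> (\<integral>r. \<bar>G r\<bar> * (\<epsilon> / (I + 1)) \<partial>hl)"
      proof (rule order_trans[OF integral_abs_bound], rule integral_mono)
        show "integrable hl (\<lambda>r. \<bar>G r * f (X r) - G r * p (X r)\<bar>)" using bnd[OF c] bnd[OF pc] by simp
        show "integrable hl (\<lambda>r. \<bar>G r\<bar> * (\<epsilon> / (I + 1)))" using G by simp
        show "\<bar>G r * f (X r) - G r * p (X r)\<bar> \<le> \<bar>G r\<bar> * (\<epsilon> / (I + 1))" for r
        proof -
          have "\<bar>f (X r) - p (X r)\<bar> \<le> \<epsilon> / (I + 1)" using p(2)[of "X r"] X[of r] by simp
          from mult_left_mono[OF this abs_ge_zero[of "G r"]] show ?thesis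
            by (simp add: abs_mult[symmetric] right_diff_distrib)
        qed
      qed
      also have "\<dots> = I * (\<epsilon> / (I + 1))" unfolding I_def by (rule integral_mult_left_zero)
      also have "\<dots> \<le> \<epsilon>" using I \<epsilon> by (simp add: field_simps)
      finally show ?thesis by simp
    qed
    then have "\<bar>\<integral>r. G r * f (X r) \<partial>hl\<bar> \<le> 0" by (rule field_le_epsilon)
    then show ?thesis by simp
  qed
  have ind: "(\<integral>r. G r * indicator {..<a} (X r) \<partial>hl) = 0" for a
  proof -
    define f where "f n x = max 0 (min 1 (real n * (a - x)))" for n x
    have lim: "(\<lambda>n. f n x) \<longlonglongrightarrow> indicator {..<a} x" for x
    proof (cases "x < a")
      case True
      obtain N :: nat where N: "1 \<le> real N * (a - x)"
        using reals_Archimedean3[of "a - x"] True by (metis diff_gt_0_iff_gt less_imp_le)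
      show ?thesis
      proof (rule tendsto_eventually)
        show "eventually (\<lambda>n. f n x = indicator {..<a} x) sequentially"
          using eventually_ge_at_top[of N]
        proof eventually_elim
          case (elim n)
          have "real N * (a - x) \<le> real n * (a - x)" using elim True by (intro mult_right_mono) auto
          with N have "1 \<le> real n * (a - x)" by linarith
          then have "min 1 (real n * (a - x)) = 1" by (rule min_absorb1)
          with True show ?case by (simp add: f_def)
        qed
      qed
    next
      case False
      then have "real n * (a - x) \<le> 0" for n by (intro mult_nonneg_nonpos) auto
      moreover have "max 0 (min 1 z) = 0" if "z \<le> 0" for z :: real using that by simp
      ultimately have "f n x = 0" for n unfolding f_def by blast
      with False show ?thesis by simp
    qed
    have "(\<lambda>n. \<integral>r. G r * f n (X r) \<partial>hl) \<longlonglongrightarrow> (\<integral>r. G r * indicator {..<a} (X r) \<partial>hl)"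
    proof (rule integral_dominated_convergence[where w="\<lambda>r. \<bar>G r\<bar>"])
      show "AE r in hl. (\<lambda>n. G r * f n (X r)) \<longlonglongrightarrow> G r * indicator {..<a} (X r)"
        by (intro AE_I2 tendsto_intros lim)
      show "AE r in hl. norm (G r * f n (X r)) \<le> \<bar>G r\<bar>" for n
        by (intro AE_I2) (auto simp: f_def abs_mult intro!: mult_left_le)
    qed (use G in \<open>auto simp: f_def\<close>)
    moreover have "(\<integral>r. G r * f n (X r) \<partial>hl) = 0" for n
      by (rule cont) (auto simp: f_def intro!: continuous_intros)
    ultimately show ?thesis by (simp add: LIMSEQ_const_iff)
  qed
  have "AE r in lborel. indicator {0<..} r *\<^sub>R G r = 0"
  proof (rule AE_eq_0_if_integral_Ioi_eq_0)
    show "integrable lborel (\<lambda>r. indicator {0<..} r *\<^sub>R G r)" using G by (simp add: integrable_hl)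
    show "(\<integral>r. indicator {x<..} r * (indicator {0<..} r *\<^sub>R G r) \<partial>lborel) = 0" for x
    proof -
      have *: "indicator {x<..} r * (indicator {0<..} r *\<^sub>R G r)
          = indicator {0<..} r *\<^sub>R (G r * indicator {..<X (max 0 x)} (X r))" for r
      proof (cases "0 < r")
        case True
        have "x < r \<longleftrightarrow> max 0 x < r" using True by simp
        also have "\<dots> \<longleftrightarrow> (max 0 x)\<^sup>2 < r\<^sup>2" using True
          by (meson less_imp_le max.cobounded1 power_less_imp_less_base power_strict_mono zero_less_numeral)
        finally show ?thesis using True by (auto simp: X_def indicator_def)
      qed simp
      show ?thesis unfolding * using ind[of "X (max 0 x)"] by (simp add: integral_hl)
    qed
  qed
  then have "AE r in lborel. r \<in> {0<..} \<longrightarrow> G r = 0"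
    by eventually_elim (auto simp: indicator_def)
  then have "AE r in hl. G r = 0" by (subst AE_restrict_space_iff) auto
  then show ?thesis by eventually_elim (simp add: G_def)
qed

section \<open>The cardinal sine and powers as its superpositions\<close>

text \<open>A constant of its own keeps the case distinction at \<open>0\<close> away from the simplifier.\<close>

definition sincf :: "real \<Rightarrow> real"
  where "sincf x = (if x = 0 then 1 else sin x / x)"

lemma isCont_sincf: "isCont sincf x"
  using isCont_sinc[of x] by (simp add: sincf_def[abs_def])

lemma borel_measurable_sincf [measurable]: "sincf \<in> borel_measurable borel"
  using borel_measurable_sinc by (simp add: sincf_def[abs_def])

lemma sincf_bounds: "0 \<le> 1 - sincf x" "1 - sincf x \<le> x\<^sup>2" "1 - sincf x \<le> 2" "\<bar>sincf x\<bar> \<le> 1"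
proof -
  show a: "\<bar>sincf x\<bar> \<le> 1"
    using abs_sin_x_le_abs_x[of x] by (auto simp: sincf_def abs_divide divide_le_eq)
  then show "0 \<le> 1 - sincf x" "1 - sincf x \<le> 2" by (auto simp: abs_le_iff)
  show "1 - sincf x \<le> x\<^sup>2"
  proof (cases "x = 0")
    case False
    have "\<bar>sin x - (\<Sum>m<3. sin_coeff m * x ^ m)\<bar> \<le> inverse (fact 3) * \<bar>x\<bar> ^ 3" by (rule Maclaurin_sin_bound)
    then have "\<bar>sin x - x\<bar> \<le> \<bar>x\<bar> ^ 3 / 6"
      by (simp add: eval_nat_numeral sin_coeff_def fact_numeral)
    then have "\<bar>sin x - x\<bar> / \<bar>x\<bar> \<le> x\<^sup>2 / 6"
      using False by (simp add: field_simps power3_eq_cube power2_eq_square)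
    moreover have "1 - sincf x \<le> \<bar>sin x - x\<bar> / \<bar>x\<bar>"
      using False by (simp add: sincf_def abs_divide[symmetric] diff_divide_distrib)
    moreover have "0 \<le> x\<^sup>2" by simp
    ultimately show ?thesis by linarith
  qed (simp add: sincf_def)
qed

lemma integrable_hl_powr:
  shows "-1 < a \<Longrightarrow> integrable hl (\<lambda>x. indicator {0<..<c} x * x powr a)"
    and "a < -1 \<Longrightarrow> 0 < c \<Longrightarrow> integrable hl (\<lambda>x. indicator {c<..} x * x powr a)"
proof -
  assume a: "-1 < a"
  show "integrable hl (\<lambda>x. indicator {0<..<c} x * x powr a)"
  proof (cases "0 < c")
    case True
    have "set_integrable lborel (einterval 0 (ereal c)) (\<lambda>x. x powr a)"
    proof (rule interval_integral_FTC_nonneg(1)[where F="\<lambda>x. x powr (a + 1) / (a + 1)"])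
      show "((\<lambda>x. x powr (a + 1) / (a + 1)) has_real_derivative x powr a) (at x)" if "0 < ereal x" for x
        using a that by (auto intro!: derivative_eq_intros)
      show "(((\<lambda>x. x powr (a + 1) / (a + 1)) \<circ> real_of_ereal) \<longlongrightarrow> 0) (at_right 0)"
        unfolding zero_ereal_def ereal_tendsto_simps using a by real_asymp
      have "((\<lambda>x. x powr (a + 1) / (a + 1)) \<longlongrightarrow> c powr (a + 1) / (a + 1)) (at_left c)"
        by (intro tendsto_intros) (use True a in auto)
      then show "(((\<lambda>x. x powr (a + 1) / (a + 1)) \<circ> real_of_ereal) \<longlongrightarrow> c powr (a + 1) / (a + 1)) (at_left (ereal c))"
        unfolding ereal_tendsto_simps .
    qed (use True in \<open>auto intro!: AE_I2 continuous_intros\<close>)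
    moreover have "einterval 0 (ereal c) = {0<..<c}" by (auto simp: einterval_def)
    ultimately have "integrable lborel (\<lambda>x. indicator {0<..<c} x * x powr a)"
      by (simp add: set_integrable_def)
    then show ?thesis by (rule integrable_hl_lborel)
  qed simp
next
  assume a: "a < -1" and c: "0 < c"
  have "set_integrable lborel (einterval (ereal c) \<infinity>) (\<lambda>x. x powr a)"
  proof (rule interval_integral_FTC_nonneg(1)[where F="\<lambda>x. x powr (a + 1) / (a + 1)"])
    show "((\<lambda>x. x powr (a + 1) / (a + 1)) has_real_derivative x powr a) (at x)" if "ereal c < ereal x" for x
      using a c that by (auto intro!: derivative_eq_intros)
    have "((\<lambda>x. x powr (a + 1) / (a + 1)) \<longlongrightarrow> c powr (a + 1) / (a + 1)) (at_right c)"
      by (intro tendsto_intros) (use c a in auto)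
    then show "(((\<lambda>x. x powr (a + 1) / (a + 1)) \<circ> real_of_ereal) \<longlongrightarrow> c powr (a + 1) / (a + 1)) (at_right (ereal c))"
      unfolding ereal_tendsto_simps .
    show "(((\<lambda>x. x powr (a + 1) / (a + 1)) \<circ> real_of_ereal) \<longlongrightarrow> 0) (at_left \<infinity>)"
      unfolding ereal_tendsto_simps using a by real_asymp
  qed (use c in \<open>auto intro!: AE_I2 continuous_intros\<close>)
  moreover have "einterval (ereal c) \<infinity> = {c<..}" by (auto simp: einterval_def)
  ultimately have "integrable lborel (\<lambda>x. indicator {c<..} x * x powr a)"
    by (simp add: set_integrable_def)
  then show "integrable hl (\<lambda>x. indicator {c<..} x * x powr a)" by (rule integrable_hl_lborel)
qed

text \<open>The constant \<open>A\<close> in \<open>A r^\<alpha> = \<integral> (1 - sin(kr)/(kr)) k^(-1-\<alpha>) dk\<close>.\<close>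

definition sinc_moment :: "real \<Rightarrow> real"
  where "sinc_moment \<alpha> = (\<integral>s. (1 - sincf s) * s powr (- 1 - \<alpha>) \<partial>hl)"

text \<open>The integrand is at most \<open>s^(1-\<alpha>)\<close> near \<open>0\<close> and at most \<open>2 s^(-1-\<alpha>)\<close> near infinity; integrability
  of the former is the condition \<open>\<alpha> < 2\<close>, that of the latter is \<open>0 < \<alpha>\<close>.\<close>

lemma integrable_sinc_moment:
  assumes "0 < \<alpha>" "\<alpha> < 2"
  shows "integrable hl (\<lambda>s. (1 - sincf s) * s powr (- 1 - \<alpha>))"
proof (rule Bochner_Integration.integrable_bound)
  show "integrable hl (\<lambda>s. indicator {0<..<2} s * s powr (1 - \<alpha>) + 2 * (indicator {1<..} s * s powr (- 1 - \<alpha>)))"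
    using assms by (intro Bochner_Integration.integrable_add integrable_mult_right integrable_hl_powr) auto
  show "(\<lambda>s. (1 - sincf s) * s powr (- 1 - \<alpha>)) \<in> borel_measurable hl"
    by (rule measurable_hl) measurable
  show "AE s in hl. norm ((1 - sincf s) * s powr (- 1 - \<alpha>))
    \<le> norm (indicator {0<..<2} s * s powr (1 - \<alpha>) + 2 * (indicator {1<..} s * s powr (- 1 - \<alpha>)))"
  proof (intro AE_I2)
    fix s assume "s \<in> space hl"
    then have s: "0 < s" by (simp add: space_restrict_space)
    note sb = sincf_bounds[of s]
    have n: "norm ((1 - sincf s) * s powr (- 1 - \<alpha>)) = (1 - sincf s) * s powr (- 1 - \<alpha>)"
      using sb(1) by (simp only: real_norm_def abs_mult abs_of_nonneg powr_ge_zero)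
    show "norm ((1 - sincf s) * s powr (- 1 - \<alpha>))
      \<le> norm (indicator {0<..<2} s * s powr (1 - \<alpha>) + 2 * (indicator {1<..} s * s powr (- 1 - \<alpha>)))"
    proof (cases "s < 2")
      case True
      have "(1 - sincf s) * s powr (- 1 - \<alpha>) \<le> s\<^sup>2 * s powr (- 1 - \<alpha>)" by (intro mult_right_mono sb) simp
      also have "\<dots> = s powr 2 * s powr (- 1 - \<alpha>)" using s by (simp add: powr_numeral)
      also have "\<dots> = s powr (1 - \<alpha>)" by (simp flip: powr_add)
      also have "\<dots> \<le> s powr (1 - \<alpha>) + 2 * (indicator {1<..} s * s powr (- 1 - \<alpha>))" by simp
      finally show ?thesis unfolding n using True s by simp
    next
      case False
      have "(1 - sincf s) * s powr (- 1 - \<alpha>) \<le> 2 * s powr (- 1 - \<alpha>)" by (intro mult_right_mono sb) simp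
      then show ?thesis unfolding n using False s by simp
    qed
  qed
qed

text \<open>The integrand is nonnegative, and on \<open>[2, 3]\<close> it is at least half of \<open>3^(-1-\<alpha>)\<close>.\<close>

lemma sinc_moment_pos:
  assumes "0 < \<alpha>" "\<alpha> < 2"
  shows "0 < sinc_moment \<alpha>"
proof -
  have m: "emeasure lborel {2..3::real} < \<infinity>" by simp
  have ii: "integrable hl (\<lambda>s. indicator {2..3} s * (1/2 * 3 powr (- 1 - \<alpha>)))"
    by (rule integrable_hl_lborel) simp
  have "0 < (1/2 * 3 powr (- 1 - \<alpha>) :: real)" by simp
  also have "\<dots> = (\<integral>s. indicator {2..3} s * (1/2 * 3 powr (- 1 - \<alpha>)) \<partial>hl)"
  proof -
    have "(\<lambda>s. indicator {0<..} s *\<^sub>R (indicator {2..3::real} s * (1/2 * 3 powr (- 1 - \<alpha>))))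
       = (\<lambda>s. indicator {2..3::real} s *\<^sub>R (1/2 * 3 powr (- 1 - \<alpha>)))"
      by (auto simp: indicator_def fun_eq_iff)
    then show ?thesis unfolding integral_hl by (simp only:) simp
  qed
  also have "\<dots> \<le> sinc_moment \<alpha>"
    unfolding sinc_moment_def
  proof (rule integral_mono[OF ii integrable_sinc_moment[OF assms]])
    fix s assume "s \<in> space hl"
    show "indicator {2..3} s * (1/2 * 3 powr (- 1 - \<alpha>)) \<le> (1 - sincf s) * s powr (- 1 - \<alpha>)"
    proof (cases "s \<in> {2..3}")
      case True
      have "sin s / s \<le> 1 / 2"
      proof -
        have s2: "2 \<le> s" using True by simp
        then have "sin s * 2 \<le> s" using sin_le_one[of s] by linarith
        then show ?thesis using s2 by (simp add: divide_le_eq)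
      qed
      then have "1/2 \<le> 1 - sincf s" using True by (auto simp: sincf_def)
      moreover have "3 powr (- 1 - \<alpha>) \<le> s powr (- 1 - \<alpha>)"
        using True assms by (intro powr_mono2') auto
      ultimately have "1/2 * 3 powr (- 1 - \<alpha>) \<le> (1 - sincf s) * s powr (- 1 - \<alpha>)"
        by (intro mult_mono) auto
      then show ?thesis using True by (simp only: indicator_simps mult_1)
    next
      case False
      then show ?thesis using sincf_bounds(1)[of s] by (simp add: mult_nonneg_nonneg)
    qed
  qed
  finally show ?thesis .
qed

text \<open>Substitute \<open>s = kr\<close>. Thus a power of \<open>r\<close> is a superposition of the functions \<open>1 - sin(kr)/(kr)\<close>,
  which are the increments of the radial waves of frequency \<open>k\<close>, with a power of \<open>k\<close> as density.\<close>

lemma sinc_moment_scaling: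
  assumes \<alpha>: "0 < \<alpha>" "\<alpha> < 2" and r: "0 < r"
  shows "integrable hl (\<lambda>k. (1 - sincf (k * r)) * k powr (- 1 - \<alpha>))"
    and "(\<integral>k. (1 - sincf (k * r)) * k powr (- 1 - \<alpha>) \<partial>hl) = sinc_moment \<alpha> * r powr \<alpha>"
proof -
  define f where "f s = indicator {0<..} s *\<^sub>R ((1 - sincf s) * s powr (- 1 - \<alpha>))" for s
  have fr: "f (0 + r * k) = r powr (- 1 - \<alpha>) * (indicator {0<..} k *\<^sub>R ((1 - sincf (k * r)) * k powr (- 1 - \<alpha>)))" for k
  proof (cases "0 < k")
    case True
    then show ?thesis using r by (simp add: f_def powr_mult mult.commute)
  qed (use r in \<open>simp add: f_def indicator_def zero_less_mult_iff\<close>)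
  have f: "integrable lborel f" unfolding f_def using integrable_sinc_moment[OF \<alpha>] by (simp add: integrable_hl)
  have "integrable lborel (\<lambda>k. f (0 + r * k))"
    using r by (intro lborel_integrable_real_affine f) simp
  then have "integrable lborel (\<lambda>k. indicator {0<..} k *\<^sub>R ((1 - sincf (k * r)) * k powr (- 1 - \<alpha>)))"
    unfolding fr using r by (simp only: integrable_mult_left_iff) simp
  then show "integrable hl (\<lambda>k. (1 - sincf (k * r)) * k powr (- 1 - \<alpha>))" by (simp add: integrable_hl)
  have "sinc_moment \<alpha> = (\<integral>s. f s \<partial>lborel)" by (simp add: sinc_moment_def integral_hl f_def)
  also have "\<dots> = \<bar>r\<bar> *\<^sub>R (\<integral>k. f (0 + r * k) \<partial>lborel)" using r by (intro lborel_integral_real_affine) simp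
  also have "\<dots> = (r powr 1 * r powr (- 1 - \<alpha>)) * (\<integral>k. (1 - sincf (k * r)) * k powr (- 1 - \<alpha>) \<partial>hl)"
    unfolding fr using r by (simp only: integral_mult_right_zero) (simp add: integral_hl)
  also have "r powr 1 * r powr (- 1 - \<alpha>) = r powr (- \<alpha>)" by (simp only: powr_add[symmetric]) simp
  finally show "(\<integral>k. (1 - sincf (k * r)) * k powr (- 1 - \<alpha>) \<partial>hl) = sinc_moment \<alpha> * r powr \<alpha>"
    using r by (simp add: powr_minus field_simps)
qed

section \<open>Continuity of the correlation function\<close>

lemma integrable_translate:
  fixes f :: "'a::euclidean_space \<Rightarrow> 'b::{banach,second_countable_topology}"
  assumes "integrable lborel f"
  shows "integrable lborel (\<lambda>x. f (x + h))"
    and "(\<integral>x. f (x + h) \<partial>lborel) = (\<integral>x. f x \<partial>lborel)"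
proof -
  have m: "(+) h \<in> measurable lborel borel" by simp
  have f: "f \<in> borel_measurable borel" using assms by (simp add: borel_measurable_integrable)
  have "integrable (distr lborel borel ((+) h)) f" using assms by (simp add: lborel_distr_plus)
  then have "integrable lborel (\<lambda>x. f (h + x))" by (subst (asm) integrable_distr_eq[OF m f])
  then show "integrable lborel (\<lambda>x. f (x + h))" by (simp add: add.commute)
  have "(\<integral>x. f x \<partial>lborel) = (\<integral>x. f x \<partial>distr lborel borel ((+) h))"
    by (simp add: lborel_distr_plus)
  also have "\<dots> = (\<integral>x. f (h + x) \<partial>lborel)" by (rule integral_distr[OF m f])
  finally show "(\<integral>x. f (x + h) \<partial>lborel) = (\<integral>x. f x \<partial>lborel)" by (simp add: add.commute)
qed

text \<open>Bounds the values by \<open>m\<close> and cuts the support down to the ball of radius \<open>m\<close>. It is jointly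
  continuous, so that it preserves both continuity of a function and pointwise convergence.\<close>

definition truncation :: "real \<Rightarrow> 'a::euclidean_space \<Rightarrow> 'b::euclidean_space \<Rightarrow> 'b"
  where "truncation m x v = (max 0 (min 1 (m - norm x)) * (m / max m (norm v))) *\<^sub>R v"

lemma norm_truncation:
  assumes "0 < m"
  shows "norm (truncation m x v) \<le> norm v" "norm (truncation m x v) \<le> m"
    "m \<le> norm x \<Longrightarrow> truncation m x v = 0"
proof -
  define a where "a = max 0 (min 1 (m - norm x))"
  have a: "0 \<le> a" "a \<le> 1" by (auto simp: a_def)
  have mv: "0 < max m (norm v)" using assms by auto
  have n: "norm (truncation m x v) = a * (m / max m (norm v) * norm v)"
    using a mv assms by (simp add: truncation_def a_def abs_mult)
  have "m / max m (norm v) * norm v \<le> norm v"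
    using mv mult_left_mono[of m "max m (norm v)" "norm v"] by (simp add: field_simps)
  moreover have "m / max m (norm v) * norm v \<le> m"
    using mv assms by (simp add: field_simps mult_left_mono)
  moreover have "0 \<le> m / max m (norm v) * norm v" using mv assms by simp
  ultimately show "norm (truncation m x v) \<le> norm v" "norm (truncation m x v) \<le> m"
    unfolding n using a by (meson mult_left_le_one_le order_trans)+
  show "m \<le> norm x \<Longrightarrow> truncation m x v = 0" by (simp add: truncation_def)
qed

lemma continuous_on_truncation:
  assumes "0 < m" "continuous_on S f" "continuous_on S g"
  shows "continuous_on S (\<lambda>z. truncation m (f z) (g z))"
  unfolding truncation_def
  by (intro continuous_intros assms) (use assms(1) in \<open>auto simp: max_def\<close>)

lemma borel_measurable_truncation[measurable]:
  assumes [measurable]: "f \<in> borel_measurable M" "g \<in> borel_measurable M"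
  shows "(\<lambda>z. truncation m (f z) (g z)) \<in> borel_measurable M"
  unfolding truncation_def by measurable

lemma truncation_tendsto:
  "(\<lambda>n. truncation (real (Suc n)) x v) \<longlonglongrightarrow> v"
proof (rule tendsto_eventually)
  obtain N :: nat where N: "norm x + 1 \<le> N" "norm v \<le> N"
    by (metis max.bounded_iff real_arch_simple)
  show "eventually (\<lambda>n. truncation (real (Suc n)) x v = v) sequentially"
    using eventually_ge_at_top[of N]
    by eventually_elim (use N in \<open>auto simp: truncation_def max_def min_def\<close>)
qed

lemma norm_diff_sq_le: "(norm (a - b :: 'a::real_normed_vector))\<^sup>2 \<le> 2 * (norm a)\<^sup>2 + 2 * (norm b)\<^sup>2"
proof -
  have "(norm (a - b))\<^sup>2 \<le> (norm a + norm b)\<^sup>2" by (simp add: norm_triangle_ineq4 power_mono)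
  also have "\<dots> \<le> 2 * (norm a)\<^sup>2 + 2 * (norm b)\<^sup>2"
    using zero_le_power2[of "norm a - norm b"] by (simp add: power2_eq_square algebra_simps)
  finally show ?thesis .
qed

lemma integrable_norm_diff_sq:
  fixes f g :: "'a \<Rightarrow> 'b::euclidean_space"
  assumes [measurable]: "f \<in> borel_measurable M" "g \<in> borel_measurable M"
    and int: "integrable M (\<lambda>x. (norm (f x))\<^sup>2)" "integrable M (\<lambda>x. (norm (g x))\<^sup>2)"
  shows "integrable M (\<lambda>x. (norm (f x - g x))\<^sup>2)"
proof (rule Bochner_Integration.integrable_bound)
  show "integrable M (\<lambda>x. 2 * (norm (f x))\<^sup>2 + 2 * (norm (g x))\<^sup>2)" using int by simp
  show "AE x in M. norm ((norm (f x - g x))\<^sup>2) \<le> norm (2 * (norm (f x))\<^sup>2 + 2 * (norm (g x))\<^sup>2)"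
    by (intro AE_I2) (use norm_diff_sq_le in auto)
qed auto

text \<open>Dominated convergence in \<open>L\<^sup>2\<close>: the integrands are at most \<open>4 (b x)\<^sup>2\<close>.\<close>

lemma
  fixes f :: "'a \<Rightarrow> 'b::euclidean_space" and g :: "nat \<Rightarrow> 'a \<Rightarrow> 'b"
  assumes [measurable]: "f \<in> borel_measurable M" "\<And>n. g n \<in> borel_measurable M"
    and b: "integrable M (\<lambda>x. (b x)\<^sup>2)"
    and le: "\<And>x. norm (f x) \<le> b x" "\<And>n x. norm (g n x) \<le> b x"
  shows dominated_L2_integrable: "integrable M (\<lambda>x. (norm (f x - g n x))\<^sup>2)"
    and dominated_L2_tendsto: "AE x in M. (\<lambda>n. g n x) \<longlonglongrightarrow> f x \<Longrightarrow>
      (\<lambda>n. \<integral>x. (norm (f x - g n x))\<^sup>2 \<partial>M) \<longlonglongrightarrow> 0"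
proof -
  have le4: "norm ((norm (f x - g n x))\<^sup>2) \<le> 4 * (b x)\<^sup>2" for n x
  proof -
    have "norm (f x - g n x) \<le> 2 * b x"
      using norm_triangle_ineq4[of "f x" "g n x"] le(1)[of x] le(2)[of n x] by linarith
    then have "(norm (f x - g n x))\<^sup>2 \<le> (2 * b x)\<^sup>2" by (intro power_mono) auto
    then show ?thesis by (simp add: power_mult_distrib)
  qed
  show "integrable M (\<lambda>x. (norm (f x - g n x))\<^sup>2)"
    by (rule Bochner_Integration.integrable_bound[of _ "\<lambda>x. 4 * (b x)\<^sup>2"])
      (use b le4 in auto)
  assume "AE x in M. (\<lambda>n. g n x) \<longlonglongrightarrow> f x"
  then have lim: "AE x in M. (\<lambda>n. (norm (f x - g n x))\<^sup>2) \<longlonglongrightarrow> 0"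
  proof eventually_elim
    case (elim x)
    then have "(\<lambda>n. (norm (f x - g n x))\<^sup>2) \<longlonglongrightarrow> (norm (f x - f x))\<^sup>2" by (intro tendsto_intros)
    then show ?case by simp
  qed
  have "(\<lambda>n. \<integral>x. (norm (f x - g n x))\<^sup>2 \<partial>M) \<longlonglongrightarrow> integral\<^sup>L M (\<lambda>x. 0)"
    by (rule integral_dominated_convergence[where w="\<lambda>x. 4 * (b x)\<^sup>2"]) (use b lim le4 in auto)
  then show "(\<lambda>n. \<integral>x. (norm (f x - g n x))\<^sup>2 \<partial>M) \<longlonglongrightarrow> 0" by simp
qed

lemma integrable_sq_indicator_cball:
  "integrable lborel (\<lambda>x::'a::euclidean_space. (m * indicator (cball 0 R) x)\<^sup>2 :: real)"
proof -
  have "(\<lambda>x::'a. (m * indicator (cball 0 R) x)\<^sup>2 :: real) = (\<lambda>x. m\<^sup>2 * indicator (cball 0 R) x)"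
    by (auto simp: indicator_def fun_eq_iff)
  then show ?thesis using emeasure_lborel_cball_finite[of "0::'a" R] by simp
qed

text \<open>A measurable function is an almost everywhere limit of continuous functions \<open>g k\<close>. Truncated at
  level \<open>m\<close>, these have a common majorant and converge in \<open>L\<^sup>2\<close> to the truncation of \<open>u\<close>, which is
  close to \<open>u\<close> for large \<open>m\<close>.\<close>

lemma L2_dense_continuous:
  fixes u :: "'a::euclidean_space \<Rightarrow> 'b::euclidean_space"
  assumes um[measurable]: "u \<in> borel_measurable borel"
    and int: "integrable lborel (\<lambda>x. (norm (u x))\<^sup>2)" and "0 < \<epsilon>"
  obtains w R where "continuous_on UNIV w" "\<And>x. R \<le> norm x \<Longrightarrow> w x = 0"
    "\<And>x. norm (w x) \<le> R" "(\<integral>x. (norm (u x - w x))\<^sup>2 \<partial>lborel) < \<epsilon>"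
proof -
  note trunc = dominated_L2_tendsto[of u lborel "\<lambda>n x. truncation (real (Suc n)) x (u x)" "\<lambda>x. norm (u x)"]
    dominated_L2_integrable[of u lborel "\<lambda>n x. truncation (real (Suc n)) x (u x)" "\<lambda>x. norm (u x)"]
  have "(\<lambda>n. \<integral>x. (norm (u x - truncation (real (Suc n)) x (u x)))\<^sup>2 \<partial>lborel) \<longlonglongrightarrow> 0"
    by (rule trunc(1)) (use int in \<open>auto intro!: norm_truncation AE_I2 truncation_tendsto simp del: of_nat_Suc\<close>)
  from eventually_happens'[OF _ order_tendstoD(2)[OF this, of "\<epsilon>/4"]] \<open>0 < \<epsilon>\<close>
  obtain n where n: "(\<integral>x. (norm (u x - truncation (real (Suc n)) x (u x)))\<^sup>2 \<partial>lborel) < \<epsilon>/4"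
    by auto
  define m where "m = real (Suc n)"
  have m: "0 < m" by (simp add: m_def)
  have i1: "integrable lborel (\<lambda>x. (norm (u x - truncation m x (u x)))\<^sup>2)"
    unfolding m_def by (rule trunc(2)) (use int in \<open>auto intro!: norm_truncation simp del: of_nat_Suc\<close>)
  have "u \<in> borel_measurable (completion lborel)" by (rule measurable_completion) simp
  then have "u measurable_on UNIV"
    by (simp add: measurable_on_iff_borel_measurable lebesgue_on_UNIV_eq)
  then obtain N g where N: "negligible N" and g: "\<And>k. continuous_on UNIV (g k)"
    and lim: "\<And>x. x \<notin> N \<Longrightarrow> (\<lambda>k. g k x) \<longlonglongrightarrow> u x"
    unfolding measurable_on_def by auto
  define w where "w k x = truncation m x (g k x)" for k :: nat and x
  have wc: "continuous_on UNIV (w k)" for k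
    unfolding w_def[abs_def] using g m by (intro continuous_on_truncation continuous_intros)
  then have wm[measurable]: "w k \<in> borel_measurable borel" for k
    by (rule borel_measurable_continuous_onI)
  have bd: "norm (w k x) \<le> m * indicator (cball 0 m) x" "norm (truncation m x (u x)) \<le> m * indicator (cball 0 m) x" for k x
    by (cases "norm x \<le> m"; simp add: w_def norm_truncation[OF m])+
  have ae: "AE x in lborel. (\<lambda>k. w k x) \<longlonglongrightarrow> truncation m x (u x)"
  proof -
    have "AE x in lborel. x \<notin> N"
      using AE_not_in[of N lebesgue] N by (simp add: negligible_iff_null_sets AE_completion_iff)
    then show ?thesis
    proof eventually_elim
      case (elim x)
      have "continuous_on UNIV (\<lambda>v::'b. truncation m x v)"
        by (intro continuous_on_truncation continuous_intros m)
      then show ?case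
        unfolding w_def using continuous_on_tendsto_compose lim[OF elim] by (metis UNIV_I eventuallyI)
    qed
  qed
  note approx = dominated_L2_tendsto[of "\<lambda>x. truncation m x (u x)" lborel w, OF _ _ integrable_sq_indicator_cball bd(2,1)]
    dominated_L2_integrable[of "\<lambda>x. truncation m x (u x)" lborel w, OF _ _ integrable_sq_indicator_cball bd(2,1)]
  have "(\<lambda>k. \<integral>x. (norm (truncation m x (u x) - w k x))\<^sup>2 \<partial>lborel) \<longlonglongrightarrow> 0"
    by (rule approx(1)) (use ae in auto)
  from eventually_happens'[OF _ order_tendstoD(2)[OF this, of "\<epsilon>/4"]] \<open>0 < \<epsilon>\<close>
  obtain k where k: "(\<integral>x. (norm (truncation m x (u x) - w k x))\<^sup>2 \<partial>lborel) < \<epsilon>/4"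
    by auto
  have i2: "integrable lborel (\<lambda>x. (norm (truncation m x (u x) - w k x))\<^sup>2)" by (rule approx(2)) auto
  have "(\<integral>x. (norm (u x - w k x))\<^sup>2 \<partial>lborel)
    \<le> (\<integral>x. 2 * (norm (u x - truncation m x (u x)))\<^sup>2 + 2 * (norm (truncation m x (u x) - w k x))\<^sup>2 \<partial>lborel)"
  proof (rule integral_mono')
    show "(norm (u x - w k x))\<^sup>2 \<le> 2 * (norm (u x - truncation m x (u x)))\<^sup>2 + 2 * (norm (truncation m x (u x) - w k x))\<^sup>2" for x
      using norm_diff_sq_le[of "u x - truncation m x (u x)" "w k x - truncation m x (u x)"]
      by (simp add: norm_minus_commute)
  qed (use i1 i2 in auto)
  also have "\<dots> < \<epsilon>" using n k i1 i2 by (simp add: m_def)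
  finally have "(\<integral>x. (norm (u x - w k x))\<^sup>2 \<partial>lborel) < \<epsilon>" .
  then show ?thesis
    by (intro that[of "w k" m] wc) (auto simp: w_def norm_truncation[OF m])
qed

text \<open>For a continuous function of bounded support this is dominated convergence. Translations preserve
  the \<open>L\<^sup>2\<close> norm, so the error of approximating \<open>u\<close> by such a function is uniform in \<open>h\<close>.\<close>

theorem L2_continuous_translation:
  fixes u :: "'a::euclidean_space \<Rightarrow> 'b::euclidean_space"
  assumes [measurable]: "u \<in> borel_measurable borel"
    and int: "integrable lborel (\<lambda>x. (norm (u x))\<^sup>2)"
  shows "((\<lambda>h. \<integral>x. (norm (u (x + h) - u x))\<^sup>2 \<partial>lborel) \<longlongrightarrow> 0) (at 0)"
proof (rule tendstoI)
  fix \<epsilon> :: real assume \<epsilon>: "0 < \<epsilon>"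
  \<comment> \<open>Below, this error enters with weight 8 and the increment of \<open>w\<close> with weight 2.\<close>
  obtain w R where w: "continuous_on UNIV w" "\<And>x. R \<le> norm x \<Longrightarrow> w x = 0"
    "\<And>x. norm (w x) \<le> R" "(\<integral>x. (norm (u x - w x))\<^sup>2 \<partial>lborel) < \<epsilon>/16"
  proof -
    have "0 < \<epsilon>/16" using \<epsilon> by simp
    from L2_dense_continuous[OF assms this] that show thesis by blast
  qed
  have [measurable]: "w \<in> borel_measurable borel"
    using w by (intro borel_measurable_continuous_onI)
  have R: "0 \<le> R" using norm_ge_zero w(3) order_trans by blast
  have wb: "norm (w (x + h)) \<le> R * indicator (cball 0 (R + 1)) x" if "norm h \<le> 1" for x h
  proof (cases "norm x \<le> R + 1")
    case True
    then show ?thesis using w(3)[of "x + h"] by simp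
  next
    case False
    then have "R \<le> norm (x + h)" using norm_triangle_ineq4[of "x + h" h] that by simp
    with False w(2) show ?thesis by simp
  qed
  have intw: "integrable lborel (\<lambda>x. (norm (w x))\<^sup>2)"
  proof -
    have "integrable lborel (\<lambda>x. (norm (w x - 0))\<^sup>2)"
      by (rule dominated_L2_integrable[where g="\<lambda>_ _. 0", OF _ _ integrable_sq_indicator_cball[of R "R + 1"]])
        (use wb[of 0] R in auto)
    then show ?thesis by simp
  qed
  have flip: "norm (w (x + h) - w x) = norm (w x - w (x + h))" for x h by (rule norm_minus_commute)
  have lim: "((\<lambda>h. \<integral>x. (norm (w (x + h) - w x))\<^sup>2 \<partial>lborel) \<longlongrightarrow> 0) (at 0)"
    unfolding tendsto_at_iff_sequentially comp_def
  proof (intro allI impI)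
    fix X :: "nat \<Rightarrow> 'a" assume X: "X \<longlonglongrightarrow> 0"
    have "\<exists>N. \<forall>n\<ge>N. norm (X n) < 1" using LIMSEQ_D[OF X, of 1] by auto
    then obtain N where N: "\<And>n. N \<le> n \<Longrightarrow> norm (X n) \<le> 1" using less_imp_le by blast
    have "(\<lambda>n. \<integral>x. (norm (w x - w (x + X (n + N))))\<^sup>2 \<partial>lborel) \<longlonglongrightarrow> 0"
    proof (rule dominated_L2_tendsto[OF _ _ integrable_sq_indicator_cball])
      show "norm (w x) \<le> R * indicator (cball 0 (R + 1)) x" for x using wb[of 0 x] by simp
      show "norm (w (x + X (n + N))) \<le> R * indicator (cball 0 (R + 1)) x" for n x by (rule wb[OF N]) simp
      show "AE x in lborel. (\<lambda>n. w (x + X (n + N))) \<longlonglongrightarrow> w x"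
      proof (intro AE_I2)
        fix x
        have "(\<lambda>n. x + X (n + N)) \<longlonglongrightarrow> x + 0"
          by (intro tendsto_intros LIMSEQ_ignore_initial_segment X)
        then show "(\<lambda>n. w (x + X (n + N))) \<longlonglongrightarrow> w x"
          using continuous_on_tendsto_compose[OF w(1), of _ x] by auto
      qed
    qed auto
    then show "(\<lambda>n. \<integral>x. (norm (w (x + X n) - w x))\<^sup>2 \<partial>lborel) \<longlonglongrightarrow> 0"
      unfolding flip by (rule LIMSEQ_offset)
  qed
  have bound: "(\<integral>x. (norm (u (x + h) - u x))\<^sup>2 \<partial>lborel)
      \<le> 8 * (\<integral>x. (norm (u x - w x))\<^sup>2 \<partial>lborel) + 2 * (\<integral>x. (norm (w (x + h) - w x))\<^sup>2 \<partial>lborel)" for h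
  proof -
    have i1: "integrable lborel (\<lambda>x. (norm (u x - w x))\<^sup>2)"
      by (intro integrable_norm_diff_sq int intw) auto
    have i2: "integrable lborel (\<lambda>x. (norm (u (x + h) - w (x + h)))\<^sup>2)"
      by (rule integrable_translate(1)[OF i1])
    have i3: "integrable lborel (\<lambda>x. (norm (w (x + h) - w x))\<^sup>2)"
      by (intro integrable_norm_diff_sq intw integrable_translate(1)[OF intw]) auto
    have gen: "p \<le> 4 * a + 4 * b + 2 * r" if "p \<le> 2 * q + 2 * r" "2 * q \<le> 2 * (2 * a + 2 * b)"
      for p q r a b :: real
      using that by argo
    have "(\<integral>x. (norm (u (x + h) - u x))\<^sup>2 \<partial>lborel)
       \<le> (\<integral>x. 4 * (norm (u (x + h) - w (x + h)))\<^sup>2 + 4 * (norm (u x - w x))\<^sup>2 + 2 * (norm (w (x + h) - w x))\<^sup>2 \<partial>lborel)"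
    proof (rule integral_mono')
      fix x
      let ?a = "u (x + h) - w (x + h)" and ?b = "u x - w x" and ?c = "w (x + h) - w x"
      have "u (x + h) - u x = (?a - ?b) - (- ?c)" by simp
      then have 1: "(norm (u (x + h) - u x))\<^sup>2 \<le> 2 * (norm (?a - ?b))\<^sup>2 + 2 * (norm (- ?c))\<^sup>2"
        using norm_diff_sq_le[of "?a - ?b" "- ?c"] by metis
      have 2: "2 * (norm (?a - ?b))\<^sup>2 \<le> 2 * (2 * (norm ?a)\<^sup>2 + 2 * (norm ?b)\<^sup>2)"
        by (rule mult_left_mono[OF norm_diff_sq_le]) simp
      show "(norm (u (x + h) - u x))\<^sup>2 \<le> 4 * (norm ?a)\<^sup>2 + 4 * (norm ?b)\<^sup>2 + 2 * (norm ?c)\<^sup>2"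
        using gen[OF 1[unfolded norm_minus_cancel[of ?c]] 2] .
    qed (use i1 i2 i3 in auto)
    also have "\<dots> = 4 * (\<integral>x. (norm (u (x + h) - w (x + h)))\<^sup>2 \<partial>lborel) + 4 * (\<integral>x. (norm (u x - w x))\<^sup>2 \<partial>lborel) + 2 * (\<integral>x. (norm (w (x + h) - w x))\<^sup>2 \<partial>lborel)"
      using i1 i2 i3 by simp
    finally show ?thesis using integrable_translate(2)[OF i1, of h] by simp
  qed
  have "eventually (\<lambda>h. dist (\<integral>x. (norm (w (x + h) - w x))\<^sup>2 \<partial>lborel) 0 < \<epsilon>/4) (at 0)"
    by (rule tendstoD[OF lim]) (use \<epsilon> in simp)
  then show "eventually (\<lambda>h. dist (\<integral>x. (norm (u (x + h) - u x))\<^sup>2 \<partial>lborel) 0 < \<epsilon>) (at 0)"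
  proof eventually_elim
    case (elim h)
    have "0 \<le> (\<integral>x. (norm (u (x + h) - u x))\<^sup>2 \<partial>lborel)" by simp
    with bound[of h] w(4) elim show ?case by (simp add: dist_real_def)
  qed
qed

lemma square_integrable_borel_representative:
  assumes "square_integrable u"
  obtains v where "v \<in> borel_measurable borel" "integrable lborel (\<lambda>x. (norm (v x))\<^sup>2)"
    "AE x in lborel. u x = v x"
proof -
  have um: "u \<in> borel_measurable (completion lborel)" and ui: "integrable lebesgue (\<lambda>x. (norm (u x))\<^sup>2)"
    using assms by (auto simp: square_integrable_def)
  have "(\<lambda>x. u x $ i) \<in> borel_measurable (completion lborel)" for i
    using measurable_compose[OF um, of "\<lambda>v. v $ i"] by simp
  then have ex: "\<forall>i. \<exists>g. g \<in> borel_measurable lborel \<and> (AE x in lborel. u x $ i = g x)"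
    using completion_ex_borel_measurable_real by blast
  from choice[OF ex] obtain g where g: "\<And>i. g i \<in> borel_measurable lborel"
      "\<And>i. AE x in lborel. u x $ i = g i x"
    by blast
  define v where "v x = (\<chi> i. g i x)" for x
  have [measurable]: "v \<in> borel_measurable borel"
    unfolding borel_measurable_euclidean_space[of v]
  proof
    fix b :: "real^3" assume "b \<in> Basis"
    then obtain i where "b = axis i 1" by (auto simp: Basis_vec_def)
    then have "(\<lambda>x. v x \<bullet> b) = g i" by (simp add: v_def inner_axis fun_eq_iff)
    then show "(\<lambda>x. v x \<bullet> b) \<in> borel_measurable borel" using g(1)[of i] by simp
  qed
  have "AE x in lborel. \<forall>i. u x $ i = g i x" using g(2) by (simp add: eventually_all_finite)
  then have ae: "AE x in lborel. u x = v x"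
    by eventually_elim (simp add: v_def vec_eq_iff)
  have m: "(\<lambda>x. (norm (v x))\<^sup>2) \<in> borel_measurable lborel" by simp
  have "AE x in lebesgue. (norm (u x))\<^sup>2 = (norm (v x))\<^sup>2"
    using AE_completion[OF ae] by eventually_elim simp
  from integrable_cong_AE_imp[OF ui measurable_completion[OF m] this]
  have "integrable lborel (\<lambda>x. (norm (v x))\<^sup>2)" using integrable_completion[OF m] by simp
  with ae show ?thesis by (intro that) auto
qed

lemma AE_translate:
  fixes h :: "'a::euclidean_space"
  assumes "AE x in lborel. P x"
  shows "AE x in lborel. P (x + h)"
proof -
  have "AE x in distr lborel borel ((+) h). P x" using assms by (subst lborel_distr_plus)
  from AE_distrD[OF _ this] show ?thesis by (simp add: add.commute)
qed

lemma lebesgue_integral_representative: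
  fixes f g :: "'a::euclidean_space \<Rightarrow> real"
  assumes "g \<in> borel_measurable borel" "AE x in lborel. f x = g x"
  shows "(\<integral>x. f x \<partial>lebesgue) = (\<integral>x. g x \<partial>lborel)"
proof -
  have g: "g \<in> borel_measurable lebesgue" using assms by (auto intro: measurable_completion)
  have ae: "AE x in lebesgue. g x = f x" using assms(2) by (auto intro!: AE_completion elim: eventually_mono)
  have "f \<in> borel_measurable lebesgue"
    using borel_measurable_AE[OF g ae] .
  then have "(\<integral>x. f x \<partial>lebesgue) = (\<integral>x. g x \<partial>lebesgue)"
    by (intro integral_cong_AE) (use g ae in auto)
  also have "\<dots> = (\<integral>x. g x \<partial>lborel)" using assms by (intro integral_completion) auto
  finally show ?thesis .
qed

definition autocorr :: "(real^3 \<Rightarrow> real^3) \<Rightarrow> real^3 \<Rightarrow> real"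
  where "autocorr u y = (\<integral>x. u (x + y) \<bullet> u x \<partial>lebesgue)"

text \<open>Let \<open>D(h)\<close> be the integral of \<open>|u(x + h) - u(x)|\<^sup>2\<close>, which tends to \<open>0\<close> with \<open>h\<close>. Expanding the
  square gives the second claim. For the first, the Young inequality bounds
  \<open>|autocorr u (y + h) - autocorr u y|\<close> by \<open>D(h)/(2e) + e autocorr u 0 / 2\<close> for every \<open>e > 0\<close>.\<close>

lemma autocorr_estimates:
  assumes "square_integrable u"
  shows "continuous_on UNIV (autocorr u)"
    and "(\<integral>x. (norm (u (x + y) - u x))\<^sup>2 \<partial>lebesgue) = 2 * autocorr u 0 - 2 * autocorr u y"
    and "\<bar>autocorr u y\<bar> \<le> autocorr u 0"
proof -
  obtain v where vm[measurable]: "v \<in> borel_measurable borel" and vi: "integrable lborel (\<lambda>x. (norm (v x))\<^sup>2)"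
    and ae: "AE x in lborel. u x = v x"
    using square_integrable_borel_representative[OF assms] .
  have ae2: "AE x in lborel. u (x + h) = v (x + h) \<and> u x = v x" for h
    using ae AE_translate[OF ae, of h] by eventually_elim simp
  have F: "autocorr u h = (\<integral>x. v (x + h) \<bullet> v x \<partial>lborel)" for h
    unfolding autocorr_def
    by (rule lebesgue_integral_representative, simp) (use ae2[of h] in eventually_elim, simp)
  define D where "D h = (\<integral>x. (norm (v (x + h) - v x))\<^sup>2 \<partial>lborel)" for h
  have D: "(\<integral>x. (norm (u (x + h) - u x))\<^sup>2 \<partial>lebesgue) = D h" for h
    unfolding D_def
    by (rule lebesgue_integral_representative, simp) (use ae2[of h] in eventually_elim, simp)
  note vt = integrable_translate[OF vi]
  have iD: "integrable lborel (\<lambda>x. (norm (v (x + h) - v x))\<^sup>2)" for h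
    by (intro integrable_norm_diff_sq vi vt) auto
  have ip: "\<bar>a \<bullet> b\<bar> \<le> (norm a)\<^sup>2 / (2 * e) + e * (norm b)\<^sup>2 / 2" if "0 < e" for a b :: "real^3" and e :: real
  proof -
    have "\<bar>a \<bullet> b\<bar> \<le> norm a * norm b" by (rule Cauchy_Schwarz_ineq2)
    also have "\<dots> \<le> (norm a)\<^sup>2 / (2 * e) + e * (norm b)\<^sup>2 / 2"
      using zero_le_power2[of "norm a - e * norm b"] that
      by (simp add: field_simps power2_eq_square)
    finally show ?thesis .
  qed
  have ii: "integrable lborel (\<lambda>x. v (x + h) \<bullet> v x)" for h
  proof (rule Bochner_Integration.integrable_bound)
    show "integrable lborel (\<lambda>x. (norm (v (x + h)))\<^sup>2 / (2 * 1) + 1 * (norm (v x))\<^sup>2 / 2)"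
      using vt(1)[of h] vi by simp
    show "AE x in lborel. norm (v (x + h) \<bullet> v x) \<le> norm ((norm (v (x + h)))\<^sup>2 / (2 * 1) + 1 * (norm (v x))\<^sup>2 / 2)"
      unfolding real_norm_def by (intro AE_I2 order_trans[OF ip[of 1] abs_ge_self]) simp
  qed auto
  have F0: "autocorr u 0 = (\<integral>x. (norm (v x))\<^sup>2 \<partial>lborel)" unfolding F by (simp add: power2_norm_eq_inner)
  have DF: "D h = 2 * autocorr u 0 - 2 * autocorr u h" for h
  proof -
    have "D h = (\<integral>x. (norm (v (x + h)))\<^sup>2 + (norm (v x))\<^sup>2 - 2 * (v (x + h) \<bullet> v x) \<partial>lborel)"
      unfolding D_def by (intro Bochner_Integration.integral_cong) (auto simp: power2_norm_eq_inner inner_diff_left inner_diff_right inner_commute)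
    also have "\<dots> = 2 * autocorr u 0 - 2 * autocorr u h"
      using vt[of h] vi ii[of h] F0 F[of h] by simp
    finally show ?thesis .
  qed
  then show "(\<integral>x. (norm (u (x + y) - u x))\<^sup>2 \<partial>lebesgue) = 2 * autocorr u 0 - 2 * autocorr u y" by (simp add: D)
  have "\<bar>autocorr u y\<bar> \<le> (\<integral>x. (norm (v (x+y)))\<^sup>2 / (2 * 1) + 1 * (norm (v x))\<^sup>2 / 2 \<partial>lborel)"
    unfolding F
    by (rule order_trans[OF integral_abs_bound]) (rule integral_mono, use ii vt vi ip[of 1] in auto)
  also have "\<dots> = autocorr u 0" using vt[of y] vi by (simp add: F0)
  finally show "\<bar>autocorr u y\<bar> \<le> autocorr u 0" .
  have lim: "(D \<longlongrightarrow> 0) (at 0)"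
    unfolding D_def[abs_def] by (rule L2_continuous_translation[OF vm vi])
  have est: "\<bar>autocorr u (y + h) - autocorr u y\<bar> \<le> D h / (2 * e) + e * autocorr u 0 / 2" if "0 < e" for y h e
  proof -
    have i: "integrable lborel (\<lambda>x. (norm (v (x + y + h) - v (x + y)))\<^sup>2)"
      using integrable_translate(1)[OF iD[of h], of y] by (simp add: ac_simps)
    have "autocorr u (y + h) - autocorr u y = (\<integral>x. (v (x + y + h) - v (x + y)) \<bullet> v x \<partial>lborel)"
      unfolding F using ii[of "y + h"] ii[of y] by (simp add: inner_diff_left add.assoc)
    also have "\<bar>\<dots>\<bar> \<le> (\<integral>x. (norm (v (x + y + h) - v (x + y)))\<^sup>2 / (2 * e) + e * (norm (v x))\<^sup>2 / 2 \<partial>lborel)"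
    proof (rule order_trans[OF integral_abs_bound], rule integral_mono)
      show "integrable lborel (\<lambda>x. \<bar>(v (x + y + h) - v (x + y)) \<bullet> v x\<bar>)"
        using ii[of "y + h"] ii[of y] by (simp add: inner_diff_left add.assoc)
      show "integrable lborel (\<lambda>x. (norm (v (x + y + h) - v (x + y)))\<^sup>2 / (2 * e) + e * (norm (v x))\<^sup>2 / 2)"
        using i vi by simp
    qed (rule ip[OF that])
    also have "\<dots> = D h / (2 * e) + e * autocorr u 0 / 2"
      using i vi integrable_translate(2)[OF iD[of h], of y] by (simp add: F0 D_def ac_simps)
    finally show ?thesis .
  qed
  show "continuous_on UNIV (autocorr u)"
    unfolding continuous_on_eq_continuous_at[OF open_UNIV] isCont_iff
  proof (intro ballI tendstoI)
    fix y and r :: real assume r: "0 < r"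
    define e where "e = r / (autocorr u 0 + 1)"
    have F0p: "0 \<le> autocorr u 0" by (simp add: F0)
    have e: "0 < e" "e * autocorr u 0 / 2 < r / 2"
      using r F0p by (auto simp: e_def field_simps)
    have "eventually (\<lambda>h. dist (D h) 0 < e * r) (at 0)" by (rule tendstoD[OF lim]) (use r e in simp)
    then show "eventually (\<lambda>h. dist (autocorr u (y + h)) (autocorr u y) < r) (at 0)"
    proof eventually_elim
      case (elim h)
      have "D h / (2 * e) < r / 2" using elim e by (simp add: field_simps dist_real_def)
      with est[OF e(1), of y h] e show ?case by (simp add: dist_real_def)
    qed
  qed
qed


lemma correlation_autocorr: "correlation \<nu> u y = 1/2 * (\<integral>A. autocorr u (A *v y) \<partial>\<nu>)"
  by (simp add: correlation_def autocorr_def)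

lemma measurable_haar_O3:
  assumes h: "normalized_haar_O3 \<nu>" and f: "continuous_on UNIV f"
  shows "f \<in> borel_measurable \<nu>"
proof -
  have st: "sets \<nu> = sets (restrict_space borel O3)" using h by (simp add: normalized_haar_O3_def)
  show ?thesis
    by (subst measurable_cong_sets[OF st refl])
      (intro measurable_restrict_space1 borel_measurable_continuous_onI f)
qed

text \<open>Continuity of \<open>autocorr u\<close> provides measurability in the rotation, without which the averages over
  the group would not be linear; by dominated convergence, it carries over to the average.\<close>

lemma
  assumes h: "normalized_haar_O3 \<nu>" and u: "square_integrable u"
  shows structure2_eq_correlation:
      "structure2 \<nu> u l = correlation \<nu> u 0 - correlation \<nu> u (l *\<^sub>R axis 1 1)"
    and continuous_on_correlation: "continuous_on UNIV (correlation \<nu> u)"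
    and correlation_radial: "correlation \<nu> u y = correlation \<nu> u (norm y *\<^sub>R axis 1 1)"
proof -
  interpret prob_space \<nu> using h by (simp add: normalized_haar_O3_def)
  have c: "continuous_on UNIV (\<lambda>A::real^3^3. autocorr u (A *v y))" for y
    by (rule continuous_on_compose2[OF autocorr_estimates(1)[OF u]])
      (auto simp: matrix_vector_mult_def intro!: continuous_intros)
  note m = measurable_haar_O3[OF h c]
  have i: "integrable \<nu> (\<lambda>A. autocorr u (A *v y))" for y
    by (rule integrable_const_bound[of _ "autocorr u 0"]) (use autocorr_estimates(3)[OF u] m in auto)
  have "structure2 \<nu> u l = 1/4 * (\<integral>A. 2 * autocorr u 0 - 2 * autocorr u (A *v (l *\<^sub>R axis 1 1)) \<partial>\<nu>)"
    by (simp add: structure2_def structure2_vec_def autocorr_estimates(2)[OF u])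
  also have "\<dots> = correlation \<nu> u 0 - correlation \<nu> u (l *\<^sub>R axis 1 1)"
    using i by (simp add: correlation_autocorr prob_space)
  finally show "structure2 \<nu> u l = correlation \<nu> u 0 - correlation \<nu> u (l *\<^sub>R axis 1 1)" .
  show "correlation \<nu> u y = correlation \<nu> u (norm y *\<^sub>R axis 1 1)"
    unfolding correlation_autocorr using haar_average_radial[OF h, of y "norm y *\<^sub>R axis 1 1"] by simp
  show "continuous_on UNIV (correlation \<nu> u)"
    unfolding continuous_on_sequentially
  proof (intro allI ballI impI, elim conjE)
    fix X :: "nat \<Rightarrow> real^3" and a assume X: "X \<longlonglongrightarrow> a"
    have "(\<lambda>n. \<integral>A. autocorr u (A *v X n) \<partial>\<nu>) \<longlonglongrightarrow> (\<integral>A. autocorr u (A *v a) \<partial>\<nu>)"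
    proof (rule integral_dominated_convergence[where w="\<lambda>_. autocorr u 0"])
      show "AE A in \<nu>. (\<lambda>n. autocorr u (A *v X n)) \<longlonglongrightarrow> autocorr u (A *v a)"
      proof (intro AE_I2)
        fix A :: "real^3^3"
        have "(\<lambda>n. A *v X n) \<longlonglongrightarrow> A *v a"
          by (rule bounded_linear.tendsto[OF matrix_vector_mul_bounded_linear X])
        then show "(\<lambda>n. autocorr u (A *v X n)) \<longlonglongrightarrow> autocorr u (A *v a)"
          using continuous_on_tendsto_compose[OF autocorr_estimates(1)[OF u], of _ "A *v a"] by auto
      qed
    qed (use m autocorr_estimates(3)[OF u] in auto)
    then show "(correlation \<nu> u \<circ> X) \<longlonglongrightarrow> correlation \<nu> u a"
      unfolding comp_def correlation_autocorr by (intro tendsto_intros)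
  qed
qed

section \<open>Slices of space and radial functions\<close>

text \<open>The first coordinate is placed last, so that Fubini provides, for almost every pair of the other
  two coordinates, a statement about the whole line parallel to the first axis.\<close>

definition vec_of_slice :: "(real \<times> real) \<times> real \<Rightarrow> real^3"
  where "vec_of_slice p = (\<chi> i. if i = 1 then snd p else if i = 2 then fst (fst p) else snd (fst p))"

lemma vec_of_slice_nth [simp]:
  "vec_of_slice p $ 1 = snd p" "vec_of_slice p $ 2 = fst (fst p)" "vec_of_slice p $ 3 = snd (fst p)"
  by (simp_all add: vec_of_slice_def)

lemma continuous_on_vec_of_slice: "continuous_on UNIV vec_of_slice"
  unfolding vec_of_slice_def[abs_def]
proof (rule continuous_on_vec_lambda)
  show "continuous_on UNIV (\<lambda>p::(real \<times> real) \<times> real. if i = 1 then snd p else if i = 2 then fst (fst p) else snd (fst p))" for i :: 3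
    by (cases "i = 1"; cases "i = 2") (simp_all add: continuous_on_fst continuous_on_snd)
qed

lemma measurable_vec_of_slice [measurable]: "vec_of_slice \<in> borel_measurable borel"
  by (intro borel_measurable_continuous_onI continuous_on_vec_of_slice)

lemma Basis_vec3: "(Basis :: (real^3) set) = {axis 1 1, axis 2 1, axis 3 1}"
  by (auto simp: Basis_vec_def UNIV_3)

lemma distr_vec_of_slice: "distr lborel borel vec_of_slice = lborel"
proof (rule lborel_eqI[symmetric])
  fix l u :: "real^3" assume lu: "\<And>b. b \<in> Basis \<Longrightarrow> l \<bullet> b \<le> u \<bullet> b"
  have lu': "l $ i \<le> u $ i" for i
    using lu[of "axis i 1"] by (simp add: inner_axis axis_in_Basis_iff)
  have "vec_of_slice -` box l u = ({l $ 2<..<u $ 2} \<times> {l $ 3<..<u $ 3}) \<times> {l $ 1<..<u $ 1}"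
    by (auto simp: mem_box_cart forall_3)
  then have "emeasure (distr lborel borel vec_of_slice) (box l u)
      = emeasure lborel (({l $ 2<..<u $ 2} \<times> {l $ 3<..<u $ 3}) \<times> {l $ 1<..<u $ 1})"
    by (subst emeasure_distr) auto
  also have "\<dots> = ennreal (u $ 2 - l $ 2) * ennreal (u $ 3 - l $ 3) * ennreal (u $ 1 - l $ 1)"
    using lu' by (simp add: lborel_prod[symmetric] lborel.emeasure_pair_measure_Times)
  also have "\<dots> = ennreal (\<Prod>b\<in>Basis. (u - l) \<bullet> b)"
    using lu' by (simp add: Basis_vec3 axis_eq_axis inner_axis ennreal_mult[symmetric] mult.commute mult.left_commute)
  finally show "emeasure (distr lborel borel vec_of_slice) (box l u) = ennreal (\<Prod>b\<in>Basis. (u - l) \<bullet> b)" .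
qed simp

lemma norm_vec_of_slice: "norm (vec_of_slice (w, x)) = sqrt (x\<^sup>2 + (norm w)\<^sup>2)"
  by (simp add: norm_eq_sqrt_inner inner_vec_def sum_3 power2_eq_square inner_prod_def)

lemma norm_vec3: "norm (vec_of_slice p) ^ 2 = (fst (fst p))\<^sup>2 + (snd (fst p))\<^sup>2 + (snd p)\<^sup>2"
  by (simp add: norm_eq_sqrt_inner inner_vec_def sum_3 power2_eq_square)


text \<open>Both measures give \<open>(-\<infinity>, a)\<close> the volume of the ball of radius \<open>a\<close>.\<close>

lemma distr_norm_vec3:
  "distr (lborel :: (real^3) measure) borel norm = density lborel (\<lambda>r. ennreal (indicator {0<..} r * (4 * pi * r\<^sup>2)))"
    (is "?M = ?N")
proof (rule measure_eqI_generator_eq[where E="range (\<lambda>a::real. {..<a})" and A="\<lambda>n. {..<real n}"])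
  show "Int_stable (range (\<lambda>a::real. {..<a}))"
  proof (rule Int_stableI)
    fix X Y assume "X \<in> range (\<lambda>a::real. {..<a})" "Y \<in> range (\<lambda>a::real. {..<a})"
    then obtain a b where "X = {..<a}" "Y = {..<b}" by blast
    then have "X \<inter> Y = {..<min a b}" by auto
    then show "X \<inter> Y \<in> range (\<lambda>a::real. {..<a})" by blast
  qed
  show "sets ?M = sigma_sets UNIV (range (\<lambda>a::real. {..<a}))" "sets ?N = sigma_sets UNIV (range (\<lambda>a::real. {..<a}))"
    by (simp_all add: borel_Iio)
  have M: "emeasure ?M {..<a} = ennreal (4 / 3 * pi * (max 0 a) ^ 3)" for a
  proof -
    have "norm -` {..<a} = ball (0::real^3) a" by (auto simp: ball_def)
    moreover have "ball (0::real^3) a = ball 0 (max 0 a)" by (auto simp: max_def)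
    ultimately show ?thesis by (simp add: emeasure_distr emeasure_ball unit_ball_vol_3)
  qed
  show "emeasure ?M X = emeasure ?N X" if X: "X \<in> range (\<lambda>a::real. {..<a})" for X
  proof -
    obtain a where X: "X = {..<a}" using X by auto
    define b where "b = max 0 a"
    have "emeasure ?N X = (\<integral>\<^sup>+r. ennreal (indicator {0<..} r * (4 * pi * r\<^sup>2)) * indicator {..<a} r \<partial>lborel)"
      unfolding X by (subst emeasure_density) auto
    also have "\<dots> = (\<integral>\<^sup>+r. ennreal (4 * pi * r\<^sup>2) * indicator {0..b} r \<partial>lborel)"
      using AE_lborel_singleton[of 0] AE_lborel_singleton[of b]
      by (intro nn_integral_cong_AE) (auto simp: b_def indicator_def elim!: eventually_elim2)
    also have "\<dots> = ennreal (4 / 3 * pi * b ^ 3 - 4 / 3 * pi * 0 ^ 3)"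
      by (rule nn_integral_FTC_Icc) (auto simp: b_def intro!: derivative_eq_intros)
    finally show ?thesis unfolding X M b_def by simp
  qed
  show "(\<Union>n. {..<real n}) = UNIV" using reals_Archimedean2 by auto
  show "emeasure ?M {..<real n} \<noteq> \<infinity>" for n unfolding M by simp
qed auto

lemma
  fixes f :: "real \<Rightarrow> 'b::{banach,second_countable_topology}"
  assumes [measurable]: "f \<in> borel_measurable borel"
  shows integrable_radial: "integrable lborel (\<lambda>y::real^3. f (norm y)) \<longleftrightarrow> integrable hl (\<lambda>r. (4 * pi * r\<^sup>2) *\<^sub>R f r)"
    and integral_radial: "(\<integral>y. f (norm (y::real^3)) \<partial>lborel) = (\<integral>r. (4 * pi * r\<^sup>2) *\<^sub>R f r \<partial>hl)"
proof -
  have e: "indicator {0<..} r *\<^sub>R ((4 * pi * r\<^sup>2) *\<^sub>R f r) = (indicator {0<..} r * (4 * pi * r\<^sup>2)) *\<^sub>R f r" for r by simp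
  have "integrable lborel (\<lambda>y::real^3. f (norm y)) \<longleftrightarrow> integrable (distr (lborel :: (real^3) measure) borel norm) f"
    by (subst integrable_distr_eq) auto
  also have "\<dots> \<longleftrightarrow> integrable hl (\<lambda>r. (4 * pi * r\<^sup>2) *\<^sub>R f r)"
    unfolding distr_norm_vec3 integrable_hl e by (subst integrable_density) auto
  finally show "integrable lborel (\<lambda>y::real^3. f (norm y)) \<longleftrightarrow> integrable hl (\<lambda>r. (4 * pi * r\<^sup>2) *\<^sub>R f r)" .
  have "(\<integral>y. f (norm (y::real^3)) \<partial>lborel) = integral\<^sup>L (distr (lborel :: (real^3) measure) borel norm) f"
    by (subst integral_distr) auto
  also have "\<dots> = (\<integral>r. (4 * pi * r\<^sup>2) *\<^sub>R f r \<partial>hl)"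
    unfolding distr_norm_vec3 integral_hl e by (subst integral_density) auto
  finally show "(\<integral>y. f (norm (y::real^3)) \<partial>lborel) = (\<integral>r. (4 * pi * r\<^sup>2) *\<^sub>R f r \<partial>hl)" .
qed

lemma AE_radial:
  assumes "AE r in lborel. 0 < r \<longrightarrow> P r"
  shows "AE y in (lborel :: (real^3) measure). P (norm y)"
proof -
  have "AE r in density lborel (\<lambda>r. ennreal (indicator {0<..} r * (4 * pi * r\<^sup>2))). P r"
    using assms by (subst AE_density) (auto elim!: eventually_mono split: split_indicator_asm)
  then have "AE r in distr (lborel :: (real^3) measure) borel norm. P r" by (simp only: distr_norm_vec3)
  from AE_distrD[OF _ this] show ?thesis by simp
qed

text \<open>Measurability of \<open>E\<close> has to be deduced from that of \<open>E(|k|)\<close>. On almost every line parallel to the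
  first axis, say at distance \<open>\<rho>\<close> from it, \<open>E(sqrt(x\<^sup>2 + \<rho>\<^sup>2))\<close> equals a Borel function of \<open>x\<close> almost
  everywhere. Since \<open>x \<mapsto> sqrt(x\<^sup>2 + \<rho>\<^sup>2)\<close> maps null sets of positive \<open>x\<close> to null sets, \<open>E\<close> is almost
  everywhere equal to a Borel function on \<open>(\<rho>, \<infinity>)\<close>, and \<open>\<rho>\<close> can be chosen arbitrarily small.\<close>

lemma radial_borel_representative:
  fixes E :: "real \<Rightarrow> real" and h :: "real^3 \<Rightarrow> real"
  assumes h: "h \<in> borel_measurable borel" and ae: "AE k in lborel. E (norm k) = h k"
  obtains e where "e \<in> borel_measurable borel" "AE r in lborel. 0 < r \<longrightarrow> E r = e r"
proof -
  note [measurable] = h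
  have "AE k in distr lborel borel vec_of_slice. E (norm k) = h k"
    using ae by (simp only: distr_vec_of_slice)
  from AE_distrD[OF _ this] have "AE p in lborel. E (norm (vec_of_slice p)) = h (vec_of_slice p)" by simp
  then have "AE p in lborel \<Otimes>\<^sub>M lborel. E (norm (vec_of_slice p)) = h (vec_of_slice p)" by (simp only: lborel_prod)
  then have sl: "AE w in lborel. AE x in lborel. E (sqrt (x\<^sup>2 + (norm w)\<^sup>2)) = h (vec_of_slice (w, x))"
    using lborel_pair.AE_pair by (fastforce simp: norm_vec_of_slice)
  have slice: "\<exists>w. norm w < d \<and> (AE x in lborel. E (sqrt (x\<^sup>2 + (norm w)\<^sup>2)) = h (vec_of_slice (w, x)))"
    if "0 < d" for d
  proof (rule ccontr)
    assume "\<not> ?thesis"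
    with sl have "AE w in lborel. w \<notin> ball (0 :: real \<times> real) d" by (auto elim!: eventually_mono)
    then have "emeasure lborel (ball (0 :: real \<times> real) d) = 0"
      by (subst (asm) AE_iff_measurable[OF _ refl]) (auto simp: ball_def)
    moreover have "0 < emeasure lborel (ball (0 :: real \<times> real) d)"
      using that content_ball_pos[of d "0 :: real \<times> real"] by (simp add: measure_def enn2real_positive_iff)
    ultimately show False by simp
  qed
  have meas: "(\<lambda>r. indicator {d<..} r * E r) \<in> borel_measurable (completion lborel)" if "0 < d" for d
  proof -
    obtain w where w: "norm w < d" "AE x in lborel. E (sqrt (x\<^sup>2 + (norm w)\<^sup>2)) = h (vec_of_slice (w, x))"
      using slice[OF \<open>0 < d\<close>] by blast
    define g where "g r = indicator {d<..} r * h (vec_of_slice (w, sqrt (r\<^sup>2 - (norm w)\<^sup>2)))" for r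
    have g[measurable]: "g \<in> borel_measurable borel" unfolding g_def[abs_def] by measurable
    define N where "N = {x. 0 < x \<and> E (sqrt (x\<^sup>2 + (norm w)\<^sup>2)) \<noteq> h (vec_of_slice (w, x))}"
    have "AE x in lebesgue. x \<notin> N"
      using AE_completion[OF w(2)] by eventually_elim (simp add: N_def)
    then have N: "negligible N" by (simp add: eventually_ae_filter_negligible) (meson mem_Collect_eq negligible_subset subsetI)
    have "negligible ((\<lambda>x. sqrt (x\<^sup>2 + (norm w)\<^sup>2)) ` N)"
    proof (rule negligible_differentiable_image_negligible[OF _ N])
      show "(\<lambda>x. sqrt (x\<^sup>2 + (norm w)\<^sup>2)) differentiable_on N"
        unfolding differentiable_on_def
      proof
        fix x assume "x \<in> N"
        then have "0 < x\<^sup>2 + (norm w)\<^sup>2" by (auto simp: N_def intro!: add_pos_nonneg)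
        then have "((\<lambda>x. sqrt (x\<^sup>2 + (norm w)\<^sup>2)) has_real_derivative (2 * x) * (inverse (sqrt (x\<^sup>2 + (norm w)\<^sup>2)) / 2)) (at x)"
          by (auto intro!: derivative_eq_intros)
        then show "(\<lambda>x. sqrt (x\<^sup>2 + (norm w)\<^sup>2)) differentiable at x within N"
          using has_field_derivative_at_within real_differentiable_def field_differentiable_imp_differentiable field_differentiable_def by blast
      qed
    qed simp
    moreover have "{r. g r \<noteq> indicator {d<..} r * E r} \<subseteq> (\<lambda>x. sqrt (x\<^sup>2 + (norm w)\<^sup>2)) ` N"
    proof
      fix r assume "r \<in> {r. g r \<noteq> indicator {d<..} r * E r}"
      then have r: "d < r" "E r \<noteq> h (vec_of_slice (w, sqrt (r\<^sup>2 - (norm w)\<^sup>2)))"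
        by (auto simp: g_def indicator_def split: if_splits)
      have "(norm w)\<^sup>2 < r\<^sup>2" using r w(1) by (intro power_strict_mono) auto
      define x where "x = sqrt (r\<^sup>2 - (norm w)\<^sup>2)"
      have "x\<^sup>2 = r\<^sup>2 - (norm w)\<^sup>2"
        unfolding x_def using \<open>(norm w)\<^sup>2 < r\<^sup>2\<close> by (intro real_sqrt_pow2) simp
      then have rx: "sqrt (x\<^sup>2 + (norm w)\<^sup>2) = r" using r that by simp
      have "0 < x" using \<open>(norm w)\<^sup>2 < r\<^sup>2\<close> by (simp add: x_def)
      with r rx have "x \<in> N" by (simp add: N_def flip: x_def)
      with rx show "r \<in> (\<lambda>x. sqrt (x\<^sup>2 + (norm w)\<^sup>2)) ` N"
        by (intro image_eqI[of _ _ x]) simp_all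
    qed
    ultimately have "negligible {r. g r \<noteq> indicator {d<..} r * E r}" using negligible_subset by blast
    then have "AE r in lebesgue. g r = indicator {d<..} r * E r"
      by (auto simp: eventually_ae_filter_negligible)
    moreover have "g \<in> borel_measurable lborel" by simp
    ultimately show ?thesis by (intro borel_measurable_AE[OF measurable_completion])
  qed
  have "(\<lambda>r. indicator {0<..} r * E r) \<in> borel_measurable (completion lborel)"
  proof (rule borel_measurable_LIMSEQ_real)
    show "(\<lambda>n. indicator {1 / real (Suc n)<..} r * E r) \<longlonglongrightarrow> indicator {0<..} r * E r" for r
    proof (rule tendsto_eventually, cases "0 < r")
      case True
      then obtain N where N: "1 / real (Suc N) < r" using nat_approx_posE by blast
      show "eventually (\<lambda>n. indicator {1 / real (Suc n)<..} r * E r = indicator {0<..} r * E r) sequentially"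
        using eventually_ge_at_top[of N]
      proof eventually_elim
        case (elim n)
        have "1 / real (Suc n) \<le> 1 / real (Suc N)" using elim by (simp add: frac_le)
        with N True show ?case by simp
      qed
    next
      case False
      then have "\<not> 1 / real (Suc n) < r" for n by (smt (verit) divide_pos_pos of_nat_0_less_iff zero_less_Suc)
      with False show "eventually (\<lambda>n. indicator {1 / real (Suc n)<..} r * E r = indicator {0<..} r * E r) sequentially" by simp
    qed
  qed (intro meas, simp)
  from completion_ex_borel_measurable_real[OF this] obtain e where
    e: "e \<in> borel_measurable lborel" "AE r in lborel. indicator {0<..} r * E r = e r" by blast
  show ?thesis
  proof (rule that)
    show "e \<in> borel_measurable borel" using e by simp
    show "AE r in lborel. 0 < r \<longrightarrow> E r = e r" using e(2) by eventually_elim auto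
  qed
qed



section \<open>Gaussians as test functions\<close>

lemma integral_lborel_mult_prod:
  fixes f :: "'a::euclidean_space \<Rightarrow> complex" and g :: "'b::euclidean_space \<Rightarrow> complex"
  assumes f: "integrable lborel f" and g: "integrable lborel g"
  shows "integrable lborel (\<lambda>p. f (fst p) * g (snd p))"
    and "(\<integral>p. f (fst p) * g (snd p) \<partial>lborel) = (\<integral>x. f x \<partial>lborel) * (\<integral>y. g y \<partial>lborel)"
proof -
  have [measurable]: "f \<in> borel_measurable borel" "g \<in> borel_measurable borel"
    using f g by (simp_all add: borel_measurable_integrable)
  have i: "integrable (lborel \<Otimes>\<^sub>M lborel) (\<lambda>p. f (fst p) * g (snd p))"
  proof (rule lborel_pair.Fubini_integrable)
    have "(\<lambda>x. \<integral>y. norm (f (fst (x, y)) * g (snd (x, y))) \<partial>lborel) = (\<lambda>x. norm (f x) * (\<integral>y. norm (g y) \<partial>lborel))"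
      by (simp add: norm_mult)
    then show "integrable lborel (\<lambda>x. \<integral>y. norm (f (fst (x, y)) * g (snd (x, y))) \<partial>lborel)"
      using f by simp
    show "AE x in lborel. integrable lborel (\<lambda>y. f (fst (x, y)) * g (snd (x, y)))"
      using g by simp
  qed measurable
  then show "integrable lborel (\<lambda>p. f (fst p) * g (snd p))" by (simp add: lborel_prod)
  have "(\<integral>p. f (fst p) * g (snd p) \<partial>lborel) = (\<integral>x. (\<integral>y. f (fst (x, y)) * g (snd (x, y)) \<partial>lborel) \<partial>lborel)"
    using lborel_pair.integral_fst'[OF i] by (simp add: lborel_prod)
  also have "\<dots> = (\<integral>x. f x \<partial>lborel) * (\<integral>y. g y \<partial>lborel)" by simp
  finally show "(\<integral>p. f (fst p) * g (snd p) \<partial>lborel) = (\<integral>x. f x \<partial>lborel) * (\<integral>y. g y \<partial>lborel)" .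
qed

definition gauss :: "real \<Rightarrow> real^3 \<Rightarrow> complex"
  where "gauss t k = complex_of_real (gexp t (norm k))"

text \<open>The transform splits into three one-dimensional ones.\<close>

lemma fourier_gauss:
  assumes t: "0 < t"
  shows "fourier (gauss t) y = complex_of_real (sqrt (pi / t) ^ 3 * exp (- ((norm y)\<^sup>2 / (4 * t))))"
proof -
  define e where "e \<eta> x = exp (- \<i> * complex_of_real (x * \<eta>)) * complex_of_real (gexp t x)" for \<eta> x :: real
  have em: "e \<eta> \<in> borel_measurable borel" for \<eta>
    unfolding e_def[abs_def] by measurable
  have ei: "integrable lborel (e \<eta>)" for \<eta>
    using integrable_power_gauss[OF t, of 0]
    by (rule Bochner_Integration.integrable_bound[where f="\<lambda>x. x ^ 0 * gexp t x"]) (use em in \<open>auto simp: e_def norm_mult\<close>)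
  let ?f = "\<lambda>k::real^3. exp (- \<i> * complex_of_real (k \<bullet> y)) * gauss t k"
  have fm[measurable]: "?f \<in> borel_measurable lborel"
    unfolding gauss_def by measurable
  have "fourier (gauss t) y = (\<integral>k. ?f k \<partial>lborel)"
    unfolding fourier_def by (rule integral_completion[OF fm])
  also have "\<dots> = (\<integral>k. ?f k \<partial>distr lborel borel vec_of_slice)" by (simp add: distr_vec_of_slice)
  also have "\<dots> = (\<integral>p. ?f (vec_of_slice p) \<partial>lborel)" using fm by (intro integral_distr) simp_all
  also have "\<dots> = (\<integral>p. (e (y $ 2) (fst (fst p)) * e (y $ 3) (snd (fst p))) * e (y $ 1) (snd p) \<partial>lborel)"
  proof (intro Bochner_Integration.integral_cong refl)
    fix p
    have E: "exp (- t * (norm (vec_of_slice p))\<^sup>2)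
        = exp (- t * (fst (fst p))\<^sup>2) * exp (- t * (snd (fst p))\<^sup>2) * gexp t (snd p)"
      by (simp add: norm_vec3 mult_exp_exp algebra_simps)
    have C: "exp (- \<i> * complex_of_real (vec_of_slice p \<bullet> y)) = exp (- \<i> * complex_of_real (fst (fst p) * y $ 2))
        * exp (- \<i> * complex_of_real (snd (fst p) * y $ 3)) * exp (- \<i> * complex_of_real (snd p * y $ 1))"
      by (simp add: inner_vec_def sum_3 mult_exp_exp algebra_simps)
    show "?f (vec_of_slice p) = (e (y $ 2) (fst (fst p)) * e (y $ 3) (snd (fst p))) * e (y $ 1) (snd p)"
      by (simp only: e_def gauss_def E C of_real_mult mult_ac)
  qed
  also have "\<dots> = (\<integral>p. e (y $ 2) (fst p) * e (y $ 3) (snd p) \<partial>lborel) * (\<integral>x. e (y $ 1) x \<partial>lborel)"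
    by (rule integral_lborel_mult_prod(2)[of "\<lambda>p. e (y $ 2) (fst p) * e (y $ 3) (snd p)"])
      (intro integral_lborel_mult_prod(1) ei)+
  also have "\<dots> = (\<integral>x. e (y $ 2) x \<partial>lborel) * (\<integral>x. e (y $ 3) x \<partial>lborel) * (\<integral>x. e (y $ 1) x \<partial>lborel)"
    by (subst integral_lborel_mult_prod(2)) (auto intro: ei)
  also have "\<dots> = complex_of_real (sqrt (pi / t) * exp (- ((y $ 2)\<^sup>2 / (4 * t))) * (sqrt (pi / t) * exp (- ((y $ 3)\<^sup>2 / (4 * t))))
       * (sqrt (pi / t) * exp (- ((y $ 1)\<^sup>2 / (4 * t)))))"
    unfolding e_def gauss_fourier_1d[OF t] by simp
  also have "sqrt (pi / t) * exp (- ((y $ 2)\<^sup>2 / (4 * t))) * (sqrt (pi / t) * exp (- ((y $ 3)\<^sup>2 / (4 * t))))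
       * (sqrt (pi / t) * exp (- ((y $ 1)\<^sup>2 / (4 * t)))) = sqrt (pi / t) ^ 3 * exp (- ((norm y)\<^sup>2 / (4 * t)))"
  proof -
    have "(norm y)\<^sup>2 = (y $ 1)\<^sup>2 + (y $ 2)\<^sup>2 + (y $ 3)\<^sup>2"
      by (simp add: norm_eq_sqrt_inner inner_vec_def sum_3 power2_eq_square)
    then have "exp (- ((norm y)\<^sup>2 / (4 * t))) = exp (- ((y $ 2)\<^sup>2 / (4 * t))) * exp (- ((y $ 3)\<^sup>2 / (4 * t))) * exp (- ((y $ 1)\<^sup>2 / (4 * t)))"
      by (simp add: mult_exp_exp add_divide_distrib)
    then show ?thesis by (simp only: power3_eq_cube mult_ac)
  qed
  finally show ?thesis .
qed

lemma real_polynomial_function_has_derivative: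
  assumes "real_polynomial_function (p :: real^'n \<Rightarrow> real)"
  shows "\<exists>D. (\<forall>x. (p has_derivative D x) (at x)) \<and> (\<forall>i. real_polynomial_function (\<lambda>x. D x (axis i 1)))"
  using assms
proof induction
  case (linear f)
  then show ?case
    by (intro exI[of _ "\<lambda>_. f"]) (auto intro: bounded_linear_imp_has_derivative real_polynomial_function.intros)
next
  case (const c)
  show ?case by (intro exI[of _ "\<lambda>_ _. 0"]) (auto intro: real_polynomial_function.intros)
next
  case (add f g)
  then obtain D D' where "\<forall>x. (f has_derivative D x) (at x)" "\<forall>i. real_polynomial_function (\<lambda>x. D x (axis i 1))"
    "\<forall>x. (g has_derivative D' x) (at x)" "\<forall>i. real_polynomial_function (\<lambda>x. D' x (axis i 1))" by blast
  then show ?case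
    by (intro exI[of _ "\<lambda>x h. D x h + D' x h"]) (auto intro!: has_derivative_add real_polynomial_function.intros(3))
next
  case (mult f g)
  then obtain D D' where "\<forall>x. (f has_derivative D x) (at x)" "\<forall>i. real_polynomial_function (\<lambda>x. D x (axis i 1))"
    "\<forall>x. (g has_derivative D' x) (at x)" "\<forall>i. real_polynomial_function (\<lambda>x. D' x (axis i 1))" by blast
  with mult.hyps show ?case
    by (intro exI[of _ "\<lambda>x h. f x * D' x h + D x h * g x"])
      (auto intro!: has_derivative_mult real_polynomial_function.intros(3) real_polynomial_function.intros(4))
qed

lemma real_polynomial_function_bound:
  assumes "real_polynomial_function (p :: 'a::euclidean_space \<Rightarrow> real)"
  shows "\<exists>C n. \<forall>x. \<bar>p x\<bar> \<le> C * (1 + norm x) ^ n"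
  using assms
proof induction
  case (linear f)
  then obtain K where K: "\<And>x. norm (f x) \<le> norm x * K" using bounded_linear.bounded by blast
  have "\<bar>f x\<bar> \<le> \<bar>K\<bar> * (1 + norm x) ^ 1" for x
  proof -
    have "\<bar>f x\<bar> \<le> norm x * K" using K[of x] by simp
    also have "\<dots> \<le> norm x * \<bar>K\<bar>" by (intro mult_left_mono) auto
    also have "\<dots> \<le> (1 + norm x) * \<bar>K\<bar>" by (intro mult_right_mono) auto
    finally show ?thesis by (simp add: mult.commute)
  qed
  then show ?case by blast
next
  case (const c)
  show ?case by (intro exI[of _ "\<bar>c\<bar>"] exI[of _ 0]) simp
next
  case (add f g)
  then obtain C n C' n' where f: "\<And>x. \<bar>f x\<bar> \<le> C * (1 + norm x) ^ n" and g: "\<And>x. \<bar>g x\<bar> \<le> C' * (1 + norm x) ^ n'" by blast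
  have "0 \<le> C" "0 \<le> C'" using order_trans[OF abs_ge_zero f[of 0]] order_trans[OF abs_ge_zero g[of 0]] by auto
  then have "\<bar>f x + g x\<bar> \<le> (C + C') * (1 + norm x) ^ (n + n')" for x
  proof -
    have "C * (1 + norm x) ^ n \<le> C * (1 + norm x) ^ (n + n')" "C' * (1 + norm x) ^ n' \<le> C' * (1 + norm x) ^ (n + n')"
      using \<open>0 \<le> C\<close> \<open>0 \<le> C'\<close> by (auto intro!: mult_left_mono power_increasing)
    with f[of x] g[of x] abs_triangle_ineq[of "f x" "g x"] show ?thesis by (simp add: distrib_right)
  qed
  then show ?case by blast
next
  case (mult f g)
  then obtain C n C' n' where f: "\<And>x. \<bar>f x\<bar> \<le> C * (1 + norm x) ^ n" and g: "\<And>x. \<bar>g x\<bar> \<le> C' * (1 + norm x) ^ n'" by blast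
  have "\<bar>f x * g x\<bar> \<le> (C * C') * (1 + norm x) ^ (n + n')" for x
    using mult_mono[OF f[of x] g[of x] order_trans[OF abs_ge_zero f]] by (simp add: abs_mult power_add ac_simps)
  then show ?case by blast
qed

lemma bounded_power_gauss:
  assumes "0 < t"
  shows "\<exists>B. \<forall>r\<ge>0. (1 + r) ^ n * gexp t r \<le> (B::real)"
proof -
  have "((\<lambda>r. (1 + r) ^ n * gexp t r) \<longlongrightarrow> 0) at_top" using assms by real_asymp
  from order_tendstoD(2)[OF this zero_less_one] obtain R where R: "\<And>r. R \<le> r \<Longrightarrow> (1 + r) ^ n * gexp t r < 1"
    by (auto simp: eventually_at_top_linorder)
  have "(1 + r) ^ n * gexp t r \<le> 1 + (1 + \<bar>R\<bar>) ^ n" if "0 \<le> r" for r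
  proof (cases "R \<le> r")
    case True
    with R[of r] show ?thesis by (smt (verit) zero_le_power abs_ge_zero)
  next
    case False
    have "(1 + r) ^ n * gexp t r \<le> (1 + \<bar>R\<bar>) ^ n * 1"
      using False that assms by (intro mult_mono power_mono) auto
    then show ?thesis by simp
  qed
  then show ?thesis by blast
qed

text \<open>Partial derivatives of a polynomial times a Gaussian are again of this form, with the same
  Gaussian; this makes all Schwartz bounds instances of \<open>bounded_power_gauss\<close>.\<close>

lemma iter_partial_gauss:
  "\<exists>p. real_polynomial_function p \<and> iter_partial is (gauss t) = (\<lambda>k. complex_of_real (p k * gexp t (norm k)))"
proof (induction "is")
  case Nil
  show ?case by (intro exI[of _ "\<lambda>_. 1"]) (auto simp: gauss_def[abs_def] intro: real_polynomial_function.intros)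
next
  case (Cons i "is")
  then obtain p where p: "real_polynomial_function p"
    and eq: "iter_partial is (gauss t) = (\<lambda>k. complex_of_real (p k * gexp t (norm k)))" by blast
  obtain D where D: "\<And>x. (p has_derivative D x) (at x)" "\<And>i. real_polynomial_function (\<lambda>x. D x (axis i 1))"
    using real_polynomial_function_has_derivative[OF p] by blast
  define E where "E k = gexp t (norm k)" for k :: "real^3"
  have "(E has_derivative (\<lambda>h. - (2 * t * (k \<bullet> h)) * E k)) (at k)" for k
    unfolding E_def power2_norm_eq_inner
    by (auto intro!: derivative_eq_intros simp: inner_commute algebra_simps)
  then have "((\<lambda>k. complex_of_real (p k * E k)) has_derivative
      (\<lambda>h. complex_of_real (p k * (- (2 * t * (k \<bullet> h)) * E k) + D k h * E k))) (at k)" for k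
    by (intro has_derivative_of_real has_derivative_mult D)
  then have "frechet_derivative (\<lambda>k. complex_of_real (p k * E k)) (at k)
      = (\<lambda>h. complex_of_real (p k * (- (2 * t * (k \<bullet> h)) * E k) + D k h * E k))" for k
    by (rule frechet_derivative_at[symmetric])
  then have "iter_partial (i # is) (gauss t) = (\<lambda>k. complex_of_real ((D k (axis i 1) - 2 * t * (k \<bullet> axis i 1) * p k) * E k))"
    unfolding iter_partial.simps eq partial_def E_def[symmetric] by (simp add: fun_eq_iff algebra_simps)
  moreover have "real_polynomial_function (\<lambda>k. D k (axis i 1) - 2 * t * (k \<bullet> axis i 1) * p k)"
    by (intro real_polynomial_function_diff D real_polynomial_function.intros(4) p real_polynomial_function.intros(2)
        real_polynomial_function.intros(1)[OF bounded_linear_inner_left])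
  ultimately show ?case unfolding E_def by blast
qed

lemma schwartz_gauss:
  assumes "0 < t" shows "schwartz (gauss t)"
  unfolding schwartz_def C_on_def
proof (intro conjI allI impI ballI)
  fix "is" :: "3 list" and x :: "real^3"
  obtain p where p: "real_polynomial_function p"
    and eq: "iter_partial is (gauss t) = (\<lambda>k. complex_of_real (p k * gexp t (norm k)))"
    using iter_partial_gauss by blast
  obtain D where D: "\<And>x. (p has_derivative D x) (at x)"
    using real_polynomial_function_has_derivative[OF p] by blast
  show d: "iter_partial is (gauss t) differentiable at x" for x
  proof -
    have "((\<lambda>k. exp (- t * (k \<bullet> k))) has_derivative (\<lambda>h. - (2 * t * (x \<bullet> h)) * exp (- t * (x \<bullet> x)))) (at x)"
      by (auto intro!: derivative_eq_intros simp: inner_commute algebra_simps)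
    from has_derivative_of_real[OF has_derivative_mult[OF D this]]
    show ?thesis unfolding eq power2_norm_eq_inner by (rule differentiableI)
  qed
  show "continuous_on UNIV (iter_partial is (gauss t))"
    using d by (intro continuous_at_imp_continuous_on ballI differentiable_imp_continuous_within)
  fix m
  obtain C n where C: "\<And>x. \<bar>p x\<bar> \<le> C * (1 + norm x) ^ n" using real_polynomial_function_bound[OF p] by blast
  obtain B where B: "\<And>r. 0 \<le> r \<Longrightarrow> (1 + r) ^ (m + n) * gexp t r \<le> B"
    using bounded_power_gauss[OF assms] by blast
  have C0: "0 \<le> C" using order_trans[OF abs_ge_zero C[of 0]] by simp
  have "norm x ^ m * norm (iter_partial is (gauss t) x) \<le> C * B" for x
  proof -
    have "norm x ^ m * norm (iter_partial is (gauss t) x) = norm x ^ m * (\<bar>p x\<bar> * gexp t (norm x))"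
      unfolding eq norm_of_real abs_mult by simp
    also have "\<dots> \<le> (1 + norm x) ^ m * (C * (1 + norm x) ^ n * gexp t (norm x))"
      using C0 by (intro mult_mono power_mono C) auto
    also have "\<dots> = C * ((1 + norm x) ^ (m + n) * gexp t (norm x))" by (simp add: power_add)
    also have "\<dots> \<le> C * B" by (intro mult_left_mono B C0) simp
    finally show ?thesis .
  qed
  then show "\<exists>C. \<forall>x. norm x ^ m * norm (iter_partial is (gauss t) x) \<le> C" by blast
qed

section \<open>Gaussian moments of the energy spectrum\<close>

lemma integral_completion_complex:
  fixes f g :: "'a \<Rightarrow> complex"
  assumes f: "integrable (completion M) f" and g: "g \<in> borel_measurable M" and ae: "AE x in M. f x = g x"
  shows "integrable M g" and "integral\<^sup>L (completion M) f = integral\<^sup>L M g"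
proof -
  have ae': "AE x in completion M. f x = g x" using ae by (rule AE_completion)
  have "integrable (completion M) g"
    by (rule integrable_cong_AE_imp[OF f measurable_completion[OF g] ae'])
  then show "integrable M g" using integrable_completion[OF g] by simp
  have "integral\<^sup>L (completion M) f = integral\<^sup>L (completion M) g"
    by (rule integral_cong_AE[OF borel_measurable_integrable[OF f] measurable_completion[OF g] ae'])
  then show "integral\<^sup>L (completion M) f = integral\<^sup>L M g" using integral_completion[OF g] by simp
qed

text \<open>What is kept of the three-dimensional Fourier relation. The left side of \<open>gauss_moments\<close> is the
  integral of \<open>E3D\<close> against \<open>exp(-t|k|\<^sup>2)\<close>, the right side that of the correlation against the Fourier
  transform \<open>(\<pi>/t)^(3/2) exp(-|y|\<^sup>2/(4t))\<close> of this Gaussian, both written in terms of the radius.\<close>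

locale spectral_pair =
  fixes e \<gamma> :: "real \<Rightarrow> real"
  assumes measurable_spectrum: "e \<in> borel_measurable borel" and measurable_profile: "\<gamma> \<in> borel_measurable borel"
    and integrable_spectrum: "\<And>t. 0 < t \<Longrightarrow> integrable hl (\<lambda>k. e k * gexp t k)"
    and integrable_profile: "\<And>s. 0 < s \<Longrightarrow> integrable hl (\<lambda>r. r\<^sup>2 * \<gamma> r * gexp s r)"
    and gauss_moments: "\<And>t. 0 < t \<Longrightarrow> (\<integral>k. e k * gexp t k \<partial>hl)
       = sqrt (pi / t) ^ 3 * (4 * pi) * (\<integral>r. r\<^sup>2 * \<gamma> r * gexp (1 / (4 * t)) r \<partial>hl)"

text \<open>The area \<open>4\<pi>k\<^sup>2\<close> of the sphere is the factor in \<open>E(|k|) = 4\<pi>|k|\<^sup>2 E3D(k)\<close>, so that no weight is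
  left on the side of the spectrum; on the side of the correlation it remains as \<open>4\<pi>r\<^sup>2\<close>.\<close>

theorem energy_spectrum_gauss_moments:
  assumes haar: "normalized_haar_O3 \<nu>" and u: "square_integrable u" and sp: "energy_spectrum \<nu> u E"
  defines "\<gamma> \<equiv> \<lambda>r. correlation \<nu> u (r *\<^sub>R axis 1 1)"
  obtains e where "spectral_pair e \<gamma>" "AE r in lborel. 0 < r \<longrightarrow> E r = e r"
proof -
  obtain E3 where ht: "has_tempered_fourier (\<lambda>y. complex_of_real (correlation \<nu> u y)) (\<lambda>k. complex_of_real (E3 k))"
    and aeE: "AE k in lebesgue. E (norm k) = 4 * pi * (norm k)\<^sup>2 * E3 k"
    using sp unfolding energy_spectrum_def by blast
  have tG: "integrable lebesgue (\<lambda>y. complex_of_real (correlation \<nu> u y) * gauss s y)" if "0 < s" for s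
    using ht schwartz_gauss[OF that] unfolding has_tempered_fourier_def tempered_function_def by blast
  have tE: "integrable lebesgue (\<lambda>k. complex_of_real (E3 k) * gauss t k)" if "0 < t" for t
    using ht schwartz_gauss[OF that] unfolding has_tempered_fourier_def tempered_function_def by blast
  have id: "(\<integral>k. complex_of_real (E3 k) * gauss t k \<partial>lebesgue)
      = (\<integral>y. complex_of_real (correlation \<nu> u y) * fourier (gauss t) y \<partial>lebesgue)" if "0 < t" for t
    using ht schwartz_gauss[OF that] unfolding has_tempered_fourier_def by blast
  have [measurable]: "correlation \<nu> u \<in> borel_measurable borel"
    using continuous_on_correlation[OF haar u] by (rule borel_measurable_continuous_onI)
  have \<gamma>m[measurable]: "\<gamma> \<in> borel_measurable borel"
    unfolding \<gamma>_def by measurable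
  have \<gamma>: "correlation \<nu> u y = \<gamma> (norm y)" for y
    unfolding \<gamma>_def by (rule correlation_radial[OF haar u])
  have "(\<lambda>k. Re (complex_of_real (E3 k) * gauss 1 k)) \<in> borel_measurable lebesgue"
    using borel_measurable_integrable[OF tE[OF zero_less_one]] by measurable
  moreover have "(\<lambda>k::real^3. exp ((norm k)\<^sup>2)) \<in> borel_measurable lebesgue"
    by (rule measurable_completion) simp
  ultimately have "(\<lambda>k. Re (complex_of_real (E3 k) * gauss 1 k) * exp ((norm k)\<^sup>2)) \<in> borel_measurable lebesgue"
    by (rule borel_measurable_times)
  then have "E3 \<in> borel_measurable (completion lborel)"
    by (simp add: gauss_def mult.assoc mult_exp_exp)
  from completion_ex_borel_measurable_real[OF this] obtain E3' where
    [measurable]: "E3' \<in> borel_measurable lborel" and ae3: "AE k in lborel. E3 k = E3' k" by blast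
  define h where "h k = 4 * pi * (norm k)\<^sup>2 * E3' k" for k
  have hm: "h \<in> borel_measurable borel" unfolding h_def[abs_def] by measurable
  have "AE k in lborel. E (norm k) = 4 * pi * (norm k)\<^sup>2 * E3 k" using aeE by (simp add: AE_completion_iff)
  then have aeh: "AE k in lborel. E (norm k) = h k"
    using ae3 by eventually_elim (simp add: h_def)
  obtain e where em[measurable]: "e \<in> borel_measurable borel" and ee: "AE r in lborel. 0 < r \<longrightarrow> E r = e r"
    using radial_borel_representative[OF hm aeh] .
  have aeq: "AE k in lborel. E3' k = e (norm k) / (4 * pi * (norm k)\<^sup>2)"
    using AE_radial[OF ee] aeh AE_lborel_singleton[of 0]
  proof eventually_elim
    case (elim k)
    then show ?case by (simp add: h_def field_simps)
  qed
  define f where "f t k = e k / (4 * pi * k\<^sup>2) * gexp t k" for t k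
  have fm[measurable]: "f t \<in> borel_measurable borel" for t unfolding f_def[abs_def] by measurable
  have aef: "AE k in lborel. complex_of_real (E3 k) * gauss t k = complex_of_real (f t (norm k))" for t
    using ae3 aeq by eventually_elim (simp add: f_def gauss_def)
  have mf: "(\<lambda>k::real^3. complex_of_real (f t (norm k))) \<in> borel_measurable lborel" for t by measurable
  have fhl: "r \<in> space hl \<Longrightarrow> (4 * pi * r\<^sup>2) *\<^sub>R f t r = e r * gexp t r" for r t
    by (simp add: f_def space_restrict_space)
  have If: "integrable lborel (\<lambda>k::real^3. f t (norm k))"
    "(\<integral>k. complex_of_real (E3 k) * gauss t k \<partial>lebesgue) = complex_of_real (\<integral>k. f t (norm (k::real^3)) \<partial>lborel)" if "0 < t" for t
    using integral_completion_complex[OF tE[OF that] mf aef] by (simp_all add: complex_of_real_integrable_eq)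
  have I1: "integrable hl (\<lambda>k. e k * gexp t k)" if "0 < t" for t
    using If(1)[OF that] unfolding integrable_radial[OF fm]
    by (subst (asm) Bochner_Integration.integrable_cong[OF refl fhl])
  have I1': "(\<integral>k. complex_of_real (E3 k) * gauss t k \<partial>lebesgue) = complex_of_real (\<integral>k. e k * gexp t k \<partial>hl)" if "0 < t" for t
    unfolding If(2)[OF that] integral_radial[OF fm]
    by (intro arg_cong[where f=complex_of_real] Bochner_Integration.integral_cong refl fhl)
  define g where "g s r = \<gamma> r * gexp s r" for s r
  have gm[measurable]: "g s \<in> borel_measurable borel" for s unfolding g_def[abs_def] by measurable
  have mg: "(\<lambda>y::real^3. complex_of_real (g s (norm y))) \<in> borel_measurable lborel" for s by measurable
  have ceq: "complex_of_real (correlation \<nu> u y) * gauss s y = complex_of_real (g s (norm y))" for s y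
    by (simp add: \<gamma> g_def gauss_def)
  have Ig: "integrable lborel (\<lambda>y::real^3. g s (norm y))"
    "(\<integral>y. complex_of_real (correlation \<nu> u y) * gauss s y \<partial>lebesgue) = complex_of_real (\<integral>y. g s (norm (y::real^3)) \<partial>lborel)" if "0 < s" for s
    using integral_completion_complex[OF tG[OF that] mg] ceq by (simp_all add: complex_of_real_integrable_eq)
  have ghl: "(4 * pi * r\<^sup>2) *\<^sub>R g s r = (4 * pi) * (r\<^sup>2 * \<gamma> r * gexp s r)" for r s
    by (simp add: g_def)
  have I2: "integrable hl (\<lambda>r. r\<^sup>2 * \<gamma> r * gexp s r)" if "0 < s" for s
    using Ig(1)[OF that] unfolding integrable_radial[OF gm] ghl by (simp only: integrable_mult_left_iff) simp
  show ?thesis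
  proof (rule that[OF spectral_pair.intro[OF em \<gamma>m I1 I2] ee])
    fix t :: real assume t: "0 < t"
    define s where "s = 1 / (4 * t)"
    have s: "0 < s" using t by (simp add: s_def)
    have "complex_of_real (\<integral>k. e k * gexp t k \<partial>hl)
        = (\<integral>y. complex_of_real (correlation \<nu> u y) * fourier (gauss t) y \<partial>lebesgue)"
      using I1'[OF t] id[OF t] by simp
    also have "\<dots> = (\<integral>y. complex_of_real (sqrt (pi / t) ^ 3) * (complex_of_real (correlation \<nu> u y) * gauss s y) \<partial>lebesgue)"
      by (intro Bochner_Integration.integral_cong refl) (simp add: fourier_gauss[OF t] gauss_def s_def)
    also have "\<dots> = complex_of_real (sqrt (pi / t) ^ 3) * complex_of_real (\<integral>y. g s (norm (y::real^3)) \<partial>lborel)"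
      by (simp only: integral_mult_right_zero Ig(2)[OF s])
    also have "(\<integral>y. g s (norm (y::real^3)) \<partial>lborel) = (4 * pi) * (\<integral>r. r\<^sup>2 * \<gamma> r * gexp s r \<partial>hl)"
      unfolding integral_radial[OF gm] ghl by (rule integral_mult_right_zero)
    finally have "complex_of_real (\<integral>k. e k * gexp t k \<partial>hl)
       = complex_of_real (sqrt (pi / t) ^ 3 * (4 * pi) * (\<integral>r. r\<^sup>2 * \<gamma> r * gexp s r \<partial>hl))"
      by (simp add: mult.assoc)
    then show "(\<integral>k. e k * gexp t k \<partial>hl)
       = sqrt (pi / t) ^ 3 * (4 * pi) * (\<integral>r. r\<^sup>2 * \<gamma> r * gexp (1 / (4 * t)) r \<partial>hl)"
      unfolding s_def of_real_eq_iff .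
  qed
qed

section \<open>The radial profile of the correlation\<close>

text \<open>Differentiating in \<open>r\<close> along the first axis is taking the first partial derivative, and a single
  partial derivative of order \<open>j\<close> is at most the norm of the tensor of all of them.\<close>

lemma decay_radial_profile:
  fixes G :: "real^3 \<Rightarrow> real"
  assumes dec: "decay_assumption G"
  defines "\<gamma> \<equiv> \<lambda>j r. iter_partial (replicate j 1) G (r *\<^sub>R axis 1 1)"
  shows "0 < r \<Longrightarrow> j < 5 \<Longrightarrow> (\<gamma> j has_real_derivative \<gamma> (Suc j) r) (at r)"
    and "0 < d \<Longrightarrow> \<exists>C\<ge>0. \<forall>r\<ge>d. \<forall>j\<le>5. \<bar>\<gamma> j r\<bar> \<le> C / (1 + r powi (int j - 1))"
proof -
  assume r: "0 < r" and j: "j < 5"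
  have "iter_partial (replicate j 1) G differentiable at (r *\<^sub>R axis 1 1)"
    using dec r j unfolding decay_assumption_def C_on_def by (auto simp: axis_eq_0_iff)
  then have "(iter_partial (replicate j 1) G has_derivative frechet_derivative (iter_partial (replicate j 1) G) (at (r *\<^sub>R axis 1 1))) (at (r *\<^sub>R axis 1 1))" (is "(_ has_derivative ?D) _")
    by (rule frechet_derivative_works[THEN iffD1])
  moreover have "((\<lambda>r. r *\<^sub>R (axis 1 1 :: real^3)) has_derivative (\<lambda>h. h *\<^sub>R axis 1 1)) (at r)"
    by (auto intro!: derivative_eq_intros)
  ultimately have "(\<gamma> j has_derivative (\<lambda>h. ?D (h *\<^sub>R axis 1 1))) (at r)"
    unfolding \<gamma>_def by (rule has_derivative_compose[rotated])
  moreover have "linear ?D" using \<open>(_ has_derivative ?D) _\<close> by (rule has_derivative_linear)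
  then have "(\<lambda>h. ?D (h *\<^sub>R axis 1 1)) = (\<lambda>h. \<gamma> (Suc j) r * h)"
    by (simp add: linear_cmul \<gamma>_def partial_def fun_eq_iff)
  ultimately show "(\<gamma> j has_real_derivative \<gamma> (Suc j) r) (at r)"
    by (simp add: has_field_derivative_def)
next
  assume d: "0 < d"
  then obtain C where C: "\<And>y k. d \<le> norm y \<Longrightarrow> k \<le> 5 \<Longrightarrow> grad_norm k G y \<le> C / (1 + norm y powi (int k - 1))"
    using dec unfolding decay_assumption_def by blast
  have b: "\<bar>\<gamma> j r\<bar> \<le> \<bar>C\<bar> / (1 + r powi (int j - 1))" if r: "d \<le> r" and j: "j \<le> 5" for r j
  proof -
    let ?y = "r *\<^sub>R axis 1 1 :: real^3"
    have n: "norm ?y = r" using d r by simp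
    have fin: "finite {is :: 3 list. length is = j}"
      using finite_lists_length_eq[of "UNIV :: 3 set" j] by simp
    have "(iter_partial (replicate j 1) G ?y)\<^sup>2 \<le> (\<Sum>is | length is = j. (iter_partial is G ?y)\<^sup>2)"
      by (rule member_le_sum[where f="\<lambda>is. (iter_partial is G ?y)\<^sup>2"]) (use fin in auto)
    then have "\<bar>\<gamma> j r\<bar> \<le> grad_norm j G ?y"
      unfolding \<gamma>_def grad_norm_def by (rule real_le_rsqrt[OF _, of "\<bar>_\<bar>", unfolded power2_abs])
    also have "\<dots> \<le> C / (1 + r powi (int j - 1))" using C[of ?y j] n r j by simp
    also have "\<dots> \<le> \<bar>C\<bar> / (1 + r powi (int j - 1))" using d r by (intro divide_right_mono) auto
    finally show ?thesis .
  qed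
  then show "\<exists>C\<ge>0. \<forall>r\<ge>d. \<forall>j\<le>5. \<bar>\<gamma> j r\<bar> \<le> C / (1 + r powi (int j - 1))"
    by (intro exI[of _ "\<bar>C\<bar>"]) auto
qed


section \<open>From the spectrum to the structure function\<close>

text \<open>Fourier inversion for radial functions. Because \<open>r\<^sup>2 sin(kr)/(kr)\<close> integrates against \<open>exp(-sr\<^sup>2)\<close> to a
  Gaussian in \<open>k\<close>, both sides have the same Gaussian moments and agree almost everywhere; being
  continuous, they agree on \<open>[0, \<infinity>)\<close>.\<close>

lemma (in spectral_pair) correlation_of_spectrum:
  assumes ei: "integrable hl e" and g: "continuous_on UNIV \<gamma>"
    and r: "0 \<le> r"
  shows "\<gamma> r = (\<integral>k. e k * sincf (k * r) \<partial>hl) / (8 * pi ^ 3)"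
proof -
  define \<gamma>' where "\<gamma>' r = (\<integral>k. e k * sincf (k * r) \<partial>hl) / (8 * pi ^ 3)" for r
  have ehl[measurable]: "e \<in> borel_measurable hl" by (rule measurable_hl[OF measurable_spectrum])
  have sm: "(\<lambda>k. sincf (k * r)) \<in> borel_measurable hl" for r
    by (rule measurable_hl) measurable
  have c': "continuous_on UNIV \<gamma>'"
    unfolding continuous_on_sequentially
  proof (intro allI ballI impI, elim conjE)
    fix X :: "nat \<Rightarrow> real" and a assume X: "X \<longlonglongrightarrow> a"
    have "(\<lambda>n. \<integral>k. e k * sincf (k * X n) \<partial>hl) \<longlonglongrightarrow> (\<integral>k. e k * sincf (k * a) \<partial>hl)"
    proof (rule integral_dominated_convergence[where w="\<lambda>k. \<bar>e k\<bar>"])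
      show "AE k in hl. (\<lambda>n. e k * sincf (k * X n)) \<longlonglongrightarrow> e k * sincf (k * a)"
      proof (intro AE_I2 tendsto_mult tendsto_const)
        fix k
        have "(\<lambda>n. k * X n) \<longlonglongrightarrow> k * a" by (intro tendsto_intros X)
        from isCont_tendsto_compose[OF isCont_sincf this]
        show "(\<lambda>n. sincf (k * X n)) \<longlonglongrightarrow> sincf (k * a)" .
      qed
      show "AE k in hl. norm (e k * sincf (k * X n)) \<le> \<bar>e k\<bar>" for n
        unfolding real_norm_def abs_mult by (intro AE_I2 mult_left_le sincf_bounds(4) abs_ge_zero)
    qed (use ei in \<open>auto intro!: borel_measurable_times sm\<close>)
    then show "(\<gamma>' \<circ> X) \<longlonglongrightarrow> \<gamma>' a"
      unfolding comp_def \<gamma>'_def by (intro tendsto_divide tendsto_const) auto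
  qed
  have "AE r in hl. r\<^sup>2 * \<gamma> r - r\<^sup>2 * \<gamma>' r = 0"
  proof (rule gauss_laplace_unique)
    fix s :: real assume s: "0 < s"
    define t where "t = 1 / (4 * s)"
    have t: "0 < t" and st: "s = 1 / (4 * t)" using s by (auto simp: t_def)
    let ?f = "\<lambda>r k. r\<^sup>2 * gexp s r * (e k * sincf (k * r))"
    have fm: "(\<lambda>(r, k). ?f r k) \<in> borel_measurable (hl \<Otimes>\<^sub>M hl)"
      by (rule measurable_hl_pair) (use measurable_spectrum in \<open>unfold borel_prod[symmetric], measurable\<close>)
    have fa: "integrable hl (\<lambda>r. r ^ 2 * gexp s r)"
      by (intro integrable_hl_lborel integrable_power_gauss s)
    have fb: "\<bar>?f r k\<bar> \<le> (r ^ 2 * gexp s r) * \<bar>e k\<bar>" for r k :: real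
    proof -
      have "\<bar>?f r k\<bar> = (r ^ 2 * gexp s r) * (\<bar>e k\<bar> * \<bar>sincf (k * r)\<bar>)"
        by (simp only: abs_mult abs_power2 abs_exp_cancel)
      also have "\<dots> \<le> (r ^ 2 * gexp s r) * \<bar>e k\<bar>"
        by (intro mult_left_mono mult_left_le sincf_bounds(4) abs_ge_zero mult_nonneg_nonneg zero_le_power2 exp_ge_zero)
      finally show ?thesis .
    qed
    note F = Fubini_hl_dominated[OF fm fa integrable_abs[OF ei] fb]
    have inner: "(\<integral>r. ?f r k \<partial>hl) = (t * sqrt (pi / s)) * (e k * gexp t k)" if "k \<in> space hl" for k
    proof -
      have k: "0 < k" using that by (simp add: space_restrict_space)
      have "(\<integral>r. ?f r k \<partial>hl) = (\<integral>r. e k / k * (r * sin (k * r) * gexp s r) \<partial>hl)"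
        using k by (intro Bochner_Integration.integral_cong refl) (auto simp: space_restrict_space power2_eq_square sincf_def)
      also have "\<dots> = e k / k * (k / (2 * s) * (sqrt (pi / s) / 2 * exp (- (k\<^sup>2 / (4 * s)))))"
        by (simp only: integral_mult_right_zero integral_sin_gauss_hl(1)[OF s])
      also have "\<dots> = (t * sqrt (pi / s)) * (e k * gexp t k)"
        using k s by (simp add: t_def field_simps)
      finally show ?thesis .
    qed
    have e1: "(r\<^sup>2 * \<gamma>' r) * gexp s r = (\<integral>k. ?f r k \<partial>hl) / (8 * pi ^ 3)" for r
      unfolding integral_mult_right_zero by (simp add: \<gamma>'_def)
    have i': "integrable hl (\<lambda>r. (r\<^sup>2 * \<gamma>' r) * gexp s r)" unfolding e1 using F(2) by simp
    have "(\<integral>r. (r\<^sup>2 * \<gamma>' r) * gexp s r \<partial>hl) = (\<integral>r. (\<integral>k. ?f r k \<partial>hl) \<partial>hl) / (8 * pi ^ 3)"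
      unfolding e1 by (rule integral_divide_zero)
    also have "(\<integral>r. (\<integral>k. ?f r k \<partial>hl) \<partial>hl) = (\<integral>k. (t * sqrt (pi / s)) * (e k * gexp t k) \<partial>hl)"
      unfolding F(1) by (rule Bochner_Integration.integral_cong[OF refl inner])
    also have "\<dots> = (t * sqrt (pi / s)) * (sqrt (pi / t) ^ 3 * (4 * pi) * (\<integral>r. r\<^sup>2 * \<gamma> r * gexp s r \<partial>hl))"
      unfolding integral_mult_right_zero gauss_moments[OF t] st ..
    also have "\<dots> / (8 * pi ^ 3) = (\<integral>r. r\<^sup>2 * \<gamma> r * gexp s r \<partial>hl)"
    proof -
      have "sqrt (pi / s) = 2 * sqrt (pi * t)" using t by (simp add: st real_sqrt_mult)
      moreover have "sqrt (pi * t) * sqrt (pi / t) = pi" using t by (simp flip: real_sqrt_mult)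
      moreover have "sqrt (pi / t) * sqrt (pi / t) = pi / t" using t by simp
      ultimately have q: "t * sqrt (pi / s) * sqrt (pi / t) ^ 3 = 2 * pi\<^sup>2"
        using t by (simp add: power3_eq_cube power2_eq_square)
      have "(t * sqrt (pi / s)) * (sqrt (pi / t) ^ 3 * (4 * pi) * x) = (t * sqrt (pi / s) * sqrt (pi / t) ^ 3) * (4 * pi * x)"
        for x :: real by (simp only: mult_ac)
      then show ?thesis unfolding q by (simp add: power2_eq_square power3_eq_cube)
    qed
    finally have eq: "(\<integral>r. (r\<^sup>2 * \<gamma>' r) * gexp s r \<partial>hl) = (\<integral>r. r\<^sup>2 * \<gamma> r * gexp s r \<partial>hl)" .
    have d: "(r\<^sup>2 * \<gamma> r - r\<^sup>2 * \<gamma>' r) * gexp s r = r\<^sup>2 * \<gamma> r * gexp s r - (r\<^sup>2 * \<gamma>' r) * gexp s r" for r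
      by (simp add: left_diff_distrib)
    show "integrable hl (\<lambda>r. (r\<^sup>2 * \<gamma> r - r\<^sup>2 * \<gamma>' r) * gexp s r)"
      unfolding d using integrable_profile[OF s] i' by (rule Bochner_Integration.integrable_diff)
    show "(\<integral>r. (r\<^sup>2 * \<gamma> r - r\<^sup>2 * \<gamma>' r) * gexp s r \<partial>hl) = 0"
      unfolding d using Bochner_Integration.integral_diff[OF integrable_profile[OF s] i'] eq by simp
  qed
  then have ae: "AE r in hl. \<gamma> r - \<gamma>' r = 0"
    using AE_space by eventually_elim (auto simp: space_restrict_space right_diff_distrib[symmetric])
  have cd: "continuous_on UNIV (\<lambda>r. \<gamma> r - \<gamma>' r)" by (intro continuous_intros g c')
  have pos: "\<gamma> r - \<gamma>' r = 0" if "0 < r" for r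
    by (rule continuous_AE_eq_0_hl[OF continuous_on_subset[OF cd] ae that]) simp
  have "\<gamma> 0 - \<gamma>' 0 = 0"
  proof (rule tendsto_unique)
    show "((\<lambda>r. \<gamma> r - \<gamma>' r) \<longlongrightarrow> \<gamma> 0 - \<gamma>' 0) (at_right 0)"
      using cd by (auto simp: continuous_on_def intro: filterlim_mono at_le)
    show "((\<lambda>r. \<gamma> r - \<gamma>' r) \<longlongrightarrow> 0) (at_right 0)"
      by (rule tendsto_eventually) (use pos in \<open>auto simp: eventually_at_right_field intro!: exI[of _ 1]\<close>)
  qed simp
  with pos r show ?thesis unfolding \<gamma>'_def[symmetric] by (cases "r = 0") auto
qed

text \<open>If the power law held for all \<open>k > 0\<close>, the increment would be the multiple of \<open>l^\<alpha>\<close> given by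
  \<open>sinc_moment_scaling\<close>. The two spectra differ only below \<open>k0\<close>, where \<open>1 - sin(kl)/(kl) \<le> (kl)\<^sup>2\<close> makes
  the difference of the integrals \<open>O(l\<^sup>2)\<close>.\<close>

lemma (in spectral_pair) increment_of_power_spectrum:
  assumes g: "continuous_on UNIV \<gamma>"
    and \<alpha>: "0 < \<alpha>" "\<alpha> < 2" and c: "0 < c" "0 < k0"
    and law: "AE k in hl. k0 \<le> k \<longrightarrow> e k = c * k powr (- 1 - \<alpha>)"
  obtains K where "\<And>l. 0 < l \<Longrightarrow> \<bar>\<gamma> 0 - \<gamma> l - c * sinc_moment \<alpha> / (8 * pi ^ 3) * l powr \<alpha>\<bar> \<le> K * l\<^sup>2"
proof -
  have ehl[measurable]: "e \<in> borel_measurable hl" by (rule measurable_hl[OF measurable_spectrum])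
  have ei: "integrable hl e"
  proof (rule Bochner_Integration.integrable_bound)
    \<comment> \<open>Below \<open>k0\<close> the Gaussian weight is at least \<open>exp(-k0\<^sup>2)\<close>; above it the power law applies.\<close>
    show "integrable hl (\<lambda>k. exp (k0\<^sup>2) * \<bar>e k * gexp 1 k\<bar> + c * (indicator {k0/2<..} k * k powr (- 1 - \<alpha>)))"
      using integrable_spectrum[of 1] \<alpha> c by (intro Bochner_Integration.integrable_add integrable_mult_right integrable_abs integrable_hl_powr) auto
    show "AE k in hl. norm (e k) \<le> norm (exp (k0\<^sup>2) * \<bar>e k * gexp 1 k\<bar> + c * (indicator {k0/2<..} k * k powr (- 1 - \<alpha>)))"
      using law AE_space
    proof eventually_elim
      case (elim k)
      have k: "0 < k" using elim by (simp add: space_restrict_space)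
      have nn: "0 \<le> exp (k0\<^sup>2) * \<bar>e k * gexp 1 k\<bar>" "0 \<le> c * (indicator {k0/2<..} k * k powr (- 1 - \<alpha>))"
        using c by auto
      show ?case
      proof (cases "k0 \<le> k")
        case True
        then have "norm (e k) = c * (indicator {k0/2<..} k * k powr (- 1 - \<alpha>))"
          using elim c k by (simp add: abs_mult)
        with nn show ?thesis by simp
      next
        case False
        have "1 \<le> exp (k0\<^sup>2) * gexp 1 k"
          using False k by (simp add: mult_exp_exp power_mono)
        then have "\<bar>e k\<bar> * 1 \<le> \<bar>e k\<bar> * (exp (k0\<^sup>2) * gexp 1 k)" by (intro mult_left_mono) auto
        also have "\<dots> = exp (k0\<^sup>2) * \<bar>e k * gexp 1 k\<bar>" by (simp add: abs_mult)
        finally have "norm (e k) \<le> exp (k0\<^sup>2) * \<bar>e k * gexp 1 k\<bar>" by simp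
        with nn show ?thesis by simp
      qed
    qed
  qed simp
  note rep = correlation_of_spectrum[OF ei g]
  \<comment> \<open>An integrable majorant, independent of \<open>l\<close>, of the difference of the integrands divided by \<open>l\<^sup>2\<close>.\<close>
  define w where "w k = k0\<^sup>2 * \<bar>e k\<bar> + c * (indicator {0<..<k0} k * k powr (1 - \<alpha>))" for k
  have wi: "integrable hl w" unfolding w_def[abs_def] using ei \<alpha>
    by (intro Bochner_Integration.integrable_add integrable_mult_right integrable_abs integrable_hl_powr) auto
  show ?thesis
  proof (rule that[of "(\<integral>k. w k \<partial>hl) / (8 * pi ^ 3)"])
    fix l :: real assume l: "0 < l"
    let ?s = "\<lambda>k. 1 - sincf (k * l)"
    have sm: "(\<lambda>k. sincf (k * l)) \<in> borel_measurable hl" by (rule measurable_hl) measurable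
    have i1: "integrable hl (\<lambda>k. e k * sincf (k * l))"
    proof (rule Bochner_Integration.integrable_bound[OF ei])
      show "AE k in hl. norm (e k * sincf (k * l)) \<le> norm (e k)"
        unfolding real_norm_def abs_mult by (intro AE_I2 mult_left_le sincf_bounds(4) abs_ge_zero)
    qed (intro borel_measurable_times sm ehl)
    have i2: "integrable hl (\<lambda>k. e k * ?s k)" using ei i1 by (simp add: right_diff_distrib)
    note i3 = sinc_moment_scaling[OF \<alpha> l]
    have "\<gamma> 0 - \<gamma> l = ((\<integral>k. e k \<partial>hl) - (\<integral>k. e k * sincf (k * l) \<partial>hl)) / (8 * pi ^ 3)"
      using rep[of 0] rep[of l] l by (simp add: diff_divide_distrib sincf_def[of 0])
    also have "(\<integral>k. e k \<partial>hl) - (\<integral>k. e k * sincf (k * l) \<partial>hl) = (\<integral>k. e k * ?s k \<partial>hl)"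
      using Bochner_Integration.integral_diff[OF ei i1] by (simp add: right_diff_distrib)
    finally have "\<gamma> 0 - \<gamma> l - c * sinc_moment \<alpha> / (8 * pi ^ 3) * l powr \<alpha>
       = ((\<integral>k. e k * ?s k \<partial>hl) - c * (\<integral>k. ?s k * k powr (- 1 - \<alpha>) \<partial>hl)) / (8 * pi ^ 3)"
      unfolding i3(2) by (simp add: diff_divide_distrib)
    also have "(\<integral>k. e k * ?s k \<partial>hl) - c * (\<integral>k. ?s k * k powr (- 1 - \<alpha>) \<partial>hl)
       = (\<integral>k. e k * ?s k - c * (?s k * k powr (- 1 - \<alpha>)) \<partial>hl)"
      using i2 i3(1) by simp
    finally have eq: "\<gamma> 0 - \<gamma> l - c * sinc_moment \<alpha> / (8 * pi ^ 3) * l powr \<alpha>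
       = (\<integral>k. e k * ?s k - c * (?s k * k powr (- 1 - \<alpha>)) \<partial>hl) / (8 * pi ^ 3)" .
    have i4: "integrable hl (\<lambda>k. e k * ?s k - c * (?s k * k powr (- 1 - \<alpha>)))"
      using i2 i3(1) by simp
    have "\<bar>\<integral>k. e k * ?s k - c * (?s k * k powr (- 1 - \<alpha>)) \<partial>hl\<bar> \<le> (\<integral>k. w k * l\<^sup>2 \<partial>hl)"
    proof (rule order_trans[OF integral_abs_bound], rule integral_mono_AE)
      show "integrable hl (\<lambda>k. \<bar>e k * ?s k - c * (?s k * k powr (- 1 - \<alpha>))\<bar>)" using i4 by (rule integrable_abs)
      show "integrable hl (\<lambda>k. w k * l\<^sup>2)" using wi by simp
      show "AE k in hl. \<bar>e k * ?s k - c * (?s k * k powr (- 1 - \<alpha>))\<bar> \<le> w k * l\<^sup>2"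
        using law AE_space
      proof eventually_elim
        case (elim k)
        have k: "0 < k" using elim by (simp add: space_restrict_space)
        show ?case
        proof (cases "k0 \<le> k")
          case True
          then have "e k * ?s k - c * (?s k * k powr (- 1 - \<alpha>)) = 0" using elim by simp
          moreover have "0 \<le> w k * l\<^sup>2" using c by (simp add: w_def)
          ultimately show ?thesis by (simp only: abs_zero)
        next
          case False
          note sb = sincf_bounds[of "k * l"]
          have kk: "k\<^sup>2 * k powr (- 1 - \<alpha>) = k powr (1 - \<alpha>)"
          proof -
            have "k\<^sup>2 * k powr (- 1 - \<alpha>) = k powr 2 * k powr (- 1 - \<alpha>)" using k by (simp add: powr_numeral)
            then show ?thesis by (simp only: powr_add[symmetric]) simp
          qed
          have "\<bar>e k * ?s k - c * (?s k * k powr (- 1 - \<alpha>))\<bar> = \<bar>e k - c * k powr (- 1 - \<alpha>)\<bar> * ?s k"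
          proof -
            have "e k * ?s k - c * (?s k * k powr (- 1 - \<alpha>)) = (e k - c * k powr (- 1 - \<alpha>)) * ?s k"
              by (simp add: algebra_simps)
            then show ?thesis using sb(1) by (simp only: abs_mult abs_of_nonneg)
          qed
          also have "\<dots> \<le> (\<bar>e k\<bar> + c * k powr (- 1 - \<alpha>)) * (k * l)\<^sup>2"
            using sb(1,2) c by (intro mult_mono) (auto simp: abs_mult intro: order_trans[OF abs_triangle_ineq4])
          also have "\<dots> = (k\<^sup>2 * \<bar>e k\<bar> + c * (k\<^sup>2 * k powr (- 1 - \<alpha>))) * l\<^sup>2"
            by (simp add: algebra_simps power_mult_distrib)
          also have "\<dots> \<le> w k * l\<^sup>2"
            unfolding kk w_def using False k by (intro mult_right_mono add_mono) (auto intro!: mult_right_mono power_mono)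
          finally show ?thesis .
        qed
      qed
    qed
    then show "\<bar>\<gamma> 0 - \<gamma> l - c * sinc_moment \<alpha> / (8 * pi ^ 3) * l powr \<alpha>\<bar> \<le> (\<integral>k. w k \<partial>hl) / (8 * pi ^ 3) * l\<^sup>2"
      unfolding eq abs_divide by (simp add: divide_right_mono)
  qed
qed

section \<open>From the structure function to the spectrum\<close>

text \<open>The moment identity, differentiated twice in \<open>t\<close>. On the left each derivative gives a factor \<open>-k\<^sup>2\<close>.
  On the right, \<open>(\<pi>/t)^(3/2) r exp(-r\<^sup>2/(4t))\<close> solves the heat equation in \<open>t\<close> and \<open>r\<close>, so that two
  derivatives in \<open>t\<close> are four derivatives in \<open>r\<close>.\<close>

lemma (in spectral_pair) gauss_moment_second_derivative:
  assumes t: "0 < t"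
  shows "integrable hl (\<lambda>k. k ^ 4 * e k * gexp t k)"
    and "(\<integral>k. k ^ 4 * e k * gexp t k \<partial>hl)
      = sqrt (pi / t) ^ 3 * (4 * pi) * (\<integral>r. r * \<gamma> r * gauss4 (1 / (4 * t)) r \<partial>hl)"
proof -
  have v: "(\<lambda>k::real. k\<^sup>2) \<in> borel_measurable hl" by (rule measurable_hl) simp
  have v0: "\<And>x::real. x \<in> space hl \<Longrightarrow> 0 \<le> x\<^sup>2" by simp
  have em0: "e \<in> borel_measurable hl" by (rule measurable_hl[OF measurable_spectrum])
  have em1: "(\<lambda>k. e k * k\<^sup>2) \<in> borel_measurable hl" by (intro borel_measurable_times em0 v)
  have ei1: "integrable hl (\<lambda>k. e k * k\<^sup>2 * gexp t k)" if "0 < t" for t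
    by (rule laplace_integrable_times[OF em0 v v0 integrable_spectrum that])
  have ei2: "integrable hl (\<lambda>k. e k * k\<^sup>2 * k\<^sup>2 * gexp t k)" if "0 < t" for t
    by (rule laplace_integrable_times[OF em1 v v0 ei1 that])
  have k4: "e k * k\<^sup>2 * k\<^sup>2 = k ^ 4 * e k" for k by (simp add: power2_eq_square eval_nat_numeral)
  show "integrable hl (\<lambda>k. k ^ 4 * e k * gexp t k)" using ei2[OF t] unfolding k4 .
  define L where "L t = (\<integral>k. e k * gexp t k \<partial>hl)" for t
  define L1 where "L1 t = (\<integral>k. e k * k\<^sup>2 * gexp t k \<partial>hl)" for t
  define L2 where "L2 t = (\<integral>k. e k * k\<^sup>2 * k\<^sup>2 * gexp t k \<partial>hl)" for t
  have dL: "(L has_real_derivative - L1 t) (at t)" if "0 < t" for t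
    unfolding L_def[abs_def] L1_def by (rule laplace_has_derivative[OF em0 v v0 integrable_spectrum that])
  have dL1: "(L1 has_real_derivative - L2 t) (at t)" if "0 < t" for t
    unfolding L1_def[abs_def] L2_def by (rule laplace_has_derivative[OF em1 v v0 ei1 that])
  have gm0: "(\<lambda>r. r\<^sup>2 * \<gamma> r) \<in> borel_measurable hl" by (intro borel_measurable_times v measurable_hl[OF measurable_profile])
  have gm1: "(\<lambda>r. r\<^sup>2 * \<gamma> r * r\<^sup>2) \<in> borel_measurable hl" by (intro borel_measurable_times v gm0)
  have gi1: "integrable hl (\<lambda>r. r\<^sup>2 * \<gamma> r * r\<^sup>2 * gexp s r)" if "0 < s" for s
    by (rule laplace_integrable_times[OF gm0 v v0 integrable_profile that])
  have gi2: "integrable hl (\<lambda>r. r\<^sup>2 * \<gamma> r * r\<^sup>2 * r\<^sup>2 * gexp s r)" if "0 < s" for s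
    by (rule laplace_integrable_times[OF gm1 v v0 gi1 that])
  define N where "N s = (\<integral>r. r\<^sup>2 * \<gamma> r * gexp s r \<partial>hl)" for s
  define N1 where "N1 s = (\<integral>r. r\<^sup>2 * \<gamma> r * r\<^sup>2 * gexp s r \<partial>hl)" for s
  define N2 where "N2 s = (\<integral>r. r\<^sup>2 * \<gamma> r * r\<^sup>2 * r\<^sup>2 * gexp s r \<partial>hl)" for s
  have dN: "(N has_real_derivative - N1 s) (at s)" if "0 < s" for s
    unfolding N_def[abs_def] N1_def by (rule laplace_has_derivative[OF gm0 v v0 integrable_profile that])
  have dN1: "(N1 has_real_derivative - N2 s) (at s)" if "0 < s" for s
    unfolding N1_def[abs_def] N2_def by (rule laplace_has_derivative[OF gm1 v v0 gi1 that])
  define W where "W t = sqrt (pi / t) ^ 3 * (4 * pi)" for t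
  have dW: "(W has_real_derivative - (3 / (2 * t)) * W t) (at t)" if "0 < t" for t
  proof -
    have "0 < pi / t" using that by simp
    have "((\<lambda>t. pi / t) has_real_derivative - (pi / t) / t) (at t)"
      using that by (auto intro!: derivative_eq_intros simp: power2_eq_square)
    from DERIV_chain2[where f=sqrt and g="\<lambda>t. pi / t", OF DERIV_real_sqrt[OF \<open>0 < pi / t\<close>] this]
    have "((\<lambda>t. sqrt (pi / t)) has_real_derivative inverse (sqrt (pi / t)) / 2 * (- (pi / t) / t)) (at t)" .
    also have "inverse (sqrt (pi / t)) / 2 * (- (pi / t) / t) = - sqrt (pi / t) / (2 * t)"
    proof -
      have "(pi / t) = sqrt (pi / t) * sqrt (pi / t)" using that by simp
      then have "inverse (sqrt (pi / t)) * (pi / t) = sqrt (pi / t)"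
        using that by (metis \<open>0 < pi / t\<close> left_inverse mult.assoc mult_1 order_less_irrefl real_sqrt_gt_zero)
      moreover have "inverse q / 2 * (- p / t) = - (inverse q * p) / (2 * t)" for p q :: real by simp
      ultimately show ?thesis by (simp only:)
    qed
    finally have "((\<lambda>t. sqrt (pi / t)) has_real_derivative - sqrt (pi / t) / (2 * t)) (at t)" .
    from DERIV_cmult_right[OF DERIV_power[OF this, of 3], of "4 * pi"]
    have "(W has_real_derivative real 3 * (- sqrt (pi / t) / (2 * t) * sqrt (pi / t) ^ (3 - Suc 0)) * (4 * pi)) (at t)"
      unfolding W_def[abs_def] .
    moreover have "real 3 * (- q / (2 * t) * q ^ (3 - Suc 0)) * (4 * pi) = - (3 / (2 * t)) * (q ^ 3 * (4 * pi))" for q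
      by (simp add: power3_eq_cube power2_eq_square)
    ultimately show ?thesis by (simp only: W_def)
  qed
  have ds: "((\<lambda>t. 1 / (4 * t)) has_real_derivative - (1 / (4 * t\<^sup>2))) (at t)" if "0 < t" for t :: real
    using that by (auto intro!: derivative_eq_intros simp: power2_eq_square)
  have dNs: "((\<lambda>t. N (1 / (4 * t))) has_real_derivative N1 (1 / (4 * t)) / (4 * t\<^sup>2)) (at t)"
    "((\<lambda>t. N1 (1 / (4 * t))) has_real_derivative N2 (1 / (4 * t)) / (4 * t\<^sup>2)) (at t)" if "0 < t" for t
    using DERIV_chain2[OF dN[of "1 / (4 * t)"] ds[OF that]] DERIV_chain2[OF dN1[of "1 / (4 * t)"] ds[OF that]] that by auto
  have LW: "L t = W t * N (1 / (4 * t))" if "0 < t" for t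
    unfolding L_def W_def N_def by (rule gauss_moments[OF that])
  have L1W: "- L1 t = - (3 / (2 * t)) * W t * N (1 / (4 * t)) + W t * N1 (1 / (4 * t)) / (4 * t\<^sup>2)" if t: "0 < t" for t
  proof (rule DERIV_unique)
    have "(L has_real_derivative - L1 t) (at t)" by (rule dL[OF t])
    then show "((\<lambda>t. W t * N (1 / (4 * t))) has_real_derivative - L1 t) (at t)"
      by (rule has_field_derivative_transform_within_open[of _ _ _ "{0<..}"]) (use t LW in auto)
    show "((\<lambda>t. W t * N (1 / (4 * t))) has_real_derivative
      - (3 / (2 * t)) * W t * N (1 / (4 * t)) + W t * N1 (1 / (4 * t)) / (4 * t\<^sup>2)) (at t)"
      using DERIV_mult[OF dW[OF t] dNs(1)[OF t]] by (simp add: ac_simps)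
  qed
  have L2W: "L2 t = W t * (60 * (1 / (4 * t))\<^sup>2 * N (1 / (4 * t)) - 80 * (1 / (4 * t)) ^ 3 * N1 (1 / (4 * t))
      + 16 * (1 / (4 * t)) ^ 4 * N2 (1 / (4 * t)))"
  proof -
    define R where "R t = - (3 / (2 * t)) * W t * N (1 / (4 * t)) + W t * N1 (1 / (4 * t)) / (4 * t\<^sup>2)" for t
    have "((\<lambda>t. - L1 t) has_real_derivative L2 t) (at t)" using DERIV_minus[OF dL1[OF t]] by simp
    then have 1: "(R has_real_derivative L2 t) (at t)"
      by (rule has_field_derivative_transform_within_open[of _ _ _ "{0<..}"]) (use t L1W in \<open>auto simp: R_def\<close>)
    have a: "((\<lambda>t. - (3 / (2 * t))) has_real_derivative 3 / (2 * t\<^sup>2)) (at t)"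
      using t by (auto intro!: derivative_eq_intros simp: power2_eq_square)
    have b: "((\<lambda>t. 1 / (4 * t\<^sup>2)) has_real_derivative - (1 / (2 * t ^ 3))) (at t)"
      using t by (auto intro!: derivative_eq_intros simp: power2_eq_square power3_eq_cube field_simps)
    have R: "R = (\<lambda>t. - (3 / (2 * t)) * (W t * N (1 / (4 * t))) + (1 / (4 * t\<^sup>2)) * (W t * N1 (1 / (4 * t))))"
      by (simp add: R_def fun_eq_iff)
    have 2: "(R has_real_derivative
        (3 / (2 * t\<^sup>2) * (W t * N (1 / (4 * t))) + (- (3 / (2 * t)) * W t * N (1 / (4 * t)) + N1 (1 / (4 * t)) / (4 * t\<^sup>2) * W t) * (- (3 / (2 * t))))
        + (- (1 / (2 * t ^ 3)) * (W t * N1 (1 / (4 * t))) + (- (3 / (2 * t)) * W t * N1 (1 / (4 * t)) + N2 (1 / (4 * t)) / (4 * t\<^sup>2) * W t) * (1 / (4 * t\<^sup>2)))) (at t)"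
      unfolding R
      by (intro DERIV_add DERIV_mult a b dW dNs t)
    show ?thesis unfolding DERIV_unique[OF 1 2] using t
      by (simp add: field_simps power2_eq_square power3_eq_cube eval_nat_numeral)
  qed
  define s where "s = 1 / (4 * t)"
  have s: "0 < s" using t by (simp add: s_def)
  have "r * \<gamma> r * gauss4 s r = 60 * s\<^sup>2 * (r\<^sup>2 * \<gamma> r * gexp s r) - 80 * s ^ 3 * (r\<^sup>2 * \<gamma> r * r\<^sup>2 * gexp s r)
      + 16 * s ^ 4 * (r\<^sup>2 * \<gamma> r * r\<^sup>2 * r\<^sup>2 * gexp s r)" for r
    by (simp add: gauss4_def algebra_simps power2_eq_square eval_nat_numeral)
  then have "(\<integral>r. r * \<gamma> r * gauss4 s r \<partial>hl) = 60 * s\<^sup>2 * N s - 80 * s ^ 3 * N1 s + 16 * s ^ 4 * N2 s"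
    unfolding N_def N1_def N2_def using integrable_profile[OF s] gi1[OF s] gi2[OF s] by simp
  then show "(\<integral>k. k ^ 4 * e k * gexp t k \<partial>hl)
      = sqrt (pi / t) ^ 3 * (4 * pi) * (\<integral>r. r * \<gamma> r * gauss4 (1 / (4 * t)) r \<partial>hl)"
    using L2W unfolding L2_def k4 W_def s_def by simp
qed

text \<open>For \<open>\<alpha> \<le> 1\<close> the function \<open>r^(1+\<alpha>)\<close> is too singular at the origin for \<open>integral_by_parts_gauss4\<close>.
  Instead it is written, up to the factor \<open>sinc_moment \<alpha>\<close>, as the integral of
  \<open>(r - sin(kr)/k) k^(-1-\<alpha>)\<close> over \<open>k\<close>. Integration by parts under this integral removes the linear term
  and leaves the sine transform of \<open>r exp(-sr\<^sup>2)\<close>, a Gaussian in \<open>k\<close>.\<close>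

lemma gauss4_integral_powr:
  assumes \<alpha>: "0 < \<alpha>" "\<alpha> < 2" and s: "0 < s"
  shows "integrable hl (\<lambda>k. k powr (3 - \<alpha>) * gexp (1 / (4 * s)) k)"
    and "(\<integral>r. r powr (1 + \<alpha>) * gauss4 s r \<partial>hl)
      = - (sqrt (pi / s) / (4 * s)) / sinc_moment \<alpha> * (\<integral>k. k powr (3 - \<alpha>) * gexp (1 / (4 * s)) k \<partial>hl)"
proof -
  let ?f = "\<lambda>r k. gauss4 s r * (r * ((1 - sincf (k * r)) * k powr (- 1 - \<alpha>)))"
  \<comment> \<open>A product majorant arises from \<open>1 - sin(kr)/(kr) \<le> (2 + r\<^sup>2) min(1, k\<^sup>2)\<close>.\<close>
  define b where "b k = indicator {0<..<2} k * k powr (1 - \<alpha>) + indicator {1<..} k * k powr (- 1 - \<alpha>)" for k :: real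
  have bi: "integrable hl b" unfolding b_def[abs_def] using \<alpha>
    by (intro Bochner_Integration.integrable_add integrable_hl_powr) auto
  have "cubic_growth {0<..} (\<lambda>r. 2 * r + r ^ 3)"
    by (intro cubic_growth_add cubic_growth_cmult cubic_growth_id cubic_growthI[where p="\<lambda>r. r ^ 3" and C=1]) auto
  then have ai: "integrable hl (\<lambda>r. \<bar>(2 * r + r ^ 3) * gauss4 s r\<bar>)"
    by (intro integrable_abs integrable_growth_gauss4[OF s] measurable_hl) measurable
  have fm: "(\<lambda>(r, k). ?f r k) \<in> borel_measurable (hl \<Otimes>\<^sub>M hl)"
    unfolding gauss4_def by (rule measurable_hl_pair) (unfold borel_prod[symmetric], measurable)
  have fb: "\<bar>?f r k\<bar> \<le> \<bar>(2 * r + r ^ 3) * gauss4 s r\<bar> * b k" if r: "0 < r" and k: "0 < k" for r k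
  proof -
    note sb = sincf_bounds[of "k * r"]
    have "(1 - sincf (k * r)) * k powr (- 1 - \<alpha>) \<le> (2 + r\<^sup>2) * b k"
    proof (cases "k \<le> 1")
      case True
      have "(1 - sincf (k * r)) * k powr (- 1 - \<alpha>) \<le> (k * r)\<^sup>2 * k powr (- 1 - \<alpha>)"
        by (intro mult_right_mono sb) simp
      also have "\<dots> = r\<^sup>2 * (k powr 2 * k powr (- 1 - \<alpha>))" using k by (simp add: powr_numeral power_mult_distrib)
      also have "\<dots> = r\<^sup>2 * k powr (1 - \<alpha>)" by (simp only: powr_add[symmetric]) simp
      also have "\<dots> \<le> (2 + r\<^sup>2) * b k"
        using True k by (intro mult_mono) (auto simp: b_def)
      finally show ?thesis .
    next
      case False
      have "(1 - sincf (k * r)) * k powr (- 1 - \<alpha>) \<le> 2 * k powr (- 1 - \<alpha>)"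
        by (intro mult_right_mono sb) simp
      also have "\<dots> \<le> (2 + r\<^sup>2) * b k"
        using False k by (intro mult_mono) (auto simp: b_def)
      finally show ?thesis .
    qed
    then have "\<bar>gauss4 s r\<bar> * r * ((1 - sincf (k * r)) * k powr (- 1 - \<alpha>)) \<le> \<bar>gauss4 s r\<bar> * r * ((2 + r\<^sup>2) * b k)"
      using r by (intro mult_left_mono) auto
    moreover have "\<bar>?f r k\<bar> = \<bar>gauss4 s r\<bar> * r * ((1 - sincf (k * r)) * k powr (- 1 - \<alpha>))"
      using r sb(1) by (simp add: abs_mult)
    moreover have "2 * r + r ^ 3 = r * (2 + r\<^sup>2)" by (simp add: power2_eq_square power3_eq_cube algebra_simps)
    then have "\<bar>(2 * r + r ^ 3) * gauss4 s r\<bar> = \<bar>gauss4 s r\<bar> * r * (2 + r\<^sup>2)"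
      using r by (simp add: abs_mult add_pos_nonneg)
    ultimately show ?thesis by (simp add: mult.assoc)
  qed
  have F1: "(\<integral>r. (\<integral>k. ?f r k \<partial>hl) \<partial>hl) = (\<integral>k. (\<integral>r. ?f r k \<partial>hl) \<partial>hl)"
    by (rule Fubini_hl_dominated(1)[OF fm ai bi fb])
  have F3: "integrable hl (\<lambda>k. \<integral>r. ?f r k \<partial>hl)"
    by (rule Fubini_hl_dominated(3)[OF fm ai bi fb])
  have left: "(\<integral>k. ?f r k \<partial>hl) = sinc_moment \<alpha> * (r powr (1 + \<alpha>) * gauss4 s r)" if "r \<in> space hl" for r
  proof -
    have r: "0 < r" using that by (simp add: space_restrict_space)
    show ?thesis unfolding integral_mult_right_zero sinc_moment_scaling(2)[OF \<alpha> r] using r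
      by (simp add: powr_add)
  qed
  have right: "(\<integral>r. ?f r k \<partial>hl) = - (sqrt (pi / s) / (4 * s)) * (k powr (3 - \<alpha>) * gexp (1 / (4 * s)) k)"
    if "k \<in> space hl" for k
  proof -
    have k: "0 < k" using that by (simp add: space_restrict_space)
    define p0 where "p0 r = r - sin (k * r) / k" for r
    have "(\<integral>r. p0 r * gauss4 s r \<partial>hl) = (\<integral>r. - (k ^ 3) * sin (k * r) * (r * gexp s r) \<partial>hl)"
    proof (rule integral_by_parts_gauss4[where ?p1.0="\<lambda>r. 1 - cos (k * r)" and ?p2.0="\<lambda>r. k * sin (k * r)"
          and ?p3.0="\<lambda>r. k\<^sup>2 * cos (k * r)" and ?p4.0="\<lambda>r. - (k ^ 3) * sin (k * r)", OF s])
      show "(p0 has_real_derivative 1 - cos (k * r)) (at r)" for r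
        unfolding p0_def[abs_def] using k by (auto intro!: derivative_eq_intros)
      show "((\<lambda>r. 1 - cos (k * r)) has_real_derivative k * sin (k * r)) (at r)" for r
        by (auto intro!: derivative_eq_intros)
      show "((\<lambda>r. k * sin (k * r)) has_real_derivative k\<^sup>2 * cos (k * r)) (at r)" for r
        by (auto intro!: derivative_eq_intros simp: power2_eq_square)
      show "((\<lambda>r. k\<^sup>2 * cos (k * r)) has_real_derivative - (k ^ 3) * sin (k * r)) (at r)" for r
        by (auto intro!: derivative_eq_intros simp: power2_eq_square power3_eq_cube)
      show "continuous_on {0<..} (\<lambda>r. - (k ^ 3) * sin (k * r))" by (intro continuous_intros)
      have bd: "cubic_growth {0<..} (\<lambda>r. sin (k * r))" "cubic_growth {0<..} (\<lambda>r. cos (k * r))" "cubic_growth {0<..} (\<lambda>r. 1)"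
        by (rule cubic_growth_bounded[where C=1], simp)+
      show "cubic_growth {0<..} p0"
        using cubic_growth_add[OF cubic_growth_id cubic_growth_cmult[OF bd(1), of "- 1 / k"]] by (simp add: p0_def[abs_def])
      show "cubic_growth {0<..} (\<lambda>r. 1 - cos (k * r))"
        using cubic_growth_add[OF bd(3) cubic_growth_cmult[OF bd(2), of "- 1"]] by simp
      show "cubic_growth {0<..} (\<lambda>r. k * sin (k * r))" "cubic_growth {0<..} (\<lambda>r. k\<^sup>2 * cos (k * r))"
        by (intro cubic_growth_cmult bd)+
      show "(p0 \<longlongrightarrow> 0) (at_right 0)"
        unfolding p0_def[abs_def] using k by (auto intro!: tendsto_eq_intros)
      show "((\<lambda>r. k * sin (k * r)) \<longlongrightarrow> 0) (at_right 0)"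
        by (auto intro!: tendsto_eq_intros)
      show "integrable hl (\<lambda>r. - (k ^ 3) * sin (k * r) * (r * gexp s r))"
        using integrable_mult_right[OF integral_sin_gauss_hl(2)[OF s, of k], of "- (k ^ 3)"] by (simp add: ac_simps)
    qed
    also have "\<dots> = - (k ^ 3) * (\<integral>r. r * sin (k * r) * gexp s r \<partial>hl)"
      unfolding integral_mult_right_zero[symmetric] by (intro Bochner_Integration.integral_cong refl) simp
    finally have p0: "(\<integral>r. p0 r * gauss4 s r \<partial>hl) = - (k ^ 3) * (k / (2 * s) * (sqrt (pi / s) / 2 * exp (- (k\<^sup>2 / (4 * s)))))"
      unfolding integral_sin_gauss_hl(1)[OF s] .
    have "(\<integral>r. ?f r k \<partial>hl) = (\<integral>r. k powr (- 1 - \<alpha>) * (p0 r * gauss4 s r) \<partial>hl)"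
      using k by (intro Bochner_Integration.integral_cong refl)
        (auto simp: space_restrict_space sincf_def p0_def field_simps)
    also have "\<dots> = - (sqrt (pi / s) / (4 * s)) * ((k powr (- 1 - \<alpha>) * k ^ 4) * gexp (1 / (4 * s)) k)"
      unfolding integral_mult_right_zero p0 by (simp add: eval_nat_numeral)
    also have "k powr (- 1 - \<alpha>) * k ^ 4 = k powr (- 1 - \<alpha>) * k powr 4" using k by (simp add: powr_numeral)
    also have "\<dots> = k powr (3 - \<alpha>)" by (simp only: powr_add[symmetric]) simp
    finally show ?thesis .
  qed
  have c: "sqrt (pi / s) / (4 * s) \<noteq> 0" using s by simp
  have "integrable hl (\<lambda>k. - (sqrt (pi / s) / (4 * s)) * (k powr (3 - \<alpha>) * gexp (1 / (4 * s)) k))"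
    using F3 by (subst (asm) Bochner_Integration.integrable_cong[OF refl right])
  then show "integrable hl (\<lambda>k. k powr (3 - \<alpha>) * gexp (1 / (4 * s)) k)"
    using c by (simp only: integrable_mult_left_iff) simp
  have solve: "x = - q / A * y" if "A * x = - q * y" "0 < A" for x y q A :: real
    using that by (simp add: field_simps)
  have "sinc_moment \<alpha> * (\<integral>r. r powr (1 + \<alpha>) * gauss4 s r \<partial>hl) = (\<integral>r. (\<integral>k. ?f r k \<partial>hl) \<partial>hl)"
    unfolding integral_mult_right_zero[symmetric, of "sinc_moment \<alpha>"]
    by (rule Bochner_Integration.integral_cong[OF refl left[symmetric]])
  also have "\<dots> = (\<integral>k. - (sqrt (pi / s) / (4 * s)) * (k powr (3 - \<alpha>) * gexp (1 / (4 * s)) k) \<partial>hl)"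
    unfolding F1 by (rule Bochner_Integration.integral_cong[OF refl right])
  finally show "(\<integral>r. r powr (1 + \<alpha>) * gauss4 s r \<partial>hl)
      = - (sqrt (pi / s) / (4 * s)) / sinc_moment \<alpha> * (\<integral>k. k powr (3 - \<alpha>) * gexp (1 / (4 * s)) k \<partial>hl)"
    unfolding integral_mult_right_zero using sinc_moment_pos[OF \<alpha>] by (intro solve) auto
qed

text \<open>Fubini, as \<open>r exp(-r\<^sup>2/(4t))\<close> is a multiple of the sine transform of \<open>k exp(-tk\<^sup>2)\<close>.\<close>

lemma gauss_integral_as_sine_transform:
  assumes g: "integrable hl g" and t: "0 < t"
  shows "integrable hl (\<lambda>k. k * (\<integral>r. sin (k * r) * g r \<partial>hl) * gexp t k)"
    and "(\<integral>k. k * (\<integral>r. sin (k * r) * g r \<partial>hl) * gexp t k \<partial>hl)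
      = sqrt (pi / t) / (4 * t) * (\<integral>r. g r * (r * gexp (1 / (4 * t)) r) \<partial>hl)"
proof -
  let ?f = "\<lambda>k r. k * sin (k * r) * gexp t k * g r"
  have [measurable]: "g \<in> borel_measurable hl" using g by (rule borel_measurable_integrable)
  have m1: "(\<lambda>(k, r). k * sin (k * r) * gexp t k) \<in> borel_measurable (hl \<Otimes>\<^sub>M hl)"
    by (rule measurable_hl_pair) (unfold borel_prod[symmetric], measurable)
  have m2: "(\<lambda>(k::real, r). g r) \<in> borel_measurable (hl \<Otimes>\<^sub>M hl)" by measurable
  have fm: "(\<lambda>(k, r). ?f k r) \<in> borel_measurable (hl \<Otimes>\<^sub>M hl)"
    using borel_measurable_times[OF m1 m2] by (simp add: case_prod_beta)
  have ai: "integrable hl (\<lambda>k. k ^ 1 * gexp t k)"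
    by (intro integrable_hl_lborel integrable_power_gauss t)
  have fb: "\<bar>?f k r\<bar> \<le> (k ^ 1 * gexp t k) * \<bar>g r\<bar>" if "0 < k" for k r
  proof -
    have "\<bar>?f k r\<bar> = (k * gexp t k * \<bar>g r\<bar>) * \<bar>sin (k * r)\<bar>" using that by (simp add: abs_mult)
    also have "\<dots> \<le> k * gexp t k * \<bar>g r\<bar>" using that by (intro mult_left_le) auto
    finally show ?thesis by simp
  qed
  have F1: "(\<integral>k. (\<integral>r. ?f k r \<partial>hl) \<partial>hl) = (\<integral>r. (\<integral>k. ?f k r \<partial>hl) \<partial>hl)"
    by (rule Fubini_hl_dominated(1)[OF fm ai integrable_abs[OF g] fb])
  have F2: "integrable hl (\<lambda>k. \<integral>r. ?f k r \<partial>hl)"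
    by (rule Fubini_hl_dominated(2)[OF fm ai integrable_abs[OF g] fb])
  have left: "(\<integral>r. ?f k r \<partial>hl) = k * (\<integral>r. sin (k * r) * g r \<partial>hl) * gexp t k" for k
  proof -
    have "(\<integral>r. ?f k r \<partial>hl) = (\<integral>r. (k * gexp t k) * (sin (k * r) * g r) \<partial>hl)"
      by (intro Bochner_Integration.integral_cong refl) (simp add: ac_simps)
    then show ?thesis unfolding integral_mult_right_zero by (simp add: ac_simps)
  qed
  have right: "(\<integral>k. ?f k r \<partial>hl) = sqrt (pi / t) / (4 * t) * (g r * (r * gexp (1 / (4 * t)) r))" for r
  proof -
    have "(\<integral>k. ?f k r \<partial>hl) = (\<integral>k. k * sin (r * k) * gexp t k \<partial>hl) * g r"
      unfolding integral_mult_left_zero[symmetric] by (intro Bochner_Integration.integral_cong refl) (simp add: mult.commute)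
    then show ?thesis unfolding integral_sin_gauss_hl(1)[OF t] by simp
  qed
  show "integrable hl (\<lambda>k. k * (\<integral>r. sin (k * r) * g r \<partial>hl) * gexp t k)"
    using F2 unfolding left .
  show "(\<integral>k. k * (\<integral>r. sin (k * r) * g r \<partial>hl) * gexp t k \<partial>hl)
      = sqrt (pi / t) / (4 * t) * (\<integral>r. g r * (r * gexp (1 / (4 * t)) r) \<partial>hl)"
    using F1 unfolding left right integral_mult_right_zero .
qed


lemma deriv_vanishes_below:
  fixes p q :: "real \<Rightarrow> real"
  assumes "\<And>r. 0 < r \<Longrightarrow> (p has_real_derivative q r) (at r)"
    and z: "\<And>r. 0 < r \<Longrightarrow> r < l \<Longrightarrow> p r = 0" and r: "0 < r" "r < l"
  shows "q r = 0"
proof -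
  have "(p has_real_derivative q r) (at r)" by (rule assms(1)[OF r(1)])
  then have "((\<lambda>_. 0) has_real_derivative q r) (at r)"
    by (rule has_field_derivative_transform_within_open[of _ _ _ "{0<..<l}"]) (use r z in auto)
  then show ?thesis using DERIV_unique DERIV_const by blast
qed

text \<open>The remainder \<open>p0(r) = r (\<gamma>(r) - g0 + c r^\<alpha>)\<close> vanishes below \<open>l\<close>, and so do its derivatives
  \<open>p1, ..., p4\<close>; therefore integration by parts has no boundary term at the origin. At infinity the
  decay of the derivatives of \<open>\<gamma>\<close> yields \<open>p4(r) = O(r^(-2)) + O(r^(\<alpha>-3))\<close>, which is integrable.\<close>

lemma power_law_remainder:
  fixes \<gamma> :: "nat \<Rightarrow> real \<Rightarrow> real"
  assumes d\<gamma>: "\<And>r j. 0 < r \<Longrightarrow> j < 5 \<Longrightarrow> (\<gamma> j has_real_derivative \<gamma> (Suc j) r) (at r)"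
    and dec: "\<And>d. 0 < d \<Longrightarrow> \<exists>C\<ge>0. \<forall>r\<ge>d. \<forall>j\<le>5. \<bar>\<gamma> j r\<bar> \<le> C / (1 + r powi (int j - 1))"
    and \<alpha>: "0 < \<alpha>" "\<alpha> < 2" and l: "0 < l"
    and law: "\<And>r. 0 < r \<Longrightarrow> r < l \<Longrightarrow> \<gamma> 0 r = g0 - c * r powr \<alpha>"
  obtains p4 where "integrable hl p4"
    "\<And>s. 0 < s \<Longrightarrow> integrable hl (\<lambda>r. (r * \<gamma> 0 r - g0 * r + c * r powr (1 + \<alpha>)) * gauss4 s r)"
    "\<And>s. 0 < s \<Longrightarrow> (\<integral>r. (r * \<gamma> 0 r - g0 * r + c * r powr (1 + \<alpha>)) * gauss4 s r \<partial>hl)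
        = (\<integral>r. p4 r * (r * gexp s r) \<partial>hl)"
proof -
  define p0 where "p0 r = r * \<gamma> 0 r - g0 * r + c * r powr (1 + \<alpha>)" for r
  define p1 where "p1 r = r * \<gamma> 1 r + \<gamma> 0 r - g0 + c * ((1 + \<alpha>) * r powr \<alpha>)" for r
  define p2 where "p2 r = r * \<gamma> 2 r + 2 * \<gamma> 1 r + c * ((1 + \<alpha>) * (\<alpha> * r powr (\<alpha> - 1)))" for r
  define p3 where "p3 r = r * \<gamma> 3 r + 3 * \<gamma> 2 r + c * ((1 + \<alpha>) * (\<alpha> * ((\<alpha> - 1) * r powr (\<alpha> - 2))))" for r
  define p4 where "p4 r = r * \<gamma> 4 r + 4 * \<gamma> 3 r + c * ((1 + \<alpha>) * (\<alpha> * ((\<alpha> - 1) * ((\<alpha> - 2) * r powr (\<alpha> - 3)))))" for r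
  have dp: "((\<lambda>r. r powr a) has_real_derivative a * r powr (a - 1)) (at r)" if "0 < r" for a r :: real
    using has_real_derivative_powr[OF that, of a] by simp
  have dg: "(\<gamma> 0 has_real_derivative \<gamma> 1 r) (at r)" "(\<gamma> 1 has_real_derivative \<gamma> 2 r) (at r)"
    "(\<gamma> 2 has_real_derivative \<gamma> 3 r) (at r)" "(\<gamma> 3 has_real_derivative \<gamma> 4 r) (at r)"
    "(\<gamma> 4 has_real_derivative \<gamma> 5 r) (at r)" if "0 < r" for r
    using d\<gamma>[OF that, of 0] d\<gamma>[OF that, of 1] d\<gamma>[OF that, of 2] d\<gamma>[OF that, of 3] d\<gamma>[OF that, of 4]
    by (simp_all add: eval_nat_numeral)
  have d0: "(p0 has_real_derivative p1 r) (at r)" if r: "0 < r" for r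
    unfolding p0_def[abs_def] p1_def
    by (rule derivative_eq_intros dg[OF r] dp[OF r] refl)+ (simp add: algebra_simps)
  have d1: "(p1 has_real_derivative p2 r) (at r)" if r: "0 < r" for r
    unfolding p1_def[abs_def] p2_def
    by (rule derivative_eq_intros dg[OF r] dp[OF r] refl)+ (simp add: algebra_simps)
  have d2: "(p2 has_real_derivative p3 r) (at r)" if r: "0 < r" for r
    unfolding p2_def[abs_def] p3_def
    by (rule derivative_eq_intros dg[OF r] dp[OF r] refl)+ (simp add: algebra_simps)
  have d3: "(p3 has_real_derivative p4 r) (at r)" if r: "0 < r" for r
    unfolding p3_def[abs_def] p4_def
    by (rule derivative_eq_intros dg[OF r] dp[OF r] refl)+ (simp add: algebra_simps)
  have c4: "continuous_on {0<..} p4"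
  proof -
    have "continuous_on {0<..} (\<gamma> 3)" "continuous_on {0<..} (\<gamma> 4)"
      using dg(4,5) by (auto intro!: continuous_at_imp_continuous_on dest: DERIV_isCont)
    then show ?thesis unfolding p4_def[abs_def] by (intro continuous_intros) auto
  qed
  have z0: "p0 r = 0" if "0 < r" "r < l" for r
    unfolding p0_def law[OF that] using that by (simp add: powr_add algebra_simps)
  have z1: "p1 r = 0" if "0 < r" "r < l" for r
    by (rule deriv_vanishes_below[OF d0 z0 that])
  have z2: "p2 r = 0" if "0 < r" "r < l" for r
    by (rule deriv_vanishes_below[OF d1 z1 that])
  have z3: "p3 r = 0" if "0 < r" "r < l" for r
    by (rule deriv_vanishes_below[OF d2 z2 that])
  have z4: "p4 r = 0" if "0 < r" "r < l" for r
    by (rule deriv_vanishes_below[OF d3 z3 that])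
  \<comment> \<open>As everything vanishes below \<open>l\<close>, bounds on \<open>[d, \<infinity>)\<close> with \<open>d < l\<close> cover the half-line.\<close>
  define d where "d = l / 2"
  have d: "0 < d" "d < l" using l by (auto simp: d_def)
  obtain C where C: "0 \<le> C" and Cb: "\<And>r j. d \<le> r \<Longrightarrow> j \<le> 5 \<Longrightarrow> \<bar>\<gamma> j r\<bar> \<le> C / (1 + r powi (int j - 1))"
    using dec[OF d(1)] by blast
  have Cb': "\<bar>\<gamma> j r\<bar> \<le> C" if "d \<le> r" "j \<le> 5" for r j
  proof -
    have "0 \<le> r powi (int j - 1)" using d that by (intro zero_le_power_int) auto
    then have "C / (1 + r powi (int j - 1)) \<le> C / 1" using C by (intro divide_left_mono) auto
    with Cb[OF that] show ?thesis by simp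
  qed
  have G: "cubic_growth {d..} (\<gamma> j)" "cubic_growth {d..} (\<lambda>r. r * \<gamma> j r)" if "j \<le> 5" for j
    by (rule cubic_growth_id_times[of _ _ C]; use Cb' d that in force)+
  have K: "cubic_growth {d..} (\<lambda>r. k)" "cubic_growth {d..} (\<lambda>r. r * k)" for k
    by (rule cubic_growth_id_times[of _ _ "\<bar>k\<bar>"]; use d in force)+
  have R: "cubic_growth {d..} (\<lambda>r. r powr a)" if "a \<le> 3" for a
    by (rule cubic_growth_powr[OF d(1) that])
  note growth = cubic_growth_add cubic_growth_cmult G K R
  have "cubic_growth {d..} (\<lambda>r. r * \<gamma> 0 r + r * (- g0) + c * r powr (1 + \<alpha>))"
    by (intro growth) (use \<alpha> in auto)
  then have b0: "cubic_growth {0<..} p0"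
    by (intro cubic_growth_extend[OF _ d(2) z0]) (simp_all add: p0_def[abs_def] mult.commute)
  have "cubic_growth {d..} (\<lambda>r. r * \<gamma> 1 r + \<gamma> 0 r + (- g0) + c * ((1 + \<alpha>) * r powr \<alpha>))"
    by (intro growth) (use \<alpha> in auto)
  then have b1: "cubic_growth {0<..} p1"
    by (intro cubic_growth_extend[OF _ d(2) z1]) (simp_all add: p1_def[abs_def])
  have b2: "cubic_growth {0<..} p2"
    by (intro cubic_growth_extend[OF _ d(2) z2], unfold p2_def[abs_def], intro growth) (use \<alpha> in auto)
  have b3: "cubic_growth {0<..} p3"
    by (intro cubic_growth_extend[OF _ d(2) z3], unfold p3_def[abs_def], intro growth) (use \<alpha> in auto)
  have i4: "integrable hl p4"
  proof (rule Bochner_Integration.integrable_bound)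
    define k where "k = \<bar>c * ((1 + \<alpha>) * (\<alpha> * ((\<alpha> - 1) * (\<alpha> - 2))))\<bar>"
    show "integrable hl (\<lambda>r. (C + 4 * C) * (indicator {d / 2<..} r * r powr (- 2)) + k * (indicator {d / 2<..} r * r powr (\<alpha> - 3)))"
      using \<alpha> d by (intro Bochner_Integration.integrable_add integrable_mult_right integrable_hl_powr) auto
    show "p4 \<in> borel_measurable hl" by (rule measurable_hl_continuous[OF c4])
    show "AE r in hl. norm (p4 r) \<le> norm ((C + 4 * C) * (indicator {d / 2<..} r * r powr (- 2)) + k * (indicator {d / 2<..} r * r powr (\<alpha> - 3)))"
    proof (rule AE_I2)
      fix r assume "r \<in> space hl"
      then have r: "0 < r" by (simp add: space_restrict_space)
      show "norm (p4 r) \<le> norm ((C + 4 * C) * (indicator {d / 2<..} r * r powr (- 2)) + k * (indicator {d / 2<..} r * r powr (\<alpha> - 3)))"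
      proof (cases "r < l")
        case True
        then have "p4 r = 0" by (rule z4[OF r])
        then show ?thesis by simp
      next
        case False
        then have dr: "d \<le> r" "d / 2 < r" using d by auto
        have "\<bar>\<gamma> 4 r\<bar> \<le> C / (1 + r ^ 3)" using Cb[OF dr(1), of 4] by simp
        also have "\<dots> \<le> C / r ^ 3" using C r by (intro divide_left_mono) (auto intro!: mult_pos_pos add_pos_pos)
        finally have "r * \<bar>\<gamma> 4 r\<bar> \<le> r * (C / r ^ 3)" using r by (intro mult_left_mono) auto
        also have "\<dots> = C * r powr (- 2)" using r by (simp add: powr_minus powr_numeral power3_eq_cube power2_eq_square field_simps)
        finally have 1: "\<bar>r * \<gamma> 4 r\<bar> \<le> C * r powr (- 2)" using r by (simp add: abs_mult)
        have "\<bar>\<gamma> 3 r\<bar> \<le> C / (1 + r ^ 2)" using Cb[OF dr(1), of 3] by simp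
        also have "\<dots> \<le> C / r ^ 2" using C r by (intro divide_left_mono) (auto intro!: mult_pos_pos add_pos_pos)
        also have "\<dots> = C * r powr (- 2)" using r by (simp add: powr_minus powr_numeral field_simps)
        finally have 2: "\<bar>4 * \<gamma> 3 r\<bar> \<le> 4 * C * r powr (- 2)" by simp
        have 3: "\<bar>c * ((1 + \<alpha>) * (\<alpha> * ((\<alpha> - 1) * ((\<alpha> - 2) * r powr (\<alpha> - 3)))))\<bar> = k * r powr (\<alpha> - 3)"
          by (simp add: k_def abs_mult)
        have "\<bar>p4 r\<bar> \<le> (C + 4 * C) * r powr (- 2) + k * r powr (\<alpha> - 3)"
          unfolding p4_def using 1 2 3 by (simp only: distrib_right)
        then show ?thesis using dr by simp
      qed
    qed
  qed
  have near: "(p \<longlongrightarrow> 0) (at_right 0)" if "\<And>r. 0 < r \<Longrightarrow> r < l \<Longrightarrow> p r = 0" for p :: "real \<Rightarrow> real"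
    by (rule tendsto_eventually) (use that l in \<open>auto simp: eventually_at_right_field\<close>)
  have c0: "continuous_on {0<..} p0"
    using d0 by (auto intro!: continuous_at_imp_continuous_on dest: DERIV_isCont)
  show ?thesis
  proof (rule that[OF i4])
    fix s :: real assume s: "0 < s"
    show "integrable hl (\<lambda>r. (r * \<gamma> 0 r - g0 * r + c * r powr (1 + \<alpha>)) * gauss4 s r)"
      using integrable_growth_gauss4[OF s measurable_hl_continuous[OF c0] b0] unfolding p0_def .
    have m4: "(\<lambda>r. r * gexp s r) \<in> borel_measurable hl" by (rule measurable_hl) measurable
    obtain M where M: "\<And>r. 0 \<le> r \<Longrightarrow> (1 + r) ^ 1 * gexp s r \<le> M"
      using bounded_power_gauss[OF s] by blast
    have i: "integrable hl (\<lambda>r. p4 r * (r * gexp s r))"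
    proof (rule Bochner_Integration.integrable_bound)
      show "integrable hl (\<lambda>r. M * p4 r)" using i4 by simp
      show "(\<lambda>r. p4 r * (r * gexp s r)) \<in> borel_measurable hl"
        by (intro borel_measurable_times measurable_hl_continuous[OF c4] m4)
      show "AE r in hl. norm (p4 r * (r * gexp s r)) \<le> norm (M * p4 r)"
      proof (rule AE_I2)
        fix r assume "r \<in> space hl"
        then have r: "0 < r" by (simp add: space_restrict_space)
        have "r * gexp s r \<le> (1 + r) ^ 1 * gexp s r" using r by (intro mult_right_mono) auto
        also have "\<dots> \<le> M" using r by (intro M) simp
        finally have "\<bar>r * gexp s r\<bar> \<le> \<bar>M\<bar>" using r by (simp add: abs_mult)
        from mult_left_mono[OF this abs_ge_zero[of "p4 r"]]
        show "norm (p4 r * (r * gexp s r)) \<le> norm (M * p4 r)"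
          unfolding real_norm_def abs_mult by (simp add: mult.commute[of "\<bar>M\<bar>"])
      qed
    qed
    show "(\<integral>r. (r * \<gamma> 0 r - g0 * r + c * r powr (1 + \<alpha>)) * gauss4 s r \<partial>hl)
        = (\<integral>r. p4 r * (r * gexp s r) \<partial>hl)"
      using integral_by_parts_gauss4[OF s d0 d1 d2 d3 c4 b0 b1 b2 b3 near[OF z0] near[OF z2] i]
      unfolding p0_def by auto
  qed
qed

text \<open>Here \<open>r \<gamma>(r)\<close> is \<open>g0 r - c r^(1+\<alpha>)\<close> plus the remainder. Tested with the fourth derivative of
  \<open>r exp(-sr\<^sup>2)\<close>, the linear term gives \<open>0\<close>, the power gives a Gaussian moment of \<open>k^(3-\<alpha>)\<close>, and the
  remainder gives that of a sine transform. The weight \<open>k\<^sup>4\<close> is essential for comparing moments: without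
  it, \<open>k^(-1-\<alpha>)\<close> would not be integrable at \<open>0\<close>.\<close>

lemma spectrum_of_power_law:
  fixes e :: "real \<Rightarrow> real" and \<gamma> :: "nat \<Rightarrow> real \<Rightarrow> real"
  assumes pair: "spectral_pair e (\<gamma> 0)"
    and d\<gamma>: "\<And>r j. 0 < r \<Longrightarrow> j < 5 \<Longrightarrow> (\<gamma> j has_real_derivative \<gamma> (Suc j) r) (at r)"
    and dec: "\<And>d. 0 < d \<Longrightarrow> \<exists>C\<ge>0. \<forall>r\<ge>d. \<forall>j\<le>5. \<bar>\<gamma> j r\<bar> \<le> C / (1 + r powi (int j - 1))"
    and \<alpha>: "0 < \<alpha>" "\<alpha> < 2" and l: "0 < l"
    and law: "\<And>r. 0 < r \<Longrightarrow> r < l \<Longrightarrow> \<gamma> 0 r = g0 - c * r powr \<alpha>"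
  obtains p where "integrable hl p"
    "AE k in hl. k ^ 4 * e k = 8 * pi ^ 3 * c / sinc_moment \<alpha> * k powr (3 - \<alpha>)
       + 16 * pi\<^sup>2 * (k * (\<integral>r. sin (k * r) * p r \<partial>hl))"
proof -
  obtain p where p: "integrable hl p"
    and pg: "\<And>s. 0 < s \<Longrightarrow> integrable hl (\<lambda>r. (r * \<gamma> 0 r - g0 * r + c * r powr (1 + \<alpha>)) * gauss4 s r)"
    and pe: "\<And>s. 0 < s \<Longrightarrow> (\<integral>r. (r * \<gamma> 0 r - g0 * r + c * r powr (1 + \<alpha>)) * gauss4 s r \<partial>hl)
        = (\<integral>r. p r * (r * gexp s r) \<partial>hl)"
    using power_law_remainder[OF d\<gamma> dec \<alpha> l law] by blast
  define H where "H k = (\<integral>r. sin (k * r) * p r \<partial>hl)" for k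
  have "AE k in hl. k ^ 4 * e k - (8 * pi ^ 3 * c / sinc_moment \<alpha> * k powr (3 - \<alpha>) + 16 * pi\<^sup>2 * (k * H k)) = 0"
  proof (rule gauss_laplace_unique)
    fix t :: real assume t: "0 < t"
    define s where "s = 1 / (4 * t)"
    have s: "0 < s" and ts: "1 / (4 * s) = t" using t by (auto simp: s_def)
    define W where "W = sqrt (pi / t) ^ 3 * (4 * pi)"
    note M = spectral_pair.gauss_moment_second_derivative[OF pair t, folded s_def W_def]
    note P = gauss4_integral_powr[OF \<alpha> s, unfolded ts]
    note S = gauss_integral_as_sine_transform[OF p t, folded s_def H_def]
    let ?M = "\<integral>k. k powr (3 - \<alpha>) * gexp t k \<partial>hl"
    let ?S = "\<integral>k. k * H k * gexp t k \<partial>hl"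
    have z: "(\<integral>r. r * gauss4 s r \<partial>hl) = (\<integral>r. 0 * (r * gexp s r) \<partial>hl)"
    proof (rule integral_by_parts_gauss4[where ?p1.0="\<lambda>_. 1" and ?p2.0="\<lambda>_. 0" and ?p3.0="\<lambda>_. 0", OF s])
      show "cubic_growth {0<..} (\<lambda>_. 1)" "cubic_growth {0<..} (\<lambda>_. 0)" "cubic_growth {0<..} (\<lambda>_. 0)"
        by (rule cubic_growth_bounded[where C=1], simp)+
    qed (auto intro!: derivative_eq_intros tendsto_eq_intros cubic_growth_id)
    have i1: "integrable hl (\<lambda>r. r * gauss4 s r)"
      by (rule integrable_growth_gauss4[OF s _ cubic_growth_id]) (auto intro!: measurable_hl)
    have i2: "integrable hl (\<lambda>r. r powr (1 + \<alpha>) * gauss4 s r)"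
    proof (rule integrable_growth_gauss4[OF s _ cubic_growthI[where C=1]])
      show "(\<lambda>r. r powr (1 + \<alpha>)) \<in> borel_measurable hl" by (rule measurable_hl) measurable
      show "\<bar>r powr (1 + \<alpha>)\<bar> \<le> 1 * (1 + r ^ 3)" if "r \<in> {0<..}" for r :: real
      proof (cases "r \<le> 1")
        case True
        have r: "0 < r" using that by simp
        with True have "r powr (1 + \<alpha>) \<le> 1" using \<alpha> by (simp add: powr_le1)
        moreover have "0 \<le> r ^ 3" using r by simp
        ultimately have "r powr (1 + \<alpha>) \<le> 1 + r ^ 3" by linarith
        then show ?thesis by simp
      next
        case False
        then have "r powr (1 + \<alpha>) \<le> r powr 3" using \<alpha> by (intro powr_mono) auto
        then show ?thesis using that by (simp add: powr_numeral)
      qed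
    qed
    have split: "r * \<gamma> 0 r * gauss4 s r = (r * \<gamma> 0 r - g0 * r + c * r powr (1 + \<alpha>)) * gauss4 s r
        + g0 * (r * gauss4 s r) - c * (r powr (1 + \<alpha>) * gauss4 s r)" for r
      by (simp add: algebra_simps)
    have "(\<integral>r. r * \<gamma> 0 r * gauss4 s r \<partial>hl) = (\<integral>r. p r * (r * gexp s r) \<partial>hl) + g0 * 0
        - c * (- (sqrt (pi / s) / (4 * s)) / sinc_moment \<alpha> * ?M)"
      unfolding split using pg[OF s] i1 i2 z pe[OF s] P(2) by simp
    also have "(\<integral>r. p r * (r * gexp s r) \<partial>hl) = 4 * t / sqrt (pi / t) * ?S"
      unfolding S(2) using t by simp
    finally have I: "(\<integral>r. r * \<gamma> 0 r * gauss4 s r \<partial>hl) = 4 * t / sqrt (pi / t) * ?S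
        + sqrt (pi / s) / (4 * s) * (c / sinc_moment \<alpha> * ?M)" by simp
    have "(\<integral>k. k ^ 4 * e k * gexp t k \<partial>hl) = W * (\<integral>r. r * \<gamma> 0 r * gauss4 s r \<partial>hl)"
      by (rule M(2))
    also have "\<dots> = (W * (4 * t / sqrt (pi / t))) * ?S + (W * (sqrt (pi / s) / (4 * s))) * (c / sinc_moment \<alpha> * ?M)"
      unfolding I by (simp only: distrib_left mult.assoc)
    also have "W * (4 * t / sqrt (pi / t)) = 16 * pi\<^sup>2"
    proof -
      have "sqrt (pi / t) * sqrt (pi / t) = pi / t" using t by simp
      moreover have "W * (4 * t / sqrt (pi / t)) = (sqrt (pi / t) * sqrt (pi / t)) * (16 * pi * t)"
        using t by (simp add: W_def power3_eq_cube)
      ultimately show ?thesis using t by (simp add: power2_eq_square)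
    qed
    also have "W * (sqrt (pi / s) / (4 * s)) = 8 * pi ^ 3"
    proof -
      have "sqrt (pi / s) = 2 * sqrt (pi * t)" using t by (simp add: s_def real_sqrt_mult)
      moreover have "1 / (4 * s) = t" by (rule ts)
      ultimately have "W * (sqrt (pi / s) / (4 * s)) = (sqrt (pi / t) * sqrt (pi / t)) * (sqrt (pi * t) * sqrt (pi / t)) * (8 * pi * t)"
        by (simp add: W_def power3_eq_cube s_def)
      moreover have "sqrt (pi * t) * sqrt (pi / t) = pi" using t by (simp flip: real_sqrt_mult)
      moreover have "sqrt (pi / t) * sqrt (pi / t) = pi / t" using t by simp
      ultimately show ?thesis using t by (simp add: power3_eq_cube)
    qed
    finally have eq: "(\<integral>k. k ^ 4 * e k * gexp t k \<partial>hl)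
        = 16 * pi\<^sup>2 * ?S + 8 * pi ^ 3 * (c / sinc_moment \<alpha> * ?M)" .
    have d: "(k ^ 4 * e k - (8 * pi ^ 3 * c / sinc_moment \<alpha> * k powr (3 - \<alpha>) + 16 * pi\<^sup>2 * (k * H k))) * gexp t k
        = k ^ 4 * e k * gexp t k - (8 * pi ^ 3 * c / sinc_moment \<alpha> * (k powr (3 - \<alpha>) * gexp t k)
          + 16 * pi\<^sup>2 * (k * H k * gexp t k))" for k
      by (simp add: algebra_simps)
    show "integrable hl (\<lambda>k. (k ^ 4 * e k - (8 * pi ^ 3 * c / sinc_moment \<alpha> * k powr (3 - \<alpha>) + 16 * pi\<^sup>2 * (k * H k))) * gexp t k)"
      unfolding d by (intro Bochner_Integration.integrable_diff Bochner_Integration.integrable_add integrable_mult_right M(1) P(1) S(1))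
    show "(\<integral>k. (k ^ 4 * e k - (8 * pi ^ 3 * c / sinc_moment \<alpha> * k powr (3 - \<alpha>) + 16 * pi\<^sup>2 * (k * H k))) * gexp t k \<partial>hl) = 0"
    proof -
      have lin: "(\<integral>k. f k - (a * g k + b * h k) \<partial>hl) = (\<integral>k. f k \<partial>hl) - (a * (\<integral>k. g k \<partial>hl) + b * (\<integral>k. h k \<partial>hl))"
        if "integrable hl f" "integrable hl g" "integrable hl h" for f g h and a b :: real
        using that by simp
      have "(\<integral>k. k ^ 4 * e k * gexp t k - (8 * pi ^ 3 * c / sinc_moment \<alpha> * (k powr (3 - \<alpha>) * gexp t k)
          + 16 * pi\<^sup>2 * (k * H k * gexp t k)) \<partial>hl)
        = (\<integral>k. k ^ 4 * e k * gexp t k \<partial>hl) - (8 * pi ^ 3 * c / sinc_moment \<alpha> * ?M + 16 * pi\<^sup>2 * ?S)"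
        by (rule lin[OF M(1) P(1) S(1)])
      then show ?thesis unfolding d eq by simp
    qed
  qed
  then have "AE k in hl. k ^ 4 * e k = 8 * pi ^ 3 * c / sinc_moment \<alpha> * k powr (3 - \<alpha>)
       + 16 * pi\<^sup>2 * (k * (\<integral>r. sin (k * r) * p r \<partial>hl))"
    by eventually_elim (simp add: H_def)
  with p show ?thesis by (rule that)
qed

section \<open>Power laws for the structure function and the spectrum\<close>

theorem proposition4p1:
  fixes \<nu> :: "(real^3^3) measure"
    and u :: "real^3 \<Rightarrow> real^3"
    and E :: "real \<Rightarrow> real"
    and \<alpha> :: real
  assumes "normalized_haar_O3 \<nu>"
    and "square_integrable u"
    and "energy_spectrum \<nu> u E"
    and "decay_assumption (correlation \<nu> u)"
    and "0 < \<alpha>" and "\<alpha> < 2"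
  shows "(\<forall>c l\<^sub>0. 0 < c \<and> 0 < l\<^sub>0 \<and>
            (\<forall>l. 0 \<le> l \<and> l < l\<^sub>0 \<longrightarrow> structure2 \<nu> u l = c * l powr \<alpha>) \<longrightarrow>
            (\<exists>C c\<^sub>0. 0 < c\<^sub>0 \<and> (C \<longlongrightarrow> c\<^sub>0) at_top \<and>
              (AE \<kappa> in lebesgue. 0 < \<kappa> \<longrightarrow> E \<kappa> = C \<kappa> / \<kappa> powr (1 + \<alpha>)))) \<and>
         (\<forall>c \<kappa>\<^sub>0. 0 < c \<and> 0 < \<kappa>\<^sub>0 \<and>
            (AE \<kappa> in lebesgue. \<kappa>\<^sub>0 \<le> \<kappa> \<longrightarrow> E \<kappa> = c * \<kappa> powr (- 1 - \<alpha>)) \<longrightarrow>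
            (\<exists>C c\<^sub>0. 0 < c\<^sub>0 \<and> (C \<longlongrightarrow> c\<^sub>0) (at_right 0) \<and>
              (\<forall>l\<ge>0. structure2 \<nu> u l = C l * l powr \<alpha>)))"
proof -
  note haar = assms(1) and u = assms(2) and \<alpha> = assms(5,6)
  define \<gamma> where "\<gamma> j r = iter_partial (replicate j 1) (correlation \<nu> u) (r *\<^sub>R axis 1 1)" for j r
  have \<gamma>0: "\<gamma> 0 = (\<lambda>r. correlation \<nu> u (r *\<^sub>R axis 1 1))" by (simp add: \<gamma>_def fun_eq_iff)
  have S2: "structure2 \<nu> u l = \<gamma> 0 0 - \<gamma> 0 l" for l
    by (simp add: \<gamma>0 structure2_eq_correlation[OF haar u])
  have \<gamma>c: "continuous_on UNIV (\<gamma> 0)"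
    unfolding \<gamma>0 by (rule continuous_on_compose2[OF continuous_on_correlation[OF haar u]]) (auto intro!: continuous_intros)
  obtain e where pair: "spectral_pair e (\<gamma> 0)" and Ee: "AE r in lborel. 0 < r \<longrightarrow> E r = e r"
    using energy_spectrum_gauss_moments[OF haar u assms(3)] unfolding \<gamma>0 by blast
  have A: "0 < sinc_moment \<alpha>" by (rule sinc_moment_pos[OF \<alpha>])
  show ?thesis
  proof (intro conjI allI impI; elim conjE)
    fix c l0 :: real
    assume c: "0 < c" and l0: "0 < l0" and law: "\<forall>l. 0 \<le> l \<and> l < l0 \<longrightarrow> structure2 \<nu> u l = c * l powr \<alpha>"
    have law': "\<gamma> 0 r = \<gamma> 0 0 - c * r powr \<alpha>" if "0 < r" "r < l0" for r
    proof -
      have "structure2 \<nu> u r = c * r powr \<alpha>" using law that by simp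
      then show ?thesis using S2[of r] by linarith
    qed
    obtain p where p: "integrable hl p"
      and pe: "AE k in hl. k ^ 4 * e k = 8 * pi ^ 3 * c / sinc_moment \<alpha> * k powr (3 - \<alpha>)
       + 16 * pi\<^sup>2 * (k * (\<integral>r. sin (k * r) * p r \<partial>hl))"
      using spectrum_of_power_law[OF pair
          decay_radial_profile(1)[OF assms(4), folded \<gamma>_def] decay_radial_profile(2)[OF assms(4), folded \<gamma>_def]
          \<alpha> l0 law'] by blast
    define H where "H k = (\<integral>r. sin (k * r) * p r \<partial>hl)" for k
    define c0 where "c0 = 8 * pi ^ 3 * c / sinc_moment \<alpha>"
    \<comment> \<open>The bracket in \<open>k\<^sup>4 E(k) = k^(3-\<alpha>) (c0 + 16\<pi>\<^sup>2 k^(\<alpha>-2) H(k))\<close>.\<close>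
    define C where "C k = c0 + 16 * pi\<^sup>2 * (k powr (\<alpha> - 2) * H k)" for k
    have "0 < c0" using c A by (simp add: c0_def)
    moreover have "(C \<longlongrightarrow> c0) at_top"
    proof -
      define B where "B = (\<integral>r. \<bar>p r\<bar> \<partial>hl)"
      have HB: "\<bar>H k\<bar> \<le> B" for k
      proof -
        have m: "(\<lambda>r. sin (k * r)) \<in> borel_measurable hl" by (rule measurable_hl) measurable
        have b: "\<bar>sin (k * r) * p r\<bar> \<le> \<bar>p r\<bar>" for r
          by (simp add: abs_mult mult_left_le_one_le)
        have i: "integrable hl (\<lambda>r. sin (k * r) * p r)"
          by (rule Bochner_Integration.integrable_bound[OF p]) (use m p b in \<open>auto intro!: borel_measurable_times\<close>)
        show ?thesis unfolding H_def B_def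
          by (rule order_trans[OF integral_abs_bound], rule integral_mono) (use i p b in auto)
      qed
      have "((\<lambda>k. k powr (\<alpha> - 2) * H k) \<longlongrightarrow> 0) at_top"
      proof (rule Lim_null_comparison)
        show "eventually (\<lambda>k. norm (k powr (\<alpha> - 2) * H k) \<le> k powr (\<alpha> - 2) * B) at_top"
          using HB by (intro always_eventually allI) (simp add: abs_mult mult_left_mono)
        have "((\<lambda>k::real. k powr (\<alpha> - 2)) \<longlongrightarrow> 0) at_top" using \<alpha> by real_asymp
        from tendsto_mult_right[OF this, of B]
        show "((\<lambda>k. k powr (\<alpha> - 2) * B) \<longlongrightarrow> 0) at_top" by simp
      qed
      then have "(C \<longlongrightarrow> c0 + 16 * pi\<^sup>2 * 0) at_top" unfolding C_def[abs_def] by (intro tendsto_intros)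
      then show ?thesis by simp
    qed
    moreover have "AE k in lebesgue. 0 < k \<longrightarrow> E k = C k / k powr (1 + \<alpha>)"
    proof (rule AE_completion)
      have "AE k in lborel. k \<in> {0<..} \<longrightarrow> k ^ 4 * e k = c0 * k powr (3 - \<alpha>) + 16 * pi\<^sup>2 * (k * H k)"
        using pe unfolding H_def[symmetric] c0_def[symmetric] by (subst (asm) AE_restrict_space_iff) auto
      then show "AE k in lborel. 0 < k \<longrightarrow> E k = C k / k powr (1 + \<alpha>)"
        using Ee
      proof eventually_elim
        case (elim k)
        show ?case
        proof
          assume k: "0 < k"
          have k4: "k ^ 4 = k powr 4" using k by (simp add: powr_numeral)
          have k1: "k = k powr 1" using k by simp
          have expand: "x * ((b + a * (y * h)) / z) = b * (x / z) + a * (x * y / z * h)" for x y z a b h :: real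
            by (simp add: add_divide_distrib distrib_left mult_ac)
          have "k powr 4 * (C k / k powr (1 + \<alpha>)) = c0 * (k powr 4 / k powr (1 + \<alpha>))
              + 16 * pi\<^sup>2 * (k powr 4 * k powr (\<alpha> - 2) / k powr (1 + \<alpha>) * H k)"
            unfolding C_def by (rule expand)
          also have "k powr 4 / k powr (1 + \<alpha>) = k powr (3 - \<alpha>)" by (simp flip: powr_diff)
          also have "k powr 4 * k powr (\<alpha> - 2) / k powr (1 + \<alpha>) = k powr 1" by (simp only: powr_add[symmetric] powr_diff[symmetric]) simp
          finally have "k powr 4 * (C k / k powr (1 + \<alpha>)) = k ^ 4 * e k" using elim k by simp
          then have "k ^ 4 * (C k / k powr (1 + \<alpha>)) = k ^ 4 * e k" by (simp only: k4)
          then have "C k / k powr (1 + \<alpha>) = e k"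
            by (rule mult_left_cancel[THEN iffD1, rotated]) (use k in simp)
          then show "E k = C k / k powr (1 + \<alpha>)" using elim k by simp
        qed
      qed
    qed
    ultimately show "\<exists>C c\<^sub>0. 0 < c\<^sub>0 \<and> (C \<longlongrightarrow> c\<^sub>0) at_top \<and>
              (AE \<kappa> in lebesgue. 0 < \<kappa> \<longrightarrow> E \<kappa> = C \<kappa> / \<kappa> powr (1 + \<alpha>))" by blast
  next
    fix c k0 :: real
    assume c: "0 < c" and k0: "0 < k0" and law: "AE \<kappa> in lebesgue. k0 \<le> \<kappa> \<longrightarrow> E \<kappa> = c * \<kappa> powr (- 1 - \<alpha>)"
    have "AE k in lborel. k0 \<le> k \<longrightarrow> E k = c * k powr (- 1 - \<alpha>)" using law by (simp only: AE_completion_iff)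
    then have "AE k in lborel. k \<in> {0<..} \<longrightarrow> k0 \<le> k \<longrightarrow> e k = c * k powr (- 1 - \<alpha>)"
      using Ee by eventually_elim auto
    then have law': "AE k in hl. k0 \<le> k \<longrightarrow> e k = c * k powr (- 1 - \<alpha>)"
      by (subst AE_restrict_space_iff) auto
    define c0 where "c0 = c * sinc_moment \<alpha> / (8 * pi ^ 3)"
    obtain K where K: "\<And>l. 0 < l \<Longrightarrow> \<bar>\<gamma> 0 0 - \<gamma> 0 l - c0 * l powr \<alpha>\<bar> \<le> K * l\<^sup>2"
      using spectral_pair.increment_of_power_spectrum[OF pair \<gamma>c \<alpha> c k0 law'] unfolding c0_def by blast
    define C where "C l = structure2 \<nu> u l / l powr \<alpha>" for l
    have "0 < c0" using c A by (simp add: c0_def)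
    moreover have "(C \<longlongrightarrow> c0) (at_right 0)"
    proof -
      have "((\<lambda>l. C l - c0) \<longlongrightarrow> 0) (at_right 0)"
      proof (rule Lim_null_comparison)
        show "eventually (\<lambda>l. norm (C l - c0) \<le> K * l powr (2 - \<alpha>)) (at_right 0)"
          using eventually_at_right_real[OF zero_less_one]
        proof eventually_elim
          case (elim l)
          then have l: "0 < l" by simp
          have "C l - c0 = (\<gamma> 0 0 - \<gamma> 0 l - c0 * l powr \<alpha>) / l powr \<alpha>"
            using l by (simp add: C_def S2 diff_divide_distrib)
          then have "norm (C l - c0) = \<bar>\<gamma> 0 0 - \<gamma> 0 l - c0 * l powr \<alpha>\<bar> / l powr \<alpha>" by simp
          also have "\<dots> \<le> K * l\<^sup>2 / l powr \<alpha>" by (intro divide_right_mono K l) simp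
          also have "\<dots> = K * (l powr 2 / l powr \<alpha>)" using l by (simp add: powr_numeral)
          also have "l powr 2 / l powr \<alpha> = l powr (2 - \<alpha>)" by (simp flip: powr_diff)
          finally show ?case .
        qed
        have "((\<lambda>l::real. l powr (2 - \<alpha>)) \<longlongrightarrow> 0) (at_right 0)" using \<alpha> by real_asymp
        from tendsto_mult_left[OF this, of K]
        show "((\<lambda>l. K * l powr (2 - \<alpha>)) \<longlongrightarrow> 0) (at_right 0)" by simp
      qed
      then show ?thesis by (simp add: LIM_zero_iff)
    qed
    \<comment> \<open>At \<open>l = 0\<close> both sides are \<open>0\<close>, the right one because \<open>0 powr \<alpha> = 0\<close>.\<close>
    moreover have "structure2 \<nu> u l = C l * l powr \<alpha>" if "0 \<le> l" for l
      using that by (cases "l = 0") (simp_all add: C_def S2)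
    ultimately show "\<exists>C c\<^sub>0. 0 < c\<^sub>0 \<and> (C \<longlongrightarrow> c\<^sub>0) (at_right 0) \<and>
              (\<forall>l\<ge>0. structure2 \<nu> u l = C l * l powr \<alpha>)" by blast
  qed
qed

end
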